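(* For $a>0$ let $M_a(v)=\frac{e^{-v^2/(2a)}}{\sqrt{2\pi a}}$, and let $$f_N(v)=\delta_N M_{\frac{1}{2\delta_N}}(v)+(1-\delta_N)M_{\frac{1}{2(1-\delta_N)}}(v),\qquad v\in\mathbb{R},$$ where $\delta_N=\frac{1}{N^{\eta}}$ with $\eta$ close to $1$. Then the family of probability densities on $\mathbb{S}^{N-1}(\sqrt N)$ defined by $$F_N(v_1,\dots,v_N)=\frac{\prod_{i=1}^N f_N(v_i)}{\int_{\mathbb{S}^{N-1}(\sqrt N)}\prod_{i=1}^N f_N(v_i)\,d\sigma^N}$$ is $M_{\frac12}$-chaotic but not entropically chaotic.
   Context: $\mathbb{S}^{N-1}(\sqrt N)\subset\mathbb{R}^N$ is the sphere of radius $\sqrt N$ centered at the origin (Kac's sphere) and $d\sigma^N$ is the uniform probability measure on it. A probability density on $\mathbb{S}^{N-1}(\sqrt N)$ is taken with respect to $d\sigma^N$; it is symmetric if it is invariant under all permutations of the coordinates $v_1,\dots,v_N$. A family $\{F_N\}$ of symmetric probability densities on $\mathbb{S}^{N-1}(\sqrt N)$ is $f$-chaotic, where $f$ is a probability density on $\mathbb{R}$, if for every $k\in\mathbb{N}$ the $k$-th marginals $\Pi_k(F_N)$ (the law of $(v_1,\dots,v_k)$ under $F_N\,d\sigma^N$) converge as $N\to\infty$ to $f^{\otimes k}(v_1,\dots,v_k)=\prod_{i=1}^k f(v_i)$ weakly, i.e. for every bounded continuous $\phi$ on $\mathbb{R}^k$, $\int_{\mathbb{S}^{N-1}(\sqrt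 N)}F_N\,\phi(v_1,\dots,v_k)\,d\sigma^N\to\int_{\mathbb{R}^k}f^{\otimes k}\phi\,dv_1\cdots dv_k$. Let $H_N(F_N)=\int_{\mathbb{S}^{N-1}(\sqrt N)}F_N\log F_N\,d\sigma^N$, let $\gamma(x)=e^{-x^2/2}/\sqrt{2\pi}$, and let $H(f|\gamma)=\int_{\mathbb{R}}f\log(f/\gamma)\,dx$. The family $\{F_N\}$ is entropically chaotic if it is $f$-chaotic for some $f$ and $\lim_{N\to\infty}H_N(F_N)/N=H(f|\gamma)$. *)

theory Defs
  imports "HOL-Probability.Probability" "HOL-Combinatorics.Permutations"
begin

text \<open>
  The dimension \<open>N\<close> varies, so a point \<open>(v\<^sub>1, \<dots>, v\<^sub>N)\<close> of N-space is an extensional function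
  on \<open>{..<N}\<close>, the coordinate \<open>v\<^sub>i\<close> being \<open>v (i - 1)\<close>.
\<close>

definition kac_sphere :: "nat \<Rightarrow> (nat \<Rightarrow> real) set" where
  "kac_sphere N = {v \<in> {..<N} \<rightarrow>\<^sub>E UNIV. (\<Sum>i<N. (v i)\<^sup>2) = real N}"

definition kac_ball :: "nat \<Rightarrow> (nat \<Rightarrow> real) set" where
  "kac_ball N = {v \<in> {..<N} \<rightarrow>\<^sub>E UNIV. (\<Sum>i<N. (v i)\<^sup>2) \<le> real N}"

definition radial_projection :: "nat \<Rightarrow> (nat \<Rightarrow> real) \<Rightarrow> (nat \<Rightarrow> real)" where
  "radial_projection N v = (\<lambda>i\<in>{..<N}. sqrt (real N) * v i / sqrt (\<Sum>j<N. (v j)\<^sup>2))"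

text \<open>
  The uniform probability measure on Kac's sphere, as normalised cone measure: the mass of a
  subset of the sphere is the proportion of the ball filled by the cone over it. It is a measure
  on all of N-space; lemma \<open>AE_kac_measure\<close> below says that it is carried by the sphere.
\<close>

definition kac_measure :: "nat \<Rightarrow> (nat \<Rightarrow> real) measure" where
  "kac_measure N =
     distr (uniform_measure (\<Pi>\<^sub>M i\<in>{..<N}. lborel) (kac_ball N)) (\<Pi>\<^sub>M i\<in>{..<N}. borel)
       (radial_projection N)"

definition symmetric_density :: "nat \<Rightarrow> ((nat \<Rightarrow> real) \<Rightarrow> real) \<Rightarrow> bool" where
  "symmetric_density N F \<longleftrightarrow>
     F \<in> borel_measurable (kac_measure N) \<and>
     (\<forall>v\<in>kac_sphere N. 0 \<le> F v) \<and>
     (\<integral>\<^sup>+v. ennreal (F v) \<partial>kac_measure N) = 1 \<and>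
     (\<forall>\<pi>. \<pi> permutes {..<N} \<longrightarrow> (\<forall>v\<in>kac_sphere N. F (v \<circ> \<pi>) = F v))"

definition real_density :: "(real \<Rightarrow> real) \<Rightarrow> bool" where
  "real_density f \<longleftrightarrow>
     f \<in> borel_measurable borel \<and> (\<forall>x. 0 \<le> f x) \<and> (\<integral>\<^sup>+x. ennreal (f x) \<partial>lborel) = 1"

text \<open>
  The k-th marginal is meaningful only for \<open>N \<ge> k\<close>; the finitely many other \<open>N\<close> do not affect
  the limit.
\<close>

definition chaotic :: "(nat \<Rightarrow> (nat \<Rightarrow> real) \<Rightarrow> real) \<Rightarrow> (real \<Rightarrow> real) \<Rightarrow> bool" where
  "chaotic F f \<longleftrightarrow>
     (\<forall>N\<ge>1. symmetric_density N (F N)) \<and> real_density f \<and>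
     (\<forall>k. \<forall>\<phi> :: (nat \<Rightarrow> real) \<Rightarrow> real.
        continuous_map (powertop_real {..<k}) euclideanreal \<phi> \<and>
        bounded (\<phi> ` ({..<k} \<rightarrow>\<^sub>E UNIV)) \<longrightarrow>
        (\<lambda>N. \<integral>v. F N v * \<phi> (restrict v {..<k}) \<partial>kac_measure N)
          \<longlonglongrightarrow> (\<integral>v. (\<Prod>i<k. f (v i)) * \<phi> v \<partial>(\<Pi>\<^sub>M i\<in>{..<k}. lborel)))"

text \<open>
  Entropies may be infinite, whereas the Bochner integral of a non-integrable function is 0, so
  the integral is taken with extended real values. In both uses below the negative part has a
  finite integral, since \<open>x log x\<close> is bounded below and the reference measure is a probability;
  hence \<open>\<infinity> - \<infinity>\<close> does not occur.
\<close>

definition extended_integral :: "'a measure \<Rightarrow> ('a \<Rightarrow> real) \<Rightarrow> ereal" where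
  "extended_integral M g =
     enn2ereal (\<integral>\<^sup>+x. ennreal (g x) \<partial>M) - enn2ereal (\<integral>\<^sup>+x. ennreal (- g x) \<partial>M)"

definition kac_entropy :: "nat \<Rightarrow> ((nat \<Rightarrow> real) \<Rightarrow> real) \<Rightarrow> ereal" where
  "kac_entropy N F = extended_integral (kac_measure N) (\<lambda>v. F v * ln (F v))"

definition relative_entropy :: "(real \<Rightarrow> real) \<Rightarrow> (real \<Rightarrow> real) \<Rightarrow> ereal" where
  "relative_entropy f g = extended_integral lborel (\<lambda>x. f x * ln (f x / g x))"

definition entropically_chaotic :: "(nat \<Rightarrow> (nat \<Rightarrow> real) \<Rightarrow> real) \<Rightarrow> bool" where
  "entropically_chaotic F \<longleftrightarrow>
     (\<exists>f. chaotic F f \<and>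
        (\<lambda>N. kac_entropy N (F N) / ereal (real N)) \<longlonglongrightarrow> relative_entropy f std_normal_density)"

definition maxwellian :: "real \<Rightarrow> real \<Rightarrow> real" where
  "maxwellian a v = exp (- v\<^sup>2 / (2 * a)) / sqrt (2 * pi * a)"

text \<open>
  For \<open>\<delta> = 1\<close> (which occurs below for \<open>N = 1\<close>) the second summand is 0, so the mixture is
  \<open>maxwellian (1/2)\<close>.
\<close>

definition maxwellian_mixture :: "real \<Rightarrow> real \<Rightarrow> real" where
  "maxwellian_mixture \<delta> v =
     \<delta> * maxwellian (1 / (2 * \<delta>)) v + (1 - \<delta>) * maxwellian (1 / (2 * (1 - \<delta>))) v"

definition conditioned_tensor :: "nat \<Rightarrow> (real \<Rightarrow> real) \<Rightarrow> (nat \<Rightarrow> real) \<Rightarrow> real" where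
  "conditioned_tensor N f v = (\<Prod>i<N. f (v i)) / (\<integral>w. (\<Prod>i<N. f (w i)) \<partial>kac_measure N)"

lemma sets_kac_measure [simp, measurable_cong]:
  "sets (kac_measure N) = sets (\<Pi>\<^sub>M i\<in>{..<N}. borel)"
  by (simp add: kac_measure_def)

lemma space_kac_measure [simp]: "space (kac_measure N) = {..<N} \<rightarrow>\<^sub>E UNIV"
  by (simp add: kac_measure_def space_PiM)

lemma kac_ball_sets [measurable]: "kac_ball N \<in> sets (\<Pi>\<^sub>M i\<in>{..<N}. lborel)"
proof -
  have "kac_ball N = {v \<in> space (\<Pi>\<^sub>M i\<in>{..<N}. lborel). (\<Sum>i<N. (v i)\<^sup>2) \<le> real N}"
    by (simp add: kac_ball_def space_PiM)
  also have "\<dots> \<in> sets (\<Pi>\<^sub>M i\<in>{..<N}. lborel)"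
    by measurable
  finally show ?thesis .
qed

lemma radial_projection_measurable [measurable]:
  "radial_projection N \<in> (\<Pi>\<^sub>M i\<in>{..<N}. lborel) \<rightarrow>\<^sub>M (\<Pi>\<^sub>M i\<in>{..<N}. borel)"
  unfolding radial_projection_def by measurable

lemma emeasure_box:
  assumes "a \<le> b"
  shows "emeasure (\<Pi>\<^sub>M i\<in>{..<N}. lborel) ({..<N} \<rightarrow>\<^sub>E {a..b}) = ennreal ((b - a) ^ N)"
proof -
  interpret product_sigma_finite "\<lambda>_::nat. lborel :: real measure"
    by standard
  have "emeasure (\<Pi>\<^sub>M i\<in>{..<N}. lborel) ({..<N} \<rightarrow>\<^sub>E {a..b})
      = (\<Prod>i<N. emeasure lborel {a..b})"
    by (subst emeasure_PiM) auto
  then show ?thesis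
    using assms by (simp add: ennreal_power)
qed

lemma emeasure_kac_ball:
  shows "emeasure (\<Pi>\<^sub>M i\<in>{..<N}. lborel) (kac_ball N) \<noteq> 0"
    and "emeasure (\<Pi>\<^sub>M i\<in>{..<N}. lborel) (kac_ball N) \<noteq> \<infinity>"
proof -
  let ?L = "\<Pi>\<^sub>M i\<in>{..<N}. (lborel :: real measure)"
  have "({..<N} \<rightarrow>\<^sub>E {0..1}) \<subseteq> kac_ball N"
  proof
    fix v :: "nat \<Rightarrow> real" assume v: "v \<in> {..<N} \<rightarrow>\<^sub>E {0..1}"
    have "(\<Sum>i<N. (v i)\<^sup>2) \<le> (\<Sum>i<N. 1)"
      using v by (intro sum_mono power_le_one) (auto simp: PiE_iff)
    then show "v \<in> kac_ball N"
      using v by (auto simp: kac_ball_def PiE_iff)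
  qed
  then have "emeasure ?L ({..<N} \<rightarrow>\<^sub>E {0..1}) \<le> emeasure ?L (kac_ball N)"
    by (intro emeasure_mono) auto
  then show "emeasure ?L (kac_ball N) \<noteq> 0"
    using emeasure_box[of 0 1 N] by auto
  have "kac_ball N \<subseteq> ({..<N} \<rightarrow>\<^sub>E {- sqrt N..sqrt N})"
  proof
    fix v assume v: "v \<in> kac_ball N"
    have "\<bar>v i\<bar> \<le> sqrt N" if "i < N" for i
    proof -
      have "(v i)\<^sup>2 \<le> (\<Sum>i<N. (v i)\<^sup>2)"
        using that by (intro member_le_sum) auto
      also have "\<dots> \<le> N"
        using v by (simp add: kac_ball_def)
      finally show ?thesis
        using real_le_rsqrt[of "\<bar>v i\<bar>" "real N"] by simp
    qed
    then show "v \<in> {..<N} \<rightarrow>\<^sub>E {- sqrt N..sqrt N}"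
      using v by (auto simp: kac_ball_def PiE_iff abs_le_iff minus_le_iff)
  qed
  then have "emeasure ?L (kac_ball N) \<le> emeasure ?L ({..<N} \<rightarrow>\<^sub>E {- sqrt N..sqrt N})"
    by (intro emeasure_mono sets_PiM_I_finite) auto
  then show "emeasure ?L (kac_ball N) \<noteq> \<infinity>"
    using emeasure_box[of "- sqrt N" "sqrt N" N] by (auto simp: top_unique)
qed

lemma prob_space_kac_measure: "prob_space (kac_measure N)"
proof -
  interpret U: prob_space "uniform_measure (\<Pi>\<^sub>M i\<in>{..<N}. lborel) (kac_ball N)"
    using emeasure_kac_ball[of N] by (intro prob_space_uniform_measure) auto
  show ?thesis
    unfolding kac_measure_def by (rule U.prob_space_distr) simp
qed

lemma AE_kac_measure:
  assumes "N \<ge> 1"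
  shows "AE v in kac_measure N. v \<in> kac_sphere N"
proof -
  let ?L = "\<Pi>\<^sub>M i\<in>{..<N}. (lborel :: real measure)"
  have "emeasure ?L ({..<N} \<rightarrow>\<^sub>E {0..0}) = 0"
    using emeasure_box[of 0 0 N] assms by (simp add: power_0_left)
  then have "AE v in ?L. v \<notin> {..<N} \<rightarrow>\<^sub>E {0..0}"
    by (intro AE_not_in null_setsI sets_PiM_I_finite) auto
  then have "AE v in uniform_measure ?L (kac_ball N). v \<notin> {..<N} \<rightarrow>\<^sub>E {0..0}"
    by (intro AE_uniform_measureI) (auto elim: eventually_mono)
  then have "AE v in uniform_measure ?L (kac_ball N). radial_projection N v \<in> kac_sphere N"
    using AE_space
  proof eventually_elim
    case (elim v)
    let ?s = "\<Sum>j<N. (v j)\<^sup>2"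
    have "?s \<noteq> 0"
      using elim by (force simp: space_PiM sum_nonneg_eq_0_iff PiE_iff simp del: PiE_singleton
          atLeastAtMost_singleton)
    moreover have "?s \<ge> 0"
      by (simp add: sum_nonneg)
    ultimately show ?case
      by (simp add: kac_sphere_def radial_projection_def power_divide power_mult_distrib
          flip: sum_divide_distrib sum_distrib_left)
  qed
  moreover have "{v \<in> space (\<Pi>\<^sub>M i\<in>{..<N}. borel). v \<in> kac_sphere N}
      = {v \<in> space (\<Pi>\<^sub>M i\<in>{..<N}. borel). (\<Sum>i<N. (v i)\<^sup>2) = real N}"
    by (auto simp: kac_sphere_def space_PiM)
  moreover have "\<dots> \<in> sets (\<Pi>\<^sub>M i\<in>{..<N}. borel)"
    by measurable
  ultimately show ?thesis
    unfolding kac_measure_def by (subst AE_distr_iff) auto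
qed

end

theory Submission
  imports Defs "HOL-Real_Asymp.Real_Asymp"
begin

text \<open>
  Under the product law \<open>f\<^sub>N\<^sup>\<otimes>\<^sup>N\<close> the expected energy is \<open>N\<close>, half of it carried by the
  cold component and half by the rare hot particles. Kac's measure is also the radial projection of
  the uniform measure on the shell \<open>N - 1 < |v|\<^sup>2 \<le> N\<close>, on which the projection changes the product
  density by a factor between \<open>1/e\<close> and \<open>1\<close>. Hence \<open>F\<^sub>N\<close> is the projection of the product law
  reweighted by a function between \<open>1/e\<close> and \<open>1\<close> on the shell and \<open>0\<close> elsewhere. The shell has
  probability at least \<open>exp (- o(N))\<close>, since a single hot particle can supply the energy missing from
  the cold ones. Hoeffding's inequality for averages over disjoint blocks of coordinates has
  exponentially small error, which survives the division by this probability; so block averages under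
  \<open>F\<^sub>N\<close> have the same limits as under the product law, which gives chaoticity.

  The energy splits in the limit: pointwise \<open>- ln (f\<^sub>N v)\<close> is at most
  \<open>(ln \<pi>)/2 + o(1) + \<delta> v\<^sup>2 + min (v\<^sup>2) L\<close> with \<open>L = 3 ln N\<close>, and the truncated energy has mean tending to
  \<open>1/2\<close>, not \<open>1\<close>. With Stirling's bound for the volume of the shell this shows that
  \<open>H\<^sub>N(F\<^sub>N)/N\<close> has a lower limit of at least \<open>(ln 2)/2 - 1/8\<close>, whereas the relative entropy of the
  limit is \<open>(ln 2)/2 - 1/4\<close>.
\<close>

section \<open>Kac's measure as the projection of a shell\<close>

text \<open>The classical tool, a local central limit theorem for the total energy, is delicate
  here: the fourth moment of \<open>f\<^sub>N\<close> is of order 1/\<delta> and grows with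
  \<open>N\<close>. Comparing exponential rates avoids it. The hot particle bound gives the shell a
  probability of at least exp (- 3 sqrt N) up to a power of \<open>N\<close>, for every \<delta>
  between 1/N^2 and 1/sqrt N, and a Hoeffding error exponential in \<open>N\<close>, or even in
  N/(ln N)^2, is still far smaller. This is why all exponents strictly between 1/2 and 2 are
  covered.

  The gap has a simple source. Relative entropy with respect to the standard Gaussian contains half
  of the energy. The hot particles are too few to be seen by any fixed marginal, so the limit has
  lost the energy 1/2 and its relative entropy drops by 1/4. The entropy estimate therefore uses the
  fixed accuracy 1/8, half of the gap, and never computes the limit of
  \<open>H\<^sub>N(F\<^sub>N)/N\<close>.

  As \<open>entropically_chaotic\<close> leaves the limit density open, refuting it also requires
  that a family has at most one chaotic limit up to null sets.\<close>

abbreviation lborel_pow :: "nat \<Rightarrow> (nat \<Rightarrow> real) measure" where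
  "lborel_pow N \<equiv> (\<Pi>\<^sub>M i\<in>{..<N}. lborel)"

text \<open>Width 1 in the squared radius balances two needs. Moving a point of the shell to the
  sphere raises its energy by less than 1, which costs at most a factor e in
  \<open>weight_ge\<close>; and the shell keeps at least the proportion 1 - exp (- 1/2) of the ball,
  so its volume has the same exponential rate.\<close>

definition kac_shell :: "nat \<Rightarrow> (nat \<Rightarrow> real) set" where
  "kac_shell N = {v \<in> {..<N} \<rightarrow>\<^sub>E UNIV. real N - 1 < (\<Sum>i<N. (v i)\<^sup>2) \<and> (\<Sum>i<N. (v i)\<^sup>2) \<le> real N}"

lemma kac_shell_sets [measurable]: "kac_shell N \<in> sets (\<Pi>\<^sub>M i\<in>{..<N}. borel)"
proof -
  have "kac_shell N = {v \<in> space (\<Pi>\<^sub>M i\<in>{..<N}. borel). 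
    real N - 1 < (\<Sum>i<N. (v i)\<^sup>2) \<and> (\<Sum>i<N. (v i)\<^sup>2) \<le> real N}"
    by (simp add: kac_shell_def space_PiM)
  also have "\<dots> \<in> sets (\<Pi>\<^sub>M i\<in>{..<N}. borel)"
    by measurable
  finally show ?thesis .
qed

lemma sets_lborel_pow: "sets (\<Pi>\<^sub>M i\<in>I. lborel) = sets (\<Pi>\<^sub>M i\<in>I. (borel :: real measure))"
  by (rule sets_PiM_cong) auto

lemma product_sigma_finite_lborel: "product_sigma_finite (\<lambda>_. lborel :: real measure)"
  by standard

lemma emeasure_lborel_scale:
  fixes t :: real
  assumes "t > 0" and [measurable]: "A \<in> sets borel"
  shows "ennreal t * emeasure lborel ((\<lambda>x. t * x) -` A) = emeasure lborel A"
proof -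
  have "emeasure lborel A = (\<integral>\<^sup>+x. indicator A x \<partial>lborel)"
    by simp
  also have "\<dots> = ennreal t * (\<integral>\<^sup>+x. indicator A (0 + t * x) \<partial>lborel)"
    using assms by (subst nn_integral_real_affine[where c = t and t = 0]) auto
  also have "(\<integral>\<^sup>+x. indicator A (0 + t * x) \<partial>lborel)
      = (\<integral>\<^sup>+x. indicator ((\<lambda>x. t * x) -` A) x \<partial>lborel)"
    by (intro nn_integral_cong) (simp add: indicator_def)
  also have "\<dots> = emeasure lborel ((\<lambda>x. t * x) -` A)"
    using measurable_sets[of "\<lambda>x. t * x" borel borel A] by simp
  finally show ?thesis ..
qed

text \<open>On boxes the claim splits into \<open>emeasure_lborel_scale\<close> for each side. It is
  phrased as an equality of measures because boxes determine a product measure by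
  \<open>PiM_eqI\<close>.\<close>

lemma lborel_pow_scale:
  fixes t :: real
  assumes t: "t > 0" and I: "finite I"
  shows "density (distr (\<Pi>\<^sub>M i\<in>I. lborel) (\<Pi>\<^sub>M i\<in>I. lborel) (\<lambda>v. \<lambda>i\<in>I. t * v i))
    (\<lambda>_. ennreal (t ^ card I)) = (\<Pi>\<^sub>M i\<in>I. lborel)" (is "density (distr ?L _ ?s) _ = _")
proof -
  interpret product_sigma_finite "\<lambda>_. lborel :: real measure"
    by (rule product_sigma_finite_lborel)
  have s[measurable]: "?s \<in> ?L \<rightarrow>\<^sub>M ?L"
    by (rule measurable_restrict) measurable
  show ?thesis
  proof (rule PiM_eqI)
    fix A :: "_ \<Rightarrow> real set" assume A: "\<And>i. i \<in> I \<Longrightarrow> A i \<in> sets lborel"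
    have E: "Pi\<^sub>E I A \<in> sets ?L"
      using A I by (intro sets_PiM_I_finite) auto
    have m: "(\<lambda>x. t * x) -` A i \<in> sets lborel" if "i \<in> I" for i
      using measurable_sets[of "\<lambda>x. t * x" borel borel "A i"] A[OF that] by simp
    have "?s -` Pi\<^sub>E I A \<inter> space ?L = (\<Pi>\<^sub>E i\<in>I. (\<lambda>x. t * x) -` A i)"
      by (auto simp: space_PiM PiE_iff)
    then have "emeasure (distr ?L ?L ?s) (Pi\<^sub>E I A) = (\<Prod>i\<in>I. emeasure lborel ((\<lambda>x. t * x) -` A i))"
      using E m I by (simp add: emeasure_distr emeasure_PiM)
    then have "emeasure (density (distr ?L ?L ?s) (\<lambda>_. ennreal (t ^ card I))) (Pi\<^sub>E I A)
      = ennreal t ^ card I * (\<Prod>i\<in>I. emeasure lborel ((\<lambda>x. t * x) -` A i))"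
      using E t by (simp add: emeasure_density_const ennreal_power)
    also have "\<dots> = (\<Prod>i\<in>I. ennreal t * emeasure lborel ((\<lambda>x. t * x) -` A i))"
      by (simp add: prod.distrib)
    also have "\<dots> = (\<Prod>i\<in>I. emeasure lborel (A i))"
      using t A by (intro prod.cong emeasure_lborel_scale) auto
    finally show "emeasure (density (distr ?L ?L ?s) (\<lambda>_. ennreal (t ^ card I))) (Pi\<^sub>E I A)
      = (\<Prod>i\<in>I. emeasure lborel (A i))" .
  qed (use I in auto)
qed

lemma radial_projection_scale:
  assumes "t > 0"
  shows "radial_projection N (\<lambda>i\<in>{..<N}. t * v i) = radial_projection N v"
  using assms
  by (auto simp: radial_projection_def fun_eq_iff power_mult_distrib real_sqrt_mult
      simp flip: sum_distrib_left)

text \<open>The points projected into \<open>A\<close> form a cone, by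
  \<open>radial_projection_scale\<close>. Dilation by \<open>s\<close> maps its part of energy at
  most \<open>r\<close> onto its part of energy at most \<open>s\<^sup>2 * r\<close>.\<close>

lemma emeasure_cone_scale:
  assumes [measurable]: "A \<in> sets (\<Pi>\<^sub>M i\<in>{..<N}. borel)" and r: "0 < r" "0 < s"
  shows "emeasure (lborel_pow N) {v \<in> space (lborel_pow N). (\<Sum>i<N. (v i)\<^sup>2) \<le> s\<^sup>2 * r \<and> radial_projection N v \<in> A}
     = ennreal (s ^ N) * emeasure (lborel_pow N) {v \<in> space (lborel_pow N). (\<Sum>i<N. (v i)\<^sup>2) \<le> r \<and> radial_projection N v \<in> A}"
    (is "emeasure ?L ?B = _ * emeasure _ ?B'")
proof -
  let ?s = "\<lambda>v. \<lambda>i\<in>{..<N}. s * v i"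
  have s[measurable]: "?s \<in> ?L \<rightarrow>\<^sub>M ?L"
    by (rule measurable_restrict) measurable
  have B[measurable]: "?B \<in> sets ?L"
    by measurable
  have "emeasure ?L ?B = emeasure (density (distr ?L ?L ?s) (\<lambda>_. ennreal (s ^ card {..<N}))) ?B"
    using r by (subst lborel_pow_scale) auto
  also have "\<dots> = ennreal (s ^ N) * emeasure ?L (?s -` ?B \<inter> space ?L)"
    by (simp add: emeasure_density_const emeasure_distr)
  also have "?s -` ?B \<inter> space ?L = ?B'"
    using r radial_projection_scale[of s N]
    by (auto simp: space_PiM power_mult_distrib simp flip: sum_distrib_left)
  finally show ?thesis .
qed

lemma ennreal_diff_scaled:
  fixes x :: ennreal
  assumes "x \<noteq> \<infinity>" "0 \<le> q" "q \<le> 1"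
  shows "x - ennreal q * x = ennreal (1 - q) * x"
proof (cases x)
  case (real a)
  have "ennreal a - ennreal q * ennreal a = ennreal (a - q * a)"
    using real(1) assms by (simp add: ennreal_minus flip: ennreal_mult)
  also have "a - q * a = (1 - q) * a"
    by (simp add: algebra_simps)
  also have "ennreal \<dots> = ennreal (1 - q) * ennreal a"
    using real(1) assms by (simp add: ennreal_mult)
  finally show ?thesis
    by (simp add: real)
qed (use assms in auto)

text \<open>The shell is the difference of two concentric balls, and \<open>q\<close> is the ratio
  of their volumes. The inner ball takes this same proportion of every cone, so the factor 1 - q
  does not depend on \<open>A\<close> and cancels after normalisation.\<close>

lemma emeasure_uniform_kac_shell:
  assumes N: "N \<ge> 2" and A[measurable]: "A \<in> sets (\<Pi>\<^sub>M i\<in>{..<N}. borel)"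
  defines "q \<equiv> sqrt ((real N - 1) / real N) ^ N"
  shows "emeasure (lborel_pow N) {v \<in> kac_shell N. radial_projection N v \<in> A}
    = ennreal (1 - q) * emeasure (lborel_pow N) {v \<in> kac_ball N. radial_projection N v \<in> A}"
proof -
  let ?L = "lborel_pow N"
  let ?B = "\<lambda>r. {v \<in> space ?L. (\<Sum>i<N. (v i)\<^sup>2) \<le> r \<and> radial_projection N v \<in> A}"
  let ?s = "sqrt ((real N - 1) / real N)"
  have [measurable]: "?B r \<in> sets ?L" for r
    by measurable
  have "?s\<^sup>2 * real N = real N - 1"
    using N by simp
  then have B: "emeasure ?L (?B (real N - 1)) = ennreal q * emeasure ?L (?B (real N))"
    using emeasure_cone_scale[OF A, of "real N" ?s] N by (simp add: q_def)
  have ball: "?B (real N) = {v \<in> kac_ball N. radial_projection N v \<in> A}"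
    by (auto simp: kac_ball_def space_PiM)
  have "emeasure ?L (?B (real N)) \<le> emeasure ?L (kac_ball N)"
    by (intro emeasure_mono) (auto simp: kac_ball_def space_PiM)
  then have fin: "emeasure ?L (?B (real N)) \<noteq> \<infinity>"
    using emeasure_kac_ball(2)[of N] by (auto simp: top_unique)
  have q1: "q \<le> 1" "0 \<le> q"
    using N by (auto simp: q_def divide_le_eq intro!: power_le_one)
  have D: "{v \<in> kac_shell N. radial_projection N v \<in> A} = ?B (real N) - ?B (real N - 1)"
    by (intro set_eqI) (simp add: kac_shell_def space_PiM not_le, blast)
  have "emeasure ?L {v \<in> kac_shell N. radial_projection N v \<in> A}
      = emeasure ?L (?B (real N)) - emeasure ?L (?B (real N - 1))"
    unfolding D
  proof (rule emeasure_Diff)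
    show "emeasure ?L (?B (real N - 1)) \<noteq> \<infinity>"
      using fin unfolding B by (simp add: ennreal_mult_eq_top_iff)
    show "?B (real N - 1) \<subseteq> ?B (real N)"
      by (intro subsetI) simp
  qed measurable
  then have "emeasure ?L {v \<in> kac_shell N. radial_projection N v \<in> A}
      = ennreal (1 - q) * emeasure ?L (?B (real N))"
    unfolding B by (simp only: ennreal_diff_scaled[OF fin q1(2,1)])
  then show ?thesis
    by (simp only: ball)
qed

lemma kac_shell_shrink_factor:
  assumes "N \<ge> 2"
  shows "sqrt ((real N - 1) / real N) ^ N < 1"
  using assms by (subst power_less_one_iff) auto

lemma emeasure_kac_shell:
  assumes N: "N \<ge> 2"
  shows "emeasure (lborel_pow N) (kac_shell N)
    = ennreal (1 - sqrt ((real N - 1) / real N) ^ N) * emeasure (lborel_pow N) (kac_ball N)"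
proof -
  have *: "radial_projection N v \<in> space (\<Pi>\<^sub>M i\<in>{..<N}. borel)" for v
    by (auto simp: radial_projection_def space_PiM)
  show ?thesis
    using emeasure_uniform_kac_shell[OF N sets.top] by (simp add: *)
qed

lemma emeasure_kac_shell_neq:
  assumes N: "N \<ge> 2"
  shows "emeasure (lborel_pow N) (kac_shell N) \<noteq> 0" "emeasure (lborel_pow N) (kac_shell N) \<noteq> \<infinity>"
  using emeasure_kac_ball[of N] kac_shell_shrink_factor[OF N]
  unfolding emeasure_kac_shell[OF N]
  by (auto simp: ennreal_mult_eq_top_iff ennreal_eq_0_iff)

text \<open>On the shell, unlike on the ball, the radial projection changes a product of Gaussian-like
  densities by a bounded factor only.\<close>

lemma kac_measure_shell:
  assumes N: "N \<ge> 2"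
  shows "kac_measure N =
    distr (uniform_measure (lborel_pow N) (kac_shell N)) (\<Pi>\<^sub>M i\<in>{..<N}. borel) (radial_projection N)"
    (is "_ = ?R")
proof (rule measure_eqI)
  let ?L = "lborel_pow N"
  let ?q = "sqrt ((real N - 1) / real N) ^ N"
  have sh[measurable]: "kac_shell N \<in> sets ?L"
    using kac_shell_sets sets_lborel_pow by blast
  fix A assume "A \<in> sets (kac_measure N)"
  then have A[measurable]: "A \<in> sets (\<Pi>\<^sub>M i\<in>{..<N}. borel)"
    by simp
  have S: "S \<inter> (radial_projection N -` A \<inter> space ?L) = {v \<in> S. radial_projection N v \<in> A}"
    if "S \<in> sets ?L" for S
    using sets.sets_into_space[OF that] by auto
  have "emeasure ?R A = emeasure ?L {v \<in> kac_shell N. radial_projection N v \<in> A} / emeasure ?L (kac_shell N)"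
    using S[OF sh] by (subst emeasure_distr) (simp_all add: emeasure_uniform_measure)
  also have "\<dots> = ennreal (1 - ?q) * emeasure ?L {v \<in> kac_ball N. radial_projection N v \<in> A}
      / (ennreal (1 - ?q) * emeasure ?L (kac_ball N))"
    unfolding emeasure_uniform_kac_shell[OF N A] emeasure_kac_shell[OF N] ..
  also have "\<dots> = emeasure ?L {v \<in> kac_ball N. radial_projection N v \<in> A} / emeasure ?L (kac_ball N)"
    using kac_shell_shrink_factor[OF N]
    by (subst (1 2) mult.commute, subst divide_mult_eq) (auto simp: ennreal_eq_0_iff)
  also have "\<dots> = emeasure (kac_measure N) A"
    unfolding kac_measure_def using S[OF kac_ball_sets]
    by (subst emeasure_distr) (simp_all add: emeasure_uniform_measure)
  finally show "emeasure (kac_measure N) A = emeasure ?R A" ..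
qed simp

lemma emeasure_kac_shell_measure:
  assumes "N \<ge> 2"
  shows "emeasure (lborel_pow N) (kac_shell N) = ennreal (measure (lborel_pow N) (kac_shell N))"
  using emeasure_kac_shell_neq(2)[OF assms] by (intro emeasure_eq_ennreal_measure) simp

lemma measure_kac_shell_pos:
  assumes "N \<ge> 2"
  shows "0 < measure (lborel_pow N) (kac_shell N)"
  using emeasure_kac_shell_neq(1)[OF assms] emeasure_kac_shell_measure[OF assms]
  by (metis ennreal_0 less_le measure_nonneg)

section \<open>Conditioning a product law on the shell\<close>

lemma prob_space_real_density:
  assumes "real_density f"
  shows "prob_space (density lborel (\<lambda>x. ennreal (f x)))"
  using assms by (intro prob_spaceI) (auto simp: real_density_def emeasure_density)

lemma PiM_real_density:
  assumes f: "real_density f" and I: "finite I"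
  shows "(\<Pi>\<^sub>M i\<in>I. density lborel (\<lambda>x. ennreal (f x)))
    = density (\<Pi>\<^sub>M i\<in>I. lborel) (\<lambda>v. ennreal (\<Prod>i\<in>I. f (v i)))"
proof -
  interpret L: product_sigma_finite "\<lambda>_. lborel :: real measure"
    by (rule product_sigma_finite_lborel)
  interpret p: prob_space "density lborel (\<lambda>x. ennreal (f x))"
    by (rule prob_space_real_density[OF f])
  interpret P: product_sigma_finite "\<lambda>_. density lborel (\<lambda>x. ennreal (f x))"
    by standard
  have [measurable]: "f \<in> borel_measurable borel" and nonneg: "\<And>x. 0 \<le> f x"
    using f by (auto simp: real_density_def)
  have "density (\<Pi>\<^sub>M i\<in>I. lborel) (\<lambda>v. ennreal (\<Prod>i\<in>I. f (v i)))
    = (\<Pi>\<^sub>M i\<in>I. density lborel (\<lambda>x. ennreal (f x)))"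
  proof (rule P.PiM_eqI)
    show "sets (density (\<Pi>\<^sub>M i\<in>I. lborel) (\<lambda>v. ennreal (\<Prod>i\<in>I. f (v i))))
        = sets (\<Pi>\<^sub>M i\<in>I. density lborel (\<lambda>x. ennreal (f x)))"
      unfolding sets_density by (rule sets_PiM_cong) auto
    fix A :: "_ \<Rightarrow> real set" assume A: "\<And>i. i \<in> I \<Longrightarrow> A i \<in> sets (density lborel (\<lambda>x. ennreal (f x)))"
    then have E: "Pi\<^sub>E I A \<in> sets (\<Pi>\<^sub>M i\<in>I. lborel)"
      using I by (intro sets_PiM_I_finite) auto
    have "emeasure (density (\<Pi>\<^sub>M i\<in>I. lborel) (\<lambda>v. ennreal (\<Prod>i\<in>I. f (v i)))) (Pi\<^sub>E I A)
      = (\<integral>\<^sup>+v. ennreal (\<Prod>i\<in>I. f (v i)) * indicator (Pi\<^sub>E I A) v \<partial>(\<Pi>\<^sub>M i\<in>I. lborel))"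
      using E by (intro emeasure_density) auto
    also have "\<dots> = (\<integral>\<^sup>+v. (\<Prod>i\<in>I. ennreal (f (v i)) * indicator (A i) (v i)) \<partial>(\<Pi>\<^sub>M i\<in>I. lborel))"
    proof (rule nn_integral_cong)
      fix v :: "_ \<Rightarrow> real" assume "v \<in> space (\<Pi>\<^sub>M i\<in>I. lborel)"
      then have "indicator (Pi\<^sub>E I A) v = (\<Prod>i\<in>I. indicator (A i) (v i) :: ennreal)"
        using I by (cases "v \<in> Pi\<^sub>E I A") (auto simp: PiE_iff space_PiM indicator_def intro!: prod_zero[symmetric])
      then show "ennreal (\<Prod>i\<in>I. f (v i)) * indicator (Pi\<^sub>E I A) v
          = (\<Prod>i\<in>I. ennreal (f (v i)) * indicator (A i) (v i))"
        using nonneg by (simp add: prod.distrib prod_ennreal)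
    qed
    also have "\<dots> = (\<Prod>i\<in>I. \<integral>\<^sup>+x. ennreal (f x) * indicator (A i) x \<partial>lborel)"
      using A I by (intro L.product_nn_integral_prod) auto
    also have "\<dots> = (\<Prod>i\<in>I. emeasure (density lborel (\<lambda>x. ennreal (f x))) (A i))"
      using A by (intro prod.cong refl emeasure_density[symmetric]) auto
    finally show "emeasure (density (\<Pi>\<^sub>M i\<in>I. lborel) (\<lambda>v. ennreal (\<Prod>i\<in>I. f (v i)))) (Pi\<^sub>E I A)
      = (\<Prod>i\<in>I. emeasure (density lborel (\<lambda>x. ennreal (f x))) (A i))" .
  qed (rule I)
  then show ?thesis ..
qed

text \<open>The last two assumptions say that along rays \<open>f x\<close> decreases while
  \<open>exp (x\<^sup>2) * f x\<close> increases. Every Gaussian proportional to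
  \<open>exp (- a * x\<^sup>2)\<close> with \<open>a \<le> 1\<close> has both properties, and they
  pass to convex combinations. Hence the hot component, the cold component, their mixture and the
  limit are all instances.\<close>

locale radial_density =
  fixes f :: "real \<Rightarrow> real"
  assumes real_density: "real_density f"
    and pos: "0 < f x"
    and scale_le: "1 \<le> c \<Longrightarrow> f (c * x) \<le> f x"
    and scale_ge: "1 \<le> c \<Longrightarrow> exp (- (c\<^sup>2 - 1) * x\<^sup>2) * f x \<le> f (c * x)"
begin

lemma measurable_f [measurable]: "f \<in> borel_measurable borel"
  using real_density by (simp add: real_density_def)

definition law :: "nat set \<Rightarrow> (nat \<Rightarrow> real) measure" where
  "law I = (\<Pi>\<^sub>M i\<in>I. density lborel (\<lambda>x. ennreal (f x)))"

lemma sets_law [measurable_cong, simp]: "sets (law I) = sets (\<Pi>\<^sub>M i\<in>I. borel)"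
  unfolding law_def by (rule sets_PiM_cong) auto

lemma space_law [simp]: "space (law I) = I \<rightarrow>\<^sub>E UNIV"
  by (simp add: law_def space_PiM)

lemma prob_space_law: "prob_space (law I)"
  unfolding law_def by (intro prob_space_PiM prob_space_real_density real_density)

lemma law_eq_density:
  "finite I \<Longrightarrow> law I = density (\<Pi>\<^sub>M i\<in>I. lborel) (\<lambda>v. ennreal (\<Prod>i\<in>I. f (v i)))"
  unfolding law_def by (rule PiM_real_density[OF real_density])

text \<open>The ratio of the product density at the projected point to that at the point itself. It
  converts an integral over the sphere into one over \<open>law\<close>, where the coordinates are
  independent.\<close>

definition weight :: "nat \<Rightarrow> (nat \<Rightarrow> real) \<Rightarrow> real" where
  "weight N v = indicator (kac_shell N) v * (\<Prod>i<N. f (radial_projection N v i) / f (v i))"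

lemma radial_projection_measurable' [measurable]:
  "radial_projection N \<in> (\<Pi>\<^sub>M i\<in>{..<N}. borel) \<rightarrow>\<^sub>M (\<Pi>\<^sub>M i\<in>{..<N}. borel)"
  unfolding radial_projection_def by measurable

lemma weight_measurable [measurable]: "weight N \<in> borel_measurable (\<Pi>\<^sub>M i\<in>{..<N}. borel)"
proof -
  have "(\<lambda>v. radial_projection N v i) \<in> borel_measurable (\<Pi>\<^sub>M i\<in>{..<N}. borel)" if "i < N" for i
    using measurable_compose[OF radial_projection_measurable' measurable_component_singleton] that by auto
  note [measurable] = this
  show ?thesis
    unfolding weight_def[abs_def] by measurable
qed

lemma radial_projection_shell:
  assumes "v \<in> kac_shell N" "N \<ge> 1"
  obtains c where "1 \<le> c" "c\<^sup>2 * (\<Sum>i<N. (v i)\<^sup>2) = real N" "\<And>i. i < N \<Longrightarrow> radial_projection N v i = c * v i"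
proof
  let ?s = "\<Sum>i<N. (v i)\<^sup>2"
  have s: "real N - 1 < ?s" "?s \<le> real N" "0 < ?s"
    using assms by (auto simp: kac_shell_def)
  show "1 \<le> sqrt (real N) / sqrt ?s"
    using s by simp
  show "(sqrt (real N) / sqrt ?s)\<^sup>2 * ?s = real N"
    using s by (simp add: power_divide)
  show "radial_projection N v i = sqrt (real N) / sqrt ?s * v i" if "i < N" for i
    using that by (simp add: radial_projection_def)
qed

lemma weight_nonneg: "0 \<le> weight N v"
  unfolding weight_def using pos by (intro mult_nonneg_nonneg prod_nonneg) (auto intro: less_imp_le)

lemma weight_le_1:
  assumes "N \<ge> 1"
  shows "weight N v \<le> 1"
proof (cases "v \<in> kac_shell N")
  case True
  then obtain c where c: "1 \<le> c" "\<And>i. i < N \<Longrightarrow> radial_projection N v i = c * v i"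
    using radial_projection_shell assms by metis
  have "(\<Prod>i<N. f (radial_projection N v i) / f (v i)) \<le> (\<Prod>i<N. 1)"
    using pos c scale_le[OF c(1)] by (intro prod_mono) (auto simp: less_imp_le)
  then show ?thesis
    using True by (simp add: weight_def)
qed (simp add: weight_def)

lemma weight_ge:
  assumes "N \<ge> 1" "v \<in> kac_shell N"
  shows "exp (- 1) \<le> weight N v"
proof -
  let ?s = "\<Sum>i<N. (v i)\<^sup>2"
  obtain c where c: "1 \<le> c" "c\<^sup>2 * ?s = real N" "\<And>i. i < N \<Longrightarrow> radial_projection N v i = c * v i"
    using radial_projection_shell assms by metis
  have "- 1 \<le> ?s - c\<^sup>2 * ?s"
    using c(2) assms(2) by (simp add: kac_shell_def)
  also have "\<dots> = (\<Sum>i<N. - (c\<^sup>2 - 1) * (v i)\<^sup>2)"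
    by (simp add: algebra_simps sum_distrib_left sum_subtractf)
  finally have "exp (- 1) \<le> exp (\<Sum>i<N. - (c\<^sup>2 - 1) * (v i)\<^sup>2)"
    by simp
  also have "\<dots> = (\<Prod>i<N. exp (- (c\<^sup>2 - 1) * (v i)\<^sup>2))"
    by (rule exp_sum) simp
  also have "\<dots> \<le> (\<Prod>i<N. f (radial_projection N v i) / f (v i))"
    using scale_ge[OF c(1)] pos c(3) by (intro prod_mono) (auto simp: le_divide_eq)
  finally show ?thesis
    using assms(2) by (simp add: weight_def)
qed

text \<open>Divided by the volume of the shell, this is the denominator in the definition of
  \<open>conditioned_tensor\<close>; see \<open>kac_normalisation\<close>.\<close>

definition mass :: "nat \<Rightarrow> real" where
  "mass N = (\<integral>v. weight N v \<partial>law {..<N})"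

lemma integrable_weight_bounded:
  assumes N: "N \<ge> 1" and [measurable]: "h \<in> borel_measurable (\<Pi>\<^sub>M i\<in>{..<N}. borel)"
    and C: "\<And>v. v \<in> kac_shell N \<Longrightarrow> \<bar>h v\<bar> \<le> C"
  shows "integrable (law {..<N}) (\<lambda>v. weight N v * h v)"
proof -
  interpret prob_space "law {..<N}" by (rule prob_space_law)
  have "\<bar>weight N v * h v\<bar> \<le> \<bar>C\<bar>" for v
  proof (cases "v \<in> kac_shell N")
    case True
    have "\<bar>weight N v * h v\<bar> \<le> 1 * \<bar>C\<bar>"
      unfolding abs_mult using weight_nonneg weight_le_1[OF N] C[OF True]
      by (intro mult_mono) auto
    then show ?thesis by simp
  qed (simp add: weight_def)
  then show ?thesis
    by (intro integrable_const_bound[where B = "\<bar>C\<bar>"]) auto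
qed

lemma mass_ge:
  assumes "N \<ge> 1"
  shows "exp (- 1) * measure (law {..<N}) (kac_shell N) \<le> mass N"
proof -
  interpret prob_space "law {..<N}" by (rule prob_space_law)
  have int: "integrable (law {..<N}) (weight N)"
    using integrable_weight_bounded[OF assms, of "\<lambda>_. 1" 1] by simp
  have "exp (- 1) * measure (law {..<N}) (kac_shell N)
      = (\<integral>v. exp (- 1) * indicator (kac_shell N) v \<partial>law {..<N})"
    using sets.sets_into_space[OF kac_shell_sets, of N] by (simp add: space_PiM Int_absorb2)
  also have "\<dots> \<le> mass N"
    unfolding mass_def
  proof (rule integral_mono[OF _ int])
    show "integrable (law {..<N}) (\<lambda>v. exp (- 1) * indicator (kac_shell N) v :: real)"
      by (intro integrable_mult_right integrable_real_indicator) (auto simp: less_top[symmetric])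
  qed (auto simp: indicator_def weight_nonneg weight_ge[OF assms])
  finally show ?thesis .
qed

lemma mass_nonneg: "0 \<le> mass N"
  unfolding mass_def by (intro Bochner_Integration.integral_nonneg weight_nonneg)

lemma kac_integral:
  assumes N: "N \<ge> 2" and [measurable]: "h \<in> borel_measurable (\<Pi>\<^sub>M i\<in>{..<N}. borel)"
  shows "(\<integral>v. (\<Prod>i<N. f (v i)) * h v \<partial>kac_measure N)
    = (\<integral>v. weight N v * h (radial_projection N v) \<partial>law {..<N}) / measure (lborel_pow N) (kac_shell N)"
proof -
  let ?L = "lborel_pow N"
  let ?m = "measure ?L (kac_shell N)"
  have [measurable]: "kac_shell N \<in> sets ?L"
    using kac_shell_sets sets_lborel_pow by blast
  have m: "emeasure ?L (kac_shell N) = ennreal ?m" "0 < ?m"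
    by (rule emeasure_kac_shell_measure[OF N] measure_kac_shell_pos[OF N])+
  have u: "uniform_measure ?L (kac_shell N) = density ?L (\<lambda>v. ennreal (indicator (kac_shell N) v / ?m))"
    unfolding uniform_measure_def m(1) using m(2)
    by (intro density_cong) (auto simp: indicator_def divide_ennreal simp flip: ennreal_1)
  have [measurable]: "(\<lambda>v. radial_projection N v i) \<in> borel_measurable ?L" if "i < N" for i
    using measurable_compose[OF radial_projection_measurable measurable_component_singleton] that by auto
  have [measurable]: "(\<lambda>v. h (radial_projection N v)) \<in> borel_measurable ?L"
    by measurable
  have [measurable]: "weight N \<in> borel_measurable ?L"
    using weight_measurable sets_lborel_pow measurable_cong_sets by blast
  have "(\<integral>v. (\<Prod>i<N. f (v i)) * h v \<partial>kac_measure N)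
    = (\<integral>v. (indicator (kac_shell N) v / ?m) *\<^sub>R
        ((\<Prod>i<N. f (radial_projection N v i)) * h (radial_projection N v)) \<partial>?L)"
    unfolding kac_measure_shell[OF N] u using m(2)
    by (subst integral_distr) (simp_all add: integral_density)
  also have "\<dots> = (\<integral>v. (\<Prod>i<N. f (v i)) *\<^sub>R (weight N v * h (radial_projection N v)) / ?m \<partial>?L)"
  proof (rule Bochner_Integration.integral_cong[OF refl])
    fix v
    have "(\<Prod>i<N. f (v i)) \<noteq> 0"
      using pos by (auto simp: less_imp_neq[THEN not_sym])
    then show "(indicator (kac_shell N) v / ?m) *\<^sub>R
        ((\<Prod>i<N. f (radial_projection N v i)) * h (radial_projection N v))
      = (\<Prod>i<N. f (v i)) *\<^sub>R (weight N v * h (radial_projection N v)) / ?m"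
      by (simp add: weight_def prod_dividef)
  qed
  also have "\<dots> = (\<integral>v. (\<Prod>i<N. f (v i)) *\<^sub>R (weight N v * h (radial_projection N v)) \<partial>?L) / ?m"
    by simp
  also have "(\<integral>v. (\<Prod>i<N. f (v i)) *\<^sub>R (weight N v * h (radial_projection N v)) \<partial>?L)
     = (\<integral>v. weight N v * h (radial_projection N v) \<partial>law {..<N})"
    unfolding law_eq_density[OF finite_lessThan]
    using pos by (intro integral_density[symmetric]) (auto intro!: AE_I2 prod_pos intro: less_imp_le)
  finally show ?thesis .
qed

lemma kac_normalisation:
  assumes "N \<ge> 2"
  shows "(\<integral>v. (\<Prod>i<N. f (v i)) \<partial>kac_measure N) = mass N / measure (lborel_pow N) (kac_shell N)"
  using kac_integral[OF assms, of "\<lambda>_. 1"] by (simp add: mass_def)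

text \<open>The volume of the shell cancels between numerator and denominator. It reappears only in
  the entropy, through the logarithm of the normalising constant.\<close>

lemma conditioned_integral:
  assumes N: "N \<ge> 2" and h[measurable]: "h \<in> borel_measurable (\<Pi>\<^sub>M i\<in>{..<N}. borel)"
  shows "(\<integral>v. conditioned_tensor N f v * h v \<partial>kac_measure N)
    = (\<integral>v. weight N v * h (radial_projection N v) \<partial>law {..<N}) / mass N"
proof -
  have m: "measure (lborel_pow N) (kac_shell N) \<noteq> 0"
    using measure_kac_shell_pos[OF N] by simp
  have "(\<integral>v. conditioned_tensor N f v * h v \<partial>kac_measure N)
    = (\<integral>v. ((\<Prod>i<N. f (v i)) * h v) / (\<integral>v. (\<Prod>i<N. f (v i)) \<partial>kac_measure N) \<partial>kac_measure N)"
    by (simp add: conditioned_tensor_def)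
  also have "\<dots> = (\<integral>v. (\<Prod>i<N. f (v i)) * h v \<partial>kac_measure N) / (\<integral>v. (\<Prod>i<N. f (v i)) \<partial>kac_measure N)"
    by simp
  finally show ?thesis
    using m by (simp add: kac_integral[OF N h] kac_normalisation[OF N])
qed

end

section \<open>Exchangeability of the reweighted law and concentration of block averages\<close>

context radial_density
begin

lemma distr_law_reindex:
  assumes "inj_on \<pi> I" "\<pi> \<in> I \<rightarrow> K"
  shows "distr (law K) (law I) (\<lambda>v. \<lambda>i\<in>I. v (\<pi> i)) = law I"
  unfolding law_def
  using distr_PiM_reindex[of K "\<lambda>_. density lborel (\<lambda>x. ennreal (f x))" \<pi> I] assms
    prob_space_real_density[OF real_density] by simp

lemma integral_law_reindex:
  fixes h :: "(nat \<Rightarrow> real) \<Rightarrow> real"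
  assumes \<pi>: "inj_on \<pi> I" "\<pi> \<in> I \<rightarrow> K" and [measurable]: "h \<in> borel_measurable (\<Pi>\<^sub>M i\<in>I. borel)"
  shows "(\<integral>v. h (\<lambda>i\<in>I. v (\<pi> i)) \<partial>law K) = (\<integral>v. h v \<partial>law I)"
proof -
  have "(\<lambda>v. v (\<pi> i)) \<in> borel_measurable (law K)" if "i \<in> I" for i
    using that \<pi>(2) unfolding measurable_cong_sets[OF sets_law refl]
    by (intro measurable_component_singleton) auto
  then have "(\<lambda>v. \<lambda>i\<in>I. v (\<pi> i)) \<in> law K \<rightarrow>\<^sub>M (\<Pi>\<^sub>M i\<in>I. borel)"
    by (intro measurable_restrict) auto
  then have "(\<lambda>v. \<lambda>i\<in>I. v (\<pi> i)) \<in> law K \<rightarrow>\<^sub>M law I"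
    by (simp cong: measurable_cong_sets)
  then have "(\<integral>v. h v \<partial>distr (law K) (law I) (\<lambda>v. \<lambda>i\<in>I. v (\<pi> i))) = (\<integral>v. h (\<lambda>i\<in>I. v (\<pi> i)) \<partial>law K)"
    by (intro integral_distr) auto
  then show ?thesis
    by (simp only: distr_law_reindex[OF \<pi>])
qed

lemma radial_projection_permute:
  assumes "\<pi> permutes {..<N}" "i < N"
  shows "radial_projection N (\<lambda>i\<in>{..<N}. v (\<pi> i)) i = radial_projection N v (\<pi> i)"
proof -
  have "(\<Sum>i<N. (v (\<pi> i))\<^sup>2) = (\<Sum>i<N. (v i)\<^sup>2)"
    using sum.permute[OF assms(1), of "\<lambda>i. (v i)\<^sup>2"] by (simp add: o_def)
  moreover have "\<pi> i < N"
    using assms permutes_in_image[OF assms(1)] by auto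
  ultimately show ?thesis
    using assms(2) by (simp add: radial_projection_def)
qed

lemma weight_permute:
  assumes \<pi>: "\<pi> permutes {..<N}" and v: "v \<in> {..<N} \<rightarrow>\<^sub>E UNIV"
  shows "weight N (\<lambda>i\<in>{..<N}. v (\<pi> i)) = weight N v"
proof -
  have "(\<Sum>i<N. (v (\<pi> i))\<^sup>2) = (\<Sum>i<N. (v i)\<^sup>2)"
    using sum.permute[OF \<pi>, of "\<lambda>i. (v i)\<^sup>2"] by (simp add: o_def)
  then have "(\<lambda>i\<in>{..<N}. v (\<pi> i)) \<in> kac_shell N \<longleftrightarrow> v \<in> kac_shell N"
    using v by (simp add: kac_shell_def)
  moreover have "(\<Prod>i<N. f (radial_projection N v (\<pi> i)) / f (v (\<pi> i)))
    = (\<Prod>i<N. f (radial_projection N v i) / f (v i))"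
    using prod.permute[OF \<pi>, of "\<lambda>i. f (radial_projection N v i) / f (v i)"] by (simp add: o_def)
  ultimately show ?thesis
    by (simp add: weight_def radial_projection_permute[OF \<pi>] indicator_def)
qed

lemma block_swap_permutes:
  fixes j k n N :: nat
  assumes "j < n" "n * k \<le> N"
  defines "\<pi> \<equiv> \<lambda>x. if x < k then j * k + x else if j * k \<le> x \<and> x < j * k + k then x - j * k else x"
  shows "\<pi> permutes {..<N}"
proof -
  have "(j + 1) * k \<le> n * k"
    using assms by (intro mult_right_mono) auto
  then have jk: "j * k + k \<le> N"
    using assms(2) by simp
  have "\<pi> (\<pi> x) = x" for x
  \<comment> \<open>For \<open>j = 0\<close> the two blocks coincide and \<pi> is the identity.
    Otherwise \<open>k \<le> j * k\<close>, so they are disjoint and \<pi> exchanges them.\<close>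
  proof (cases "j = 0")
    case False
    then obtain m where m: "j * k = m" "k \<le> m"
      by (cases j) auto
    then show ?thesis
      unfolding \<pi>_def m(1) by auto
  qed (simp add: \<pi>_def)
  note inv = this
  have "\<pi> x = x" if "x \<notin> {..<N}" for x
    using that jk unfolding \<pi>_def by auto
  then show ?thesis
    unfolding permutes_def using inv by metis
qed

lemma restrict_measurable_block [measurable]:
  fixes j k n N :: nat
  assumes "j < n" "n * k \<le> N"
  shows "(\<lambda>v. \<lambda>i\<in>{..<k}. v (j * k + i)) \<in> (\<Pi>\<^sub>M i\<in>{..<N}. borel) \<rightarrow>\<^sub>M (\<Pi>\<^sub>M i\<in>{..<k}. borel)"
proof (rule measurable_restrict)
  fix i assume "i \<in> {..<k}"
  moreover have "(j + 1) * k \<le> n * k"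
    using assms by (intro mult_right_mono) auto
  ultimately have "j * k + i \<in> {..<N}"
    using assms(2) by simp
  then show "(\<lambda>v. v (j * k + i)) \<in> borel_measurable (\<Pi>\<^sub>M i\<in>{..<N}. borel)"
    by (rule measurable_component_singleton)
qed

text \<open>Exchanging block 0 with block \<open>j\<close> preserves both \<open>law\<close> and
  \<open>weight\<close>. A mean over the first \<open>k\<close> coordinates thereby becomes a mean
  of averages over \<open>n\<close> disjoint blocks, to which concentration applies although the
  statistic itself involves one block only.\<close>

lemma weight_block_symmetry:
  fixes g :: "(nat \<Rightarrow> real) \<Rightarrow> real"
  assumes jn: "j < n" "n * k \<le> N" and [measurable]: "g \<in> borel_measurable (\<Pi>\<^sub>M i\<in>{..<k}. borel)"
  shows "(\<integral>v. weight N v * g (\<lambda>i\<in>{..<k}. v (j * k + i)) \<partial>law {..<N})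
    = (\<integral>v. weight N v * g (restrict v {..<k}) \<partial>law {..<N})"
proof -
  define \<pi> where "\<pi> = (\<lambda>x. if x < k then j * k + x else if j * k \<le> x \<and> x < j * k + k then x - j * k else x)"
  have \<pi>: "\<pi> permutes {..<N}"
    unfolding \<pi>_def by (rule block_swap_permutes[OF jn])
  have "1 * k \<le> n * k"
    using jn(1) by (intro mult_right_mono) auto
  also note jn(2)
  finally have k: "k \<le> N"
    by simp
  have [measurable]: "(\<lambda>v. restrict v {..<k}) \<in> (\<Pi>\<^sub>M i\<in>{..<N}. borel) \<rightarrow>\<^sub>M (\<Pi>\<^sub>M i\<in>{..<k}. borel)"
    using k by (intro measurable_restrict_subset) auto
  have "(\<integral>v. weight N v * g (\<lambda>i\<in>{..<k}. v (j * k + i)) \<partial>law {..<N})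
    = (\<integral>v. weight N (\<lambda>i\<in>{..<N}. v (\<pi> i)) * g (restrict (\<lambda>i\<in>{..<N}. v (\<pi> i)) {..<k}) \<partial>law {..<N})"
  proof (rule Bochner_Integration.integral_cong[OF refl])
    fix v assume "v \<in> space (law {..<N})"
    then have "v \<in> {..<N} \<rightarrow>\<^sub>E UNIV"
      by simp
    moreover have "restrict (\<lambda>i\<in>{..<N}. v (\<pi> i)) {..<k} = (\<lambda>i\<in>{..<k}. v (j * k + i))"
      using k by (auto simp: \<pi>_def fun_eq_iff)
    ultimately show "weight N v * g (\<lambda>i\<in>{..<k}. v (j * k + i))
      = weight N (\<lambda>i\<in>{..<N}. v (\<pi> i)) * g (restrict (\<lambda>i\<in>{..<N}. v (\<pi> i)) {..<k})"
      by (simp only: weight_permute[OF \<pi>])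
  qed
  also have "\<dots> = (\<integral>v. weight N v * g (restrict v {..<k}) \<partial>law {..<N})"
    using permutes_imp_bij[OF \<pi>]
    by (intro integral_law_reindex[of \<pi> "{..<N}" "{..<N}" "\<lambda>v. weight N v * g (restrict v {..<k})"])
       (auto simp: bij_betw_def)
  finally show ?thesis .
qed

lemma indep_coordinates:
  assumes "I \<noteq> {}"
  shows "prob_space.indep_vars (law I) (\<lambda>_. borel) (\<lambda>i v. v i) I"
proof -
  let ?D = "density lborel (\<lambda>x. ennreal (f x))"
  interpret prob_space "law I" by (rule prob_space_law)
  have rv: "random_variable borel (\<lambda>v. v i)" if "i \<in> I" for i
    using that unfolding measurable_cong_sets[OF sets_law refl] by (rule measurable_component_singleton)
  have "distr (law I) borel (\<lambda>v. v i) = ?D" if "i \<in> I" for i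
  proof -
    have "distr (law I) ?D (\<lambda>v. v i) = ?D"
      unfolding law_def using that prob_space_real_density[OF real_density]
      by (intro distr_PiM_component) auto
    moreover have "distr (law I) borel (\<lambda>v. v i) = distr (law I) ?D (\<lambda>v. v i)"
      by (intro distr_cong) auto
    ultimately show ?thesis by simp
  qed
  then have "(\<Pi>\<^sub>M i\<in>I. distr (law I) borel (\<lambda>v. v i)) = law I"
    unfolding law_def by (intro PiM_cong) (auto simp: law_def)
  moreover have "distr (law I) (\<Pi>\<^sub>M i\<in>I. borel) (\<lambda>v. \<lambda>i\<in>I. v i) = law I"
  proof -
    have "distr (law I) (\<Pi>\<^sub>M i\<in>I. borel) (\<lambda>v. \<lambda>i\<in>I. v i) = distr (law I) (law I) (\<lambda>v. v)"
      by (intro distr_cong) (auto simp: PiE_restrict)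
    then show ?thesis
      by (simp add: distr_id)
  qed
  ultimately show ?thesis
    using assms rv by (subst indep_vars_iff_distr_eq_PiM') auto
qed

lemma indep_blocks:
  fixes g :: "(nat \<Rightarrow> real) \<Rightarrow> real"
  assumes N: "N \<ge> 1" and nk: "n * k \<le> N" and [measurable]: "g \<in> borel_measurable (\<Pi>\<^sub>M i\<in>{..<k}. borel)"
  shows "prob_space.indep_vars (law {..<N}) (\<lambda>_. borel) (\<lambda>j v. g (\<lambda>i\<in>{..<k}. v (j * k + i))) {..<n}"
proof -
  interpret prob_space "law {..<N}" by (rule prob_space_law)
  let ?K = "\<lambda>j. {j * k..<j * k + k}"
  have sub: "?K j \<subseteq> {..<N}" if "j < n" for j
  proof -
    have "(j + 1) * k \<le> n * k"
      using that by (intro mult_right_mono) auto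
    then show ?thesis using nk by auto
  qed
  have less: "j * k + k \<le> j' * k" if "j < j'" for j j'
  proof -
    have "(j + 1) * k \<le> j' * k"
      using that by (intro mult_right_mono) auto
    then show ?thesis by simp
  qed
  have disj: "disjoint_family_on ?K {..<n}"
    unfolding disjoint_family_on_def
  proof (intro ballI impI)
    fix j j' :: nat assume "j \<noteq> j'"
    then show "?K j \<inter> ?K j' = {}"
      using less[of j j'] less[of j' j] by (cases "j < j'") auto
  qed
  have "indep_vars (\<lambda>j. \<Pi>\<^sub>M i\<in>?K j. borel) (\<lambda>j v. restrict (\<lambda>i. v i) (?K j)) {..<n}"
    using indep_coordinates[of "{..<N}"] N sub disj
    by (intro indep_vars_restrict[of "\<lambda>_. borel" "\<lambda>i v. v i" "{..<N}"]) (auto simp: lessThan_empty_iff)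
  then have "indep_vars (\<lambda>_. borel) (\<lambda>j v. (\<lambda>w. g (\<lambda>i\<in>{..<k}. w (j * k + i))) (restrict (\<lambda>i. v i) (?K j))) {..<n}"
  proof (rule indep_vars_compose2)
    fix j
    have [measurable]: "(\<lambda>w. w (j * k + i)) \<in> borel_measurable (\<Pi>\<^sub>M i\<in>?K j. borel)" if "i < k" for i
      using that by (intro measurable_component_singleton) auto
    show "(\<lambda>w. g (\<lambda>i\<in>{..<k}. w (j * k + i))) \<in> borel_measurable (\<Pi>\<^sub>M i\<in>?K j. borel)"
      by measurable
  qed
  moreover have "(\<lambda>i\<in>{..<k}. restrict (\<lambda>i. v i) (?K j) (j * k + i)) = (\<lambda>i\<in>{..<k}. v (j * k + i))" for v :: "nat \<Rightarrow> real" and j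
    by (auto simp: fun_eq_iff)
  ultimately show ?thesis
    by simp
qed

lemma block_average_concentration:
  fixes g :: "(nat \<Rightarrow> real) \<Rightarrow> real"
  assumes N: "N \<ge> 1" and n: "n \<ge> 1" and nk: "n * k \<le> N"
    and g[measurable]: "g \<in> borel_measurable (\<Pi>\<^sub>M i\<in>{..<k}. borel)"
    and bd: "\<And>v. 0 \<le> g v" "\<And>v. g v \<le> C" and C: "0 < C" and \<epsilon>: "0 < \<epsilon>"
  shows "measure (law {..<N}) {v \<in> space (law {..<N}).
      real n * \<epsilon> \<le> \<bar>(\<Sum>j<n. g (\<lambda>i\<in>{..<k}. v (j * k + i))) - real n * (\<integral>v. g v \<partial>law {..<k})\<bar>}
    \<le> 2 * exp (- 2 * real n * \<epsilon>\<^sup>2 / C\<^sup>2)"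
proof -
  interpret prob_space "law {..<N}" by (rule prob_space_law)
  have "expectation (\<lambda>v. g (\<lambda>i\<in>{..<k}. v (j * k + i))) = (\<integral>v. g v \<partial>law {..<k})" if "j < n" for j
  proof (rule integral_law_reindex)
    have "(j + 1) * k \<le> n * k"
      using that by (intro mult_right_mono) auto
    then show "(+) (j * k) \<in> {..<k} \<rightarrow> {..<N}"
      using nk by auto
  qed auto
  then have \<mu>: "(\<Sum>j<n. expectation (\<lambda>v. g (\<lambda>i\<in>{..<k}. v (j * k + i)))) = real n * (\<integral>v. g v \<partial>law {..<k})"
    by simp
  interpret Hoeffding_ineq "law {..<N}" "{..<n}" "\<lambda>j v. g (\<lambda>i\<in>{..<k}. v (j * k + i))" "\<lambda>_. 0" "\<lambda>_. C"
      "real n * (\<integral>v. g v \<partial>law {..<k})"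
    using indep_blocks[OF N nk g] bd by unfold_locales (auto simp: \<mu>)
  have "prob {v \<in> space (law {..<N}).
      real n * \<epsilon> \<le> \<bar>(\<Sum>j<n. g (\<lambda>i\<in>{..<k}. v (j * k + i))) - real n * (\<integral>v. g v \<partial>law {..<k})\<bar>}
    \<le> 2 * exp (- 2 * (real n * \<epsilon>)\<^sup>2 / (\<Sum>j<n. (C - 0)\<^sup>2))"
    using n \<epsilon> C by (intro Hoeffding_ineq_abs_ge) auto
  also have "- 2 * (real n * \<epsilon>)\<^sup>2 / (\<Sum>j<n. (C - 0)\<^sup>2) = - 2 * real n * \<epsilon>\<^sup>2 / C\<^sup>2"
    using n C by (simp add: power2_eq_square field_simps)
  finally show ?thesis .
qed

text \<open>Off the event \<open>B\<close> that the block average deviates by at least \<epsilon>,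
  the error is at most \<epsilon> times the weight. On \<open>B\<close> the weight is only bounded
  by 1, so this contribution carries no factor \<open>mass N\<close>: after normalisation the
  probability of \<open>B\<close> has to be small compared with the mass.\<close>

lemma weighted_block_mean:
  fixes g :: "(nat \<Rightarrow> real) \<Rightarrow> real"
  assumes N: "N \<ge> 1" and n: "n \<ge> 1" and nk: "n * k \<le> N"
    and g[measurable]: "g \<in> borel_measurable (\<Pi>\<^sub>M i\<in>{..<k}. borel)"
    and bd: "\<And>v. 0 \<le> g v" "\<And>v. g v \<le> C" and C: "0 < C" and \<epsilon>: "0 < \<epsilon>"
  shows "\<bar>(\<integral>v. weight N v * g (restrict v {..<k}) \<partial>law {..<N}) - (\<integral>v. g v \<partial>law {..<k}) * mass N\<bar>
    \<le> \<epsilon> * mass N + C * (2 * exp (- 2 * real n * \<epsilon>\<^sup>2 / C\<^sup>2))"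
proof -
  interpret prob_space "law {..<N}" by (rule prob_space_law)
  define m where "m = (\<integral>v. g v \<partial>law {..<k})"
  let ?X = "\<lambda>j v. g (\<lambda>i\<in>{..<k}. v (j * k + i))"
  let ?S = "\<lambda>v. (\<Sum>j<n. ?X j v) - real n * m"
  define B where "B = {v \<in> space (law {..<N}). real n * \<epsilon> \<le> \<bar>?S v\<bar>}"
  have [measurable]: "?X j \<in> borel_measurable (\<Pi>\<^sub>M i\<in>{..<N}. borel)" if "j < n" for j
    using measurable_compose[OF restrict_measurable_block[OF that nk] g] .
  have "B \<in> sets (law {..<N})"
    unfolding B_def by measurable
  then have [measurable, simp]: "B \<in> sets (\<Pi>\<^sub>M i\<in>{..<N}. borel)"
    by simp
  interpret K: prob_space "law {..<k}" by (rule prob_space_law)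
  have "integrable (law {..<k}) g"
    using bd by (intro K.integrable_const_bound[where B = C]) auto
  then have m: "0 \<le> m" "m \<le> C"
    unfolding m_def using bd K.integral_le_const[of g C] by auto
  have S: "\<bar>?S v\<bar> \<le> real n * C" for v
  proof -
    have "0 \<le> (\<Sum>j<n. ?X j v)" "(\<Sum>j<n. ?X j v) \<le> real n * C"
      using bd sum_bounded_above[of "{..<n}" "\<lambda>j. ?X j v" C] by (auto intro: sum_nonneg)
    moreover have "0 \<le> real n * m" "real n * m \<le> real n * C"
      using m by (auto intro: mult_left_mono)
    ultimately show ?thesis by linarith
  qed
  have intX: "integrable (law {..<N}) (\<lambda>v. weight N v * ?X j v)" if "j < n" for j
    using bd that by (intro integrable_weight_bounded[OF N, of _ C]) auto
  have intW: "integrable (law {..<N}) (weight N)"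
    using integrable_weight_bounded[OF N, of "\<lambda>_. 1" 1] by simp
  have intS: "integrable (law {..<N}) (\<lambda>v. weight N v * ?S v)"
    using S by (intro integrable_weight_bounded[OF N, of _ "real n * C"]) auto
  have "real n * ((\<integral>v. weight N v * g (restrict v {..<k}) \<partial>law {..<N}) - m * mass N)
      = (\<Sum>j<n. \<integral>v. weight N v * ?X j v \<partial>law {..<N}) - real n * m * mass N"
    using weight_block_symmetry[OF _ nk g] by (simp add: algebra_simps)
  also have "\<dots> = (\<integral>v. (\<Sum>j<n. weight N v * ?X j v) - real n * m * weight N v \<partial>law {..<N})"
    using intX intW
    by (subst Bochner_Integration.integral_diff)
      (auto simp: mass_def Bochner_Integration.integral_sum intro!: Bochner_Integration.integrable_sum)
  also have "\<dots> = (\<integral>v. weight N v * ?S v \<partial>law {..<N})"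
    by (intro Bochner_Integration.integral_cong) (simp_all add: algebra_simps sum_distrib_left)
  finally have E: "real n * ((\<integral>v. weight N v * g (restrict v {..<k}) \<partial>law {..<N}) - m * mass N)
      = (\<integral>v. weight N v * ?S v \<partial>law {..<N})" .
  have "real n * \<bar>(\<integral>v. weight N v * g (restrict v {..<k}) \<partial>law {..<N}) - m * mass N\<bar>
      = \<bar>\<integral>v. weight N v * ?S v \<partial>law {..<N}\<bar>"
    unfolding E[symmetric] by (simp add: abs_mult)
  also have "\<dots> \<le> (\<integral>v. \<bar>weight N v * ?S v\<bar> \<partial>law {..<N})"
    by (rule integral_abs_bound)
  also have "\<dots> \<le> (\<integral>v. real n * \<epsilon> * weight N v + real n * C * indicator B v \<partial>law {..<N})"
  proof (rule integral_mono)
    show "integrable (law {..<N}) (\<lambda>v. \<bar>weight N v * ?S v\<bar>)"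
      using intS by (rule integrable_abs)
    show "integrable (law {..<N}) (\<lambda>v. real n * \<epsilon> * weight N v + real n * C * indicator B v)"
      using intW by (intro Bochner_Integration.integrable_add integrable_mult_right integrable_real_indicator)
        (auto simp: less_top[symmetric])
    fix v assume v: "v \<in> space (law {..<N})"
    show "\<bar>weight N v * ?S v\<bar> \<le> real n * \<epsilon> * weight N v + real n * C * indicator B v"
    proof (cases "v \<in> B")
      case True
      have "weight N v * \<bar>?S v\<bar> \<le> 1 * (real n * C)"
        using S weight_le_1[OF N] weight_nonneg by (intro mult_mono) auto
      moreover have "0 \<le> real n * \<epsilon> * weight N v"
        using \<epsilon> weight_nonneg by simp
      ultimately show ?thesis
        using True weight_nonneg[of N v] by (simp add: abs_mult)
    next
      case False
      then have "\<bar>?S v\<bar> \<le> real n * \<epsilon>"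
        using v by (simp add: B_def)
      then have "weight N v * \<bar>?S v\<bar> \<le> weight N v * (real n * \<epsilon>)"
        using weight_nonneg by (rule mult_left_mono)
      then show ?thesis
        using False weight_nonneg[of N v] by (simp add: abs_mult mult.commute)
    qed
  qed
  also have "\<dots> = real n * \<epsilon> * mass N + real n * C * prob B"
    using intW sets.sets_into_space[of B "law {..<N}"]
    by (subst Bochner_Integration.integral_add) (auto simp: mass_def less_top[symmetric] Int_absorb2)
  also have "\<dots> \<le> real n * \<epsilon> * mass N + real n * C * (2 * exp (- 2 * real n * \<epsilon>\<^sup>2 / C\<^sup>2))"
    using block_average_concentration[OF N n nk g bd C \<epsilon>] C
    unfolding B_def m_def by (intro add_left_mono mult_left_mono) auto
  also have "\<dots> = real n * (\<epsilon> * mass N + C * (2 * exp (- 2 * real n * \<epsilon>\<^sup>2 / C\<^sup>2)))"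
    by (simp add: algebra_simps)
  finally show ?thesis
    using n unfolding m_def by simp
qed

end

section \<open>Probability of the shell under the mixture\<close>

lemma maxwellian_eq_normal_density:
  "0 < a \<Longrightarrow> maxwellian a = normal_density 0 (sqrt a)"
  by (auto simp: maxwellian_def normal_density_def fun_eq_iff)

lemma maxwellian_inverse:
  "0 < a \<Longrightarrow> maxwellian (1 / (2 * a)) x = sqrt (a / pi) * exp (- a * x\<^sup>2)"
  by (simp add: maxwellian_def real_sqrt_divide mult.commute)

lemma real_density_maxwellian:
  assumes "0 < a"
  shows "real_density (maxwellian a)"
proof -
  have "(\<integral>\<^sup>+x. ennreal (normal_density 0 (sqrt a) x) \<partial>lborel) = ennreal (\<integral>x. normal_density 0 (sqrt a) x \<partial>lborel)"
    using assms by (intro nn_integral_eq_integral) auto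
  then show ?thesis
    using assms by (simp add: real_density_def maxwellian_eq_normal_density)
qed

lemma nn_integral_maxwellian_square:
  assumes "0 < a"
  shows "(\<integral>\<^sup>+x. ennreal (x\<^sup>2 * maxwellian a x) \<partial>lborel) = ennreal a"
proof -
  have "has_bochner_integral lborel (\<lambda>x. maxwellian a x * x\<^sup>2) a"
    using normal_moment_even[of "sqrt a" 0 1] assms
    by (simp add: maxwellian_eq_normal_density fact_numeral)
  then have "has_bochner_integral lborel (\<lambda>x. x\<^sup>2 * maxwellian a x) a"
    by (simp add: mult.commute)
  then show ?thesis
    using assms
    by (subst nn_integral_eq_integral)
      (auto simp: maxwellian_def has_bochner_integral_iff)
qed

lemma maxwellian_mixture_eq:
  assumes "0 < \<delta>" "\<delta> < 1"
  shows "maxwellian_mixture \<delta> x = \<delta> * (sqrt (\<delta> / pi) * exp (- \<delta> * x\<^sup>2))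
    + (1 - \<delta>) * (sqrt ((1 - \<delta>) / pi) * exp (- (1 - \<delta>) * x\<^sup>2))"
  unfolding maxwellian_mixture_def using assms by (subst (1 2) maxwellian_inverse) simp_all

lemma real_density_mixture:
  assumes "0 < \<delta>" "\<delta> \<le> 1"
  shows "real_density (maxwellian_mixture \<delta>)"
proof (cases "\<delta> = 1")
  case True
  then have "maxwellian_mixture \<delta> = maxwellian (1 / 2)"
    by (simp add: maxwellian_mixture_def fun_eq_iff)
  then show ?thesis
    by (simp add: real_density_maxwellian)
next
  case False
  let ?h = "maxwellian (1 / (2 * \<delta>))" and ?c = "maxwellian (1 / (2 * (1 - \<delta>)))"
  have d: "0 < 1 - \<delta>"
    using assms False by simp
  have h: "real_density ?h" and c: "real_density ?c"
    using assms d by (auto intro!: real_density_maxwellian)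
  have [measurable]: "?h \<in> borel_measurable borel" "?c \<in> borel_measurable borel"
    using h c by (auto simp: real_density_def)
  have "(\<integral>\<^sup>+x. ennreal (maxwellian_mixture \<delta> x) \<partial>lborel)
      = (\<integral>\<^sup>+x. ennreal \<delta> * ennreal (?h x) + ennreal (1 - \<delta>) * ennreal (?c x) \<partial>lborel)"
    using h c assms d
    by (intro nn_integral_cong) (simp add: maxwellian_mixture_def real_density_def ennreal_mult)
  also have "\<dots> = ennreal \<delta> * 1 + ennreal (1 - \<delta>) * 1"
    using h c by (subst nn_integral_add) (auto simp: nn_integral_cmult real_density_def)
  also have "\<dots> = 1"
    using assms d by (simp flip: ennreal_plus)
  finally show ?thesis
    using h c assms d unfolding real_density_def
    by (auto simp: maxwellian_mixture_def[abs_def])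
qed

lemma radial_density_maxwellian:
  assumes a: "0 < a" "a \<le> 1"
  shows "radial_density (maxwellian (1 / (2 * a)))"
proof
  show "real_density (maxwellian (1 / (2 * a)))"
    using a by (intro real_density_maxwellian) simp
  fix c x :: real
  show "0 < maxwellian (1 / (2 * a)) x"
    using a by (simp add: maxwellian_inverse)
  assume c: "1 \<le> c"
  have c2: "1 \<le> c\<^sup>2"
    using c by simp
  have "a * (1 * x\<^sup>2) \<le> a * (c\<^sup>2 * x\<^sup>2)"
    using a c2 by (intro mult_left_mono mult_right_mono) auto
  then show "maxwellian (1 / (2 * a)) (c * x) \<le> maxwellian (1 / (2 * a)) x"
    using a by (simp add: maxwellian_inverse power_mult_distrib mult_left_mono)
  have "a * ((c\<^sup>2 - 1) * x\<^sup>2) \<le> 1 * ((c\<^sup>2 - 1) * x\<^sup>2)"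
    using a c2 by (intro mult_right_mono) auto
  then have "exp (- (c\<^sup>2 - 1) * x\<^sup>2 - a * x\<^sup>2) \<le> exp (- a * (c * x)\<^sup>2)"
    by (simp add: algebra_simps power_mult_distrib)
  then have "sqrt (a / pi) * exp (- (c\<^sup>2 - 1) * x\<^sup>2 - a * x\<^sup>2) \<le> sqrt (a / pi) * exp (- a * (c * x)\<^sup>2)"
    using a by (intro mult_left_mono) auto
  then show "exp (- (c\<^sup>2 - 1) * x\<^sup>2) * maxwellian (1 / (2 * a)) x \<le> maxwellian (1 / (2 * a)) (c * x)"
    unfolding maxwellian_inverse[OF a(1)]
    by (simp add: exp_add[symmetric] mult.left_commute[of _ "sqrt (a / pi)"])
qed

lemma radial_density_mixture:
  assumes "0 < \<delta>" "\<delta> < 1"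
  shows "radial_density (maxwellian_mixture \<delta>)"
proof -
  interpret h: radial_density "maxwellian (1 / (2 * \<delta>))"
    using assms by (intro radial_density_maxwellian) auto
  interpret c: radial_density "maxwellian (1 / (2 * (1 - \<delta>)))"
    using assms by (intro radial_density_maxwellian) auto
  show ?thesis
  proof
    show "real_density (maxwellian_mixture \<delta>)"
      using assms by (intro real_density_mixture) auto
    fix c x :: real
    show "0 < maxwellian_mixture \<delta> x"
      using assms h.pos c.pos by (auto simp: maxwellian_mixture_def intro!: add_pos_pos mult_pos_pos)
    assume c: "1 \<le> c"
    show "maxwellian_mixture \<delta> (c * x) \<le> maxwellian_mixture \<delta> x"
      unfolding maxwellian_mixture_def
      using assms h.scale_le[OF c] c.scale_le[OF c] by (intro add_mono mult_left_mono) auto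
    have "exp (- (c\<^sup>2 - 1) * x\<^sup>2) * maxwellian_mixture \<delta> x
      = \<delta> * (exp (- (c\<^sup>2 - 1) * x\<^sup>2) * maxwellian (1 / (2 * \<delta>)) x)
        + (1 - \<delta>) * (exp (- (c\<^sup>2 - 1) * x\<^sup>2) * maxwellian (1 / (2 * (1 - \<delta>))) x)"
      unfolding maxwellian_mixture_def by (simp only: distrib_left mult.left_commute)
    also have "\<dots> \<le> maxwellian_mixture \<delta> (c * x)"
      unfolding maxwellian_mixture_def
      using assms h.scale_ge[OF c] c.scale_ge[OF c] by (intro add_mono mult_left_mono) auto
    finally show "exp (- (c\<^sup>2 - 1) * x\<^sup>2) * maxwellian_mixture \<delta> x \<le> maxwellian_mixture \<delta> (c * x)" .
  qed
qed

lemma (in radial_density) nn_integral_law_component: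
  assumes "i \<in> I" and [measurable]: "h \<in> borel_measurable borel"
  shows "(\<integral>\<^sup>+v. h (v i) \<partial>law I) = (\<integral>\<^sup>+x. ennreal (f x) * h x \<partial>lborel)"
proof -
  let ?D = "density lborel (\<lambda>x. ennreal (f x))"
  have "(\<integral>\<^sup>+x. ennreal (f x) * h x \<partial>lborel) = (\<integral>\<^sup>+x. h x \<partial>?D)"
    by (simp add: nn_integral_density)
  also have "?D = distr (law I) ?D (\<lambda>v. v i)"
    unfolding law_def using prob_space_real_density[OF real_density] assms(1)
    by (intro distr_PiM_component[symmetric]) auto
  also have "(\<integral>\<^sup>+x. h x \<partial>\<dots>) = (\<integral>\<^sup>+v. h (v i) \<partial>law I)"
    unfolding law_def using assms(1) by (intro nn_integral_distr) auto
  finally show ?thesis ..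
qed

text \<open>For \<delta> at most 1/9 a cold particle has mean energy at most 9/16, so Markov's
  inequality at level 3/4 per particle leaves a failure probability of at most 3/4. The lemma is
  used with \<open>n + 1 = N\<close>: the level 3N/4 is at most N - 1 once \<open>N \<ge> 4\<close>,
  which leaves the last particle energy to absorb.\<close>

lemma cold_energy_markov:
  assumes d: "0 \<le> \<delta>" "\<delta> \<le> 1 / 9" and n: "0 < n"
  defines "M \<equiv> maxwellian (1 / (2 * (1 - \<delta>)))"
  shows "1 / 4 \<le> measure (radial_density.law M {..<n})
    {v \<in> space (radial_density.law M {..<n}). (\<Sum>i<n. (v i)\<^sup>2) \<le> 3 / 4 * (real n + 1)}"
proof -
  interpret radial_density M
    unfolding M_def using d by (intro radial_density_maxwellian) auto
  interpret prob_space "law {..<n}" by (rule prob_space_law)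
  have comp: "(\<integral>\<^sup>+v. ennreal ((v i)\<^sup>2) \<partial>law {..<n}) = ennreal (1 / (2 * (1 - \<delta>)))" if "i < n" for i
  proof -
    have "(\<integral>\<^sup>+v. ennreal ((v i)\<^sup>2) \<partial>law {..<n}) = (\<integral>\<^sup>+x. ennreal (M x) * ennreal (x\<^sup>2) \<partial>lborel)"
      using that by (intro nn_integral_law_component) auto
    also have "\<dots> = (\<integral>\<^sup>+x. ennreal (x\<^sup>2 * M x) \<partial>lborel)"
      using pos by (intro nn_integral_cong) (simp add: ennreal_mult'' less_imp_le mult.commute)
    also have "\<dots> = ennreal (1 / (2 * (1 - \<delta>)))"
      unfolding M_def using d by (intro nn_integral_maxwellian_square) auto
    finally show ?thesis .
  qed
  have "(\<integral>\<^sup>+v. ennreal (\<Sum>i<n. (v i)\<^sup>2) \<partial>law {..<n}) = (\<integral>\<^sup>+v. (\<Sum>i<n. ennreal ((v i)\<^sup>2)) \<partial>law {..<n})"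
    by (intro nn_integral_cong) simp
  also have "\<dots> = (\<Sum>i<n. \<integral>\<^sup>+v. ennreal ((v i)\<^sup>2) \<partial>law {..<n})"
    by (rule nn_integral_sum) simp
  also have "\<dots> = (\<Sum>i<n. ennreal (1 / (2 * (1 - \<delta>))))"
    using comp by (intro sum.cong) auto
  also have "\<dots> = ennreal (real n / (2 * (1 - \<delta>)))"
    using d by (simp add: ennreal_of_nat_eq_real_of_nat flip: ennreal_mult)
  finally have E: "(\<integral>\<^sup>+v. ennreal (\<Sum>i<n. (v i)\<^sup>2) \<partial>law {..<n}) = ennreal (real n / (2 * (1 - \<delta>)))" .
  let ?c = "4 / (3 * (real n + 1))"
  let ?B = "{v \<in> space (law {..<n}). 1 \<le> ennreal ?c * ennreal (\<Sum>i<n. (v i)\<^sup>2)}"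
  let ?G = "{v \<in> space (law {..<n}). (\<Sum>i<n. (v i)\<^sup>2) \<le> 3 / 4 * (real n + 1)}"
  have "emeasure (law {..<n}) ?B \<le> ennreal ?c * (\<integral>\<^sup>+v. ennreal (\<Sum>i<n. (v i)\<^sup>2) \<partial>law {..<n})"
  proof -
    have "emeasure (law {..<n}) ?B
      \<le> ennreal ?c * (\<integral>\<^sup>+v. ennreal (\<Sum>i<n. (v i)\<^sup>2) * indicator (space (law {..<n})) v \<partial>law {..<n})"
      by (rule nn_integral_Markov_inequality) measurable
    also have "(\<integral>\<^sup>+v. ennreal (\<Sum>i<n. (v i)\<^sup>2) * indicator (space (law {..<n})) v \<partial>law {..<n})
      = (\<integral>\<^sup>+v. ennreal (\<Sum>i<n. (v i)\<^sup>2) \<partial>law {..<n})"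
      by (intro nn_integral_cong) (simp add: indicator_def)
    finally show ?thesis .
  qed
  also have "\<dots> = ennreal (?c * (real n / (2 * (1 - \<delta>))))"
    unfolding E using d by (intro ennreal_mult[symmetric]) auto
  also have "\<dots> \<le> ennreal (3 / 4)"
  proof (rule ennreal_leI)
    have "16 * real n \<le> 18 * (1 - \<delta>) * real n"
      using d by (intro mult_right_mono) auto
    also have "\<dots> \<le> 18 * (1 - \<delta>) * (real n + 1)"
      using d by (intro mult_left_mono) auto
    finally have *: "16 * real n \<le> 18 * ((1 - \<delta>) * (real n + 1))"
      by (simp only: mult.assoc)
    have "?c * (real n / (2 * (1 - \<delta>))) = 16 * real n / (24 * ((1 - \<delta>) * (real n + 1)))"
    proof -
      have "4 / (3 * b) * (m / (2 * a)) = 16 * m / (24 * (a * b))" for a b m :: real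
        by simp
      then show ?thesis .
    qed
    also have "\<dots> \<le> 3 / 4"
      using d * by (subst pos_divide_le_eq) (auto intro!: mult_pos_pos)
    finally show "?c * (real n / (2 * (1 - \<delta>))) \<le> 3 / 4" .
  qed
  finally have "prob ?B \<le> 3 / 4"
    by (simp add: emeasure_eq_measure)
  moreover have "space (law {..<n}) - ?B \<subseteq> ?G"
  proof
    fix v assume v: "v \<in> space (law {..<n}) - ?B"
    have "0 \<le> (\<Sum>i<n. (v i)\<^sup>2)"
      by (intro sum_nonneg) simp
    then have "ennreal ?c * ennreal (\<Sum>i<n. (v i)\<^sup>2) = ennreal (?c * (\<Sum>i<n. (v i)\<^sup>2))"
      by (intro ennreal_mult[symmetric]) auto
    then have "?c * (\<Sum>i<n. (v i)\<^sup>2) < 1"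
      using v by (simp add: not_le)
    then have "4 * (\<Sum>i<n. (v i)\<^sup>2) < 3 * (real n + 1)"
      by (simp add: divide_less_eq)
    then show "v \<in> ?G"
      using v by (simp add: field_simps)
  qed
  then have "prob (space (law {..<n}) - ?B) \<le> prob ?G"
    by (intro finite_measure_mono) measurable
  moreover have "prob (space (law {..<n}) - ?B) = 1 - prob ?B"
    by (intro prob_compl) measurable
  ultimately show ?thesis by linarith
qed

text \<open>The total energy is brought into the shell by one hot particle, which absorbs what the
  cold ones leave over.\<close>

lemma hot_particle_fills_shell:
  fixes E h :: real and f :: "real \<Rightarrow> real"
  assumes [measurable]: "f \<in> borel_measurable borel"
    and f: "\<And>x. x\<^sup>2 \<le> N \<Longrightarrow> h \<le> f x" and h: "0 \<le> h" and E: "0 \<le> E" "E \<le> N - 1"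
  shows "ennreal (h / (2 * sqrt N))
    \<le> (\<integral>\<^sup>+x. ennreal (f x) * indicator {x. N - 1 < E + x\<^sup>2 \<and> E + x\<^sup>2 \<le> N} x \<partial>lborel)"
proof -
  let ?a = "sqrt (N - 1 - E)" and ?b = "sqrt (N - E)"
  have b: "?b \<le> sqrt N" "0 < ?b" "?a \<le> ?b" "0 \<le> ?a"
    using E by auto
  \<comment> \<open>The admissible energies of the particle fill an interval of length 1. Its
    positive velocities then fill one of length 1 / (?b + ?a), and both roots are at most
    \<open>sqrt N\<close>.\<close>
  have "(?b - ?a) * (?b + ?a) = 1"
    using E by (simp add: algebra_simps flip: power2_eq_square)
  then have "?b - ?a = 1 / (?b + ?a)"
    using b by (subst nonzero_eq_divide_eq) auto
  moreover have "1 / (2 * sqrt N) \<le> 1 / (?b + ?a)"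
  proof -
    have "?b + ?a \<le> 2 * sqrt N" "0 < ?b + ?a"
      using b by linarith+
    then show ?thesis
      by (intro frac_le) auto
  qed
  ultimately have len: "1 / (2 * sqrt N) \<le> ?b - ?a"
    by simp
  have "ennreal (h / (2 * sqrt N)) \<le> ennreal (h * (?b - ?a))"
    using mult_left_mono[OF len h] by (intro ennreal_leI) simp
  also have "\<dots> = (\<integral>\<^sup>+x. ennreal h * indicator {?a<..?b} x \<partial>lborel)"
    using h b by (simp add: nn_integral_cmult_indicator ennreal_mult)
  also have "\<dots> \<le> (\<integral>\<^sup>+x. ennreal (f x) * indicator {x. N - 1 < E + x\<^sup>2 \<and> E + x\<^sup>2 \<le> N} x \<partial>lborel)"
  proof (rule nn_integral_mono)
    fix x :: real
    show "ennreal h * indicator {?a<..?b} x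
      \<le> ennreal (f x) * indicator {x. N - 1 < E + x\<^sup>2 \<and> E + x\<^sup>2 \<le> N} x"
    proof (cases "x \<in> {?a<..?b}")
      case True
      then have x: "?a < x" "x \<le> ?b"
        by simp_all
      then have "0 \<le> x"
        using b(4) by linarith
      have "?a\<^sup>2 < x\<^sup>2"
        by (rule power_strict_mono) (use x b in auto)
      moreover have "x\<^sup>2 \<le> ?b\<^sup>2"
        by (rule power_mono) (use x \<open>0 \<le> x\<close> in auto)
      ultimately have "N - 1 < E + x\<^sup>2" "E + x\<^sup>2 \<le> N"
        using E by simp_all
      then show ?thesis
        using f[of x] E by (simp add: indicator_def ennreal_leI)
    qed simp
  qed
  finally show ?thesis .
qed

text \<open>The last coordinate is integrated first. It is bounded below by the hot component at
  energy at most \<open>N\<close>, times the length of the velocity interval. The other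
  \<open>N - 1\<close> coordinates are bounded below by their cold components, which costs the power
  of 1 - \<delta>, and 1/4 is the probability that their energy leaves room.\<close>

lemma measure_shell_mixture_ge:
  assumes d: "0 < \<delta>" "\<delta> \<le> 1 / 9" and N: "N \<ge> 4"
  defines "f \<equiv> maxwellian_mixture \<delta>"
  shows "\<delta> * sqrt (\<delta> / pi) * exp (- \<delta> * N) / (2 * sqrt N) * ((1 - \<delta>) ^ (N - 1) * (1 / 4))
    \<le> measure (radial_density.law f {..<N}) (kac_shell N)"
proof -
  define M where "M = maxwellian (1 / (2 * (1 - \<delta>)))"
  define n where "n = N - 1"
  define h where "h = \<delta> * sqrt (\<delta> / pi) * exp (- \<delta> * N)"
  let ?h = "ennreal (h / (2 * sqrt N))"
  have Nn: "{..<N} = insert n {..<n}" "N = Suc n"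
    using N by (auto simp: n_def)
  interpret f: radial_density f
    unfolding f_def using d by (intro radial_density_mixture) auto
  interpret M: radial_density M
    unfolding M_def using d by (intro radial_density_maxwellian) auto
  interpret L: product_sigma_finite "\<lambda>_. lborel :: real measure"
    by (rule product_sigma_finite_lborel)
  interpret P: prob_space "f.law {..<N}" by (rule f.prob_space_law)
  interpret Q: prob_space "M.law {..<n}" by (rule M.prob_space_law)
  define G where "G = {v \<in> space (M.law {..<n}). (\<Sum>i<n. (v i)\<^sup>2) \<le> 3 / 4 * (real n + 1)}"
  have G_sets[measurable]: "G \<in> sets (\<Pi>\<^sub>M i\<in>{..<n}. borel)"
    unfolding G_def M.sets_law[symmetric] by measurable
  then have [measurable]: "G \<in> sets (lborel_pow n)"
    by (simp only: sets_lborel_pow)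
  have [measurable]: "kac_shell N \<in> sets (lborel_pow N)"
    using kac_shell_sets sets_lborel_pow by blast
  have h: "0 \<le> h"
    using d by (simp add: h_def)
  have f_h: "h \<le> f x" if "x\<^sup>2 \<le> real N" for x
  proof -
    have "\<delta> * (sqrt (\<delta> / pi) * exp (- \<delta> * N)) \<le> \<delta> * (sqrt (\<delta> / pi) * exp (- \<delta> * x\<^sup>2))"
      using d that by (intro mult_left_mono) auto
    then show ?thesis
      using d unfolding f_def by (subst maxwellian_mixture_eq) (auto simp: h_def intro!: add_increasing2)
  qed
  have f_M: "(1 - \<delta>) * M x \<le> f x" for x
    using d by (simp add: f_def M_def maxwellian_mixture_def maxwellian_def)
  have prod: "(1 - \<delta>) ^ n * (\<Prod>i<n. M (v i)) \<le> (\<Prod>i<n. f (v i))" for v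
  proof -
    have "(1 - \<delta>) ^ n * (\<Prod>i<n. M (v i)) = (\<Prod>i<n. (1 - \<delta>) * M (v i))"
      by (simp add: prod.distrib)
    also have "\<dots> \<le> (\<Prod>i<n. f (v i))"
      using f_M M.pos d by (intro prod_mono) (auto simp: less_imp_le)
    finally show ?thesis .
  qed
  have inner: "?h * ennreal ((1 - \<delta>) ^ n) * (ennreal (\<Prod>i<n. M (v i)) * indicator G v)
    \<le> (\<integral>\<^sup>+x. ennreal (\<Prod>i<N. f ((v(n := x)) i)) * indicator (kac_shell N) (v(n := x)) \<partial>lborel)"
    if v: "v \<in> space (lborel_pow n)" for v
  proof (cases "v \<in> G")
    case True
    let ?E = "\<Sum>i<n. (v i)\<^sup>2"
    have E: "0 \<le> ?E" "?E \<le> real N - 1"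
    proof -
      have "?E \<le> 3 / 4 * real N"
        using True by (simp add: G_def Nn(2) add.commute)
      moreover have "4 \<le> real N"
        using N by simp
      ultimately show "?E \<le> real N - 1"
        by linarith
    qed (simp add: sum_nonneg)
    have "(\<integral>\<^sup>+x. ennreal (\<Prod>i<N. f ((v(n := x)) i)) * indicator (kac_shell N) (v(n := x)) \<partial>lborel)
      = (\<integral>\<^sup>+x. ennreal (\<Prod>i<n. f (v i)) * (ennreal (f x) * indicator {x. N - 1 < ?E + x\<^sup>2 \<and> ?E + x\<^sup>2 \<le> N} x) \<partial>lborel)"
    proof (rule nn_integral_cong)
      fix x :: real
      have "(\<Sum>i<N. ((v(n := x)) i)\<^sup>2) = ?E + x\<^sup>2"
        unfolding Nn(1) by simp
      moreover have "(\<Prod>i<N. f ((v(n := x)) i)) = (\<Prod>i<n. f (v i)) * f x"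
        unfolding Nn(1) by simp
      moreover have "v(n := x) \<in> {..<N} \<rightarrow>\<^sub>E UNIV"
        using v by (auto simp: space_PiM PiE_iff extensional_def Nn(2))
      ultimately show "ennreal (\<Prod>i<N. f ((v(n := x)) i)) * indicator (kac_shell N) (v(n := x))
        = ennreal (\<Prod>i<n. f (v i)) * (ennreal (f x) * indicator {x. N - 1 < ?E + x\<^sup>2 \<and> ?E + x\<^sup>2 \<le> N} x)"
        using f.pos N by (simp add: kac_shell_def indicator_def ennreal_mult less_imp_le prod_nonneg of_nat_diff)
    qed
    also have "\<dots> = ennreal (\<Prod>i<n. f (v i)) * (\<integral>\<^sup>+x. ennreal (f x) * indicator {x. N - 1 < ?E + x\<^sup>2 \<and> ?E + x\<^sup>2 \<le> N} x \<partial>lborel)"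
      by (rule nn_integral_cmult) measurable
    finally have eq: "(\<integral>\<^sup>+x. ennreal (\<Prod>i<N. f ((v(n := x)) i)) * indicator (kac_shell N) (v(n := x)) \<partial>lborel)
      = ennreal (\<Prod>i<n. f (v i)) * (\<integral>\<^sup>+x. ennreal (f x) * indicator {x. N - 1 < ?E + x\<^sup>2 \<and> ?E + x\<^sup>2 \<le> N} x \<partial>lborel)" .
    have "?h \<le> (\<integral>\<^sup>+x. ennreal (f x) * indicator {x. N - 1 < ?E + x\<^sup>2 \<and> ?E + x\<^sup>2 \<le> N} x \<partial>lborel)"
      using hot_particle_fills_shell[of f "real N" h ?E] f_h h E N by (simp add: of_nat_diff)
    moreover have "ennreal ((1 - \<delta>) ^ n) * ennreal (\<Prod>i<n. M (v i)) \<le> ennreal (\<Prod>i<n. f (v i))"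
      using prod[of v] d M.pos by (subst ennreal_mult[symmetric]) (auto intro!: ennreal_leI prod_nonneg simp: less_imp_le)
    ultimately have "?h * (ennreal ((1 - \<delta>) ^ n) * ennreal (\<Prod>i<n. M (v i)))
      \<le> (\<integral>\<^sup>+x. ennreal (f x) * indicator {x. N - 1 < ?E + x\<^sup>2 \<and> ?E + x\<^sup>2 \<le> N} x \<partial>lborel)
        * ennreal (\<Prod>i<n. f (v i))"
      by (intro mult_mono) auto
    then show ?thesis
      unfolding eq using True by (simp add: ac_simps)
  qed simp
  have "?h * ennreal ((1 - \<delta>) ^ n) * ennreal (1 / 4) \<le> ?h * ennreal ((1 - \<delta>) ^ n) * emeasure (M.law {..<n}) G"
  proof (rule mult_left_mono)
    have "1 / 4 \<le> Q.prob G"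
      by (rule cold_energy_markov[of \<delta> n, folded M_def, folded G_def]) (use d N in \<open>auto simp: n_def\<close>)
    then show "ennreal (1 / 4) \<le> emeasure (M.law {..<n}) G"
      unfolding Q.emeasure_eq_measure by (rule ennreal_leI)
  qed simp
  also have "\<dots> = ?h * ennreal ((1 - \<delta>) ^ n) * (\<integral>\<^sup>+v. ennreal (\<Prod>i<n. M (v i)) * indicator G v \<partial>lborel_pow n)"
    unfolding M.law_eq_density[OF finite_lessThan] by (subst emeasure_density) auto
  also have "\<dots> = (\<integral>\<^sup>+v. ?h * ennreal ((1 - \<delta>) ^ n) * (ennreal (\<Prod>i<n. M (v i)) * indicator G v) \<partial>lborel_pow n)"
    by (rule nn_integral_cmult[symmetric]) measurable
  also have "\<dots> \<le> (\<integral>\<^sup>+v. (\<integral>\<^sup>+x. ennreal (\<Prod>i<N. f ((v(n := x)) i)) * indicator (kac_shell N) (v(n := x)) \<partial>lborel) \<partial>lborel_pow n)"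
    by (rule nn_integral_mono) (rule inner)
  also have "\<dots> = (\<integral>\<^sup>+v. ennreal (\<Prod>i<N. f (v i)) * indicator (kac_shell N) v \<partial>lborel_pow N)"
    unfolding Nn(1)
    by (subst L.product_nn_integral_insert) (auto simp flip: Nn(1))
  also have "\<dots> = emeasure (f.law {..<N}) (kac_shell N)"
    unfolding f.law_eq_density[OF finite_lessThan] by (subst emeasure_density) measurable
  finally have "?h * ennreal ((1 - \<delta>) ^ n) * ennreal (1 / 4) \<le> ennreal (P.prob (kac_shell N))"
    by (simp add: P.emeasure_eq_measure)
  moreover have "?h * ennreal ((1 - \<delta>) ^ n) * ennreal (1 / 4) = ennreal (h / (2 * sqrt N) * ((1 - \<delta>) ^ n * (1 / 4)))"
    using h d by (simp add: mult.assoc flip: ennreal_mult)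
  ultimately show ?thesis
    by (simp add: h_def n_def)
qed

text \<open>Since \<delta> N is at most sqrt N, one factor exp (- sqrt N) pays for the hot particle
  and two pay for the power of 1 - \<delta>. The lower bound on \<delta> makes the prefactor
  polynomial; the constants multiply to 1/48, with 1/3 for \<open>exp (- 1)\<close>, and 100 is a
  round number above 48. \<open>N \<ge> 81\<close> yields \<delta> at most 1/9, as
  \<open>cold_energy_markov\<close> requires.\<close>

lemma mass_mixture_ge:
  assumes d: "1 / (real N)\<^sup>2 \<le> \<delta>" "\<delta> \<le> 1 / sqrt N" and N: "N \<ge> 81"
  shows "exp (- 3 * sqrt N) / (100 * real N ^ 4) \<le> radial_density.mass (maxwellian_mixture \<delta>) N"
proof -
  have N0: "0 < real N" "1 \<le> real N" "1 \<le> sqrt N"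
    using N by auto
  have sN: "9 \<le> sqrt N"
    using N real_le_rsqrt[of 9 "real N"] by simp
  then have "1 / sqrt N \<le> 1 / 9"
    using N0 sN by (intro divide_left_mono) auto
  then have d9: "\<delta> \<le> 1 / 9"
    using d by simp
  have d0: "0 < \<delta>"
    using d(1) N0 by (intro less_le_trans[OF _ d(1)]) simp
  have dN: "\<delta> * real N \<le> sqrt N"
  proof -
    have "\<delta> * real N \<le> 1 / sqrt N * real N"
      using d(2) by (intro mult_right_mono) auto
    then show ?thesis
      using N0 by (simp add: real_div_sqrt)
  qed
  have a1: "1 / (real N)\<^sup>2 * (1 / (2 * real N)) \<le> \<delta> * sqrt (\<delta> / pi)"
  proof (rule mult_mono)
    have "1 / (2 * real N) = sqrt ((1 / (2 * real N))\<^sup>2)"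
      by simp
    also have "\<dots> \<le> sqrt (\<delta> / pi)"
    proof (rule real_sqrt_le_mono)
      have "(1 / (2 * real N))\<^sup>2 = (1 / (real N)\<^sup>2) / 4"
        by (simp add: power_divide power_mult_distrib)
      also have "\<dots> \<le> \<delta> / 4"
        using d(1) by simp
      also have "\<dots> \<le> \<delta> / pi"
        using d0 pi_less_4 by (intro divide_left_mono) auto
      finally show "(1 / (2 * real N))\<^sup>2 \<le> \<delta> / pi" .
    qed
    finally show "1 / (2 * real N) \<le> sqrt (\<delta> / pi)" .
  qed (use d d0 in auto)
  have a2: "exp (- sqrt N) \<le> exp (- \<delta> * N)"
    using dN by simp
  have a3: "1 / (2 * real N) \<le> 1 / (2 * sqrt N)"
    using N0 by (intro divide_left_mono) (auto intro!: real_le_lsqrt self_le_power simp flip: of_nat_power)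
  have a4: "exp (- 2 * sqrt N) \<le> (1 - \<delta>) ^ (N - 1)"
  proof -
    have "- 2 * \<delta> \<le> ln (1 - \<delta>)"
    proof -
      have "\<delta> ^ 2 \<le> \<delta> / 9"
        using d0 d9 by (simp add: power2_eq_square)
      then show ?thesis
        using ln_one_minus_pos_lower_bound[of \<delta>] d0 d9 by simp
    qed
    then have "exp (- 2 * \<delta>) \<le> 1 - \<delta>"
      using d9 by (subst (asm) ln_ge_iff) auto
    then have "exp (- 2 * \<delta>) ^ (N - 1) \<le> (1 - \<delta>) ^ (N - 1)"
      by (intro power_mono) auto
    moreover have "exp (- 2 * sqrt N) \<le> exp (- 2 * \<delta>) ^ (N - 1)"
    proof -
      have "\<delta> * real (N - 1) \<le> \<delta> * real N"
        using d0 by (intro mult_left_mono) auto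
      then show ?thesis
        using dN by (simp add: mult.commute flip: exp_of_nat_mult)
    qed
    ultimately show ?thesis by simp
  qed
  have "1 / 3 \<le> exp (- 1 :: real)"
    using exp_le by (simp add: exp_minus field_simps)
  moreover have mono: "x0 * (x1 * x2 * x3 * (x4 * (1 / 4))) \<le> y0 * (y1 * y2 * y3 * (y4 * (1 / 4)))"
    if "x0 \<le> y0" "x1 \<le> y1" "x2 \<le> y2" "x3 \<le> y3" "x4 \<le> y4" "0 \<le> x0" "0 \<le> x1" "0 \<le> x2" "0 \<le> x3" "0 \<le> x4"
    for x0 x1 x2 x3 x4 y0 y1 y2 y3 y4 :: real
    using that by (intro mult_mono mult_nonneg_nonneg) auto
  ultimately have a5: "1 / 3 * ((1 / (real N)\<^sup>2 * (1 / (2 * real N))) * exp (- sqrt N) * (1 / (2 * real N)) * (exp (- 2 * sqrt N) * (1 / 4)))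
    \<le> exp (- 1) * (\<delta> * sqrt (\<delta> / pi) * exp (- \<delta> * N) * (1 / (2 * sqrt N)) * ((1 - \<delta>) ^ (N - 1) * (1 / 4)))"
    by (intro mono a1 a2 a3 a4) auto
  have "exp (- 3 * sqrt N) = exp (- sqrt N) * exp (- 2 * sqrt N)"
    by (simp flip: exp_add)
  then have "1 / 3 * ((1 / (real N)\<^sup>2 * (1 / (2 * real N))) * exp (- sqrt N) * (1 / (2 * real N)) * (exp (- 2 * sqrt N) * (1 / 4)))
      = exp (- 3 * sqrt N) / (48 * real N ^ 4)"
    by (simp add: power_numeral_reduce)
  moreover have "exp (- 3 * sqrt N) / (100 * real N ^ 4) \<le> exp (- 3 * sqrt N) / (48 * real N ^ 4)"
    using N0 by (intro divide_left_mono) auto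
  moreover have "exp (- 1) * (\<delta> * sqrt (\<delta> / pi) * exp (- \<delta> * N) * (1 / (2 * sqrt N)) * ((1 - \<delta>) ^ (N - 1) * (1 / 4)))
    \<le> radial_density.mass (maxwellian_mixture \<delta>) N"
  proof -
    interpret radial_density "maxwellian_mixture \<delta>"
      using d0 d9 by (intro radial_density_mixture) auto
    have "exp (- 1) * (\<delta> * sqrt (\<delta> / pi) * exp (- \<delta> * N) * (1 / (2 * sqrt N)) * ((1 - \<delta>) ^ (N - 1) * (1 / 4)))
      \<le> exp (- 1) * measure (law {..<N}) (kac_shell N)"
      using measure_shell_mixture_ge[of \<delta> N] d0 d9 N by (intro mult_left_mono) auto
    also have "\<dots> \<le> mass N"
      using N by (intro mass_ge) auto
    finally show ?thesis .
  qed
  ultimately show ?thesis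
    using a5 by linarith
qed

section \<open>Limits of reweighted means under the mixture\<close>

context radial_density
begin

text \<open>By \<open>conditioned_integral\<close>, the expectation of \<open>h\<close> under the
  density on the sphere is the weighted mean of \<open>h\<close> composed with
  \<open>radial_projection N\<close>. Without the projection it is the mean to which block
  concentration applies.\<close>

definition weighted_mean :: "nat \<Rightarrow> ((nat \<Rightarrow> real) \<Rightarrow> real) \<Rightarrow> real" where
  "weighted_mean N h = (\<integral>v. weight N v * h v \<partial>law {..<N}) / mass N"

lemma weighted_mean_diff_le:
  assumes N: "N \<ge> 1" and [measurable]: "h \<in> borel_measurable (\<Pi>\<^sub>M i\<in>{..<N}. borel)"
      "h' \<in> borel_measurable (\<Pi>\<^sub>M i\<in>{..<N}. borel)" "g \<in> borel_measurable (\<Pi>\<^sub>M i\<in>{..<N}. borel)"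
    and C: "\<And>v. v \<in> kac_shell N \<Longrightarrow> \<bar>h v\<bar> \<le> C" "\<And>v. v \<in> kac_shell N \<Longrightarrow> \<bar>h' v\<bar> \<le> C"
      "\<And>v. v \<in> kac_shell N \<Longrightarrow> \<bar>g v\<bar> \<le> C"
    and le: "\<And>v. v \<in> kac_shell N \<Longrightarrow> \<bar>h v - h' v\<bar> \<le> g v"
  shows "\<bar>weighted_mean N h - weighted_mean N h'\<bar> \<le> weighted_mean N g"
proof -
  have int: "integrable (law {..<N}) (\<lambda>v. weight N v * h v)" "integrable (law {..<N}) (\<lambda>v. weight N v * h' v)"
      "integrable (law {..<N}) (\<lambda>v. weight N v * g v)"
    using C by (auto intro!: integrable_weight_bounded[OF N])
  have "\<bar>\<integral>v. weight N v * h v - weight N v * h' v \<partial>law {..<N}\<bar>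
      \<le> (\<integral>v. \<bar>weight N v * h v - weight N v * h' v\<bar> \<partial>law {..<N})"
    by (rule integral_abs_bound)
  also have "\<dots> \<le> (\<integral>v. weight N v * g v \<partial>law {..<N})"
  proof (rule integral_mono)
    fix v
    show "\<bar>weight N v * h v - weight N v * h' v\<bar> \<le> weight N v * g v"
    proof (cases "v \<in> kac_shell N")
      case True
      have "\<bar>weight N v * h v - weight N v * h' v\<bar> = weight N v * \<bar>h v - h' v\<bar>"
        using weight_nonneg[of N v] by (simp add: abs_mult flip: right_diff_distrib)
      then show ?thesis
        using le[OF True] weight_nonneg[of N v] by (simp add: mult_left_mono)
    qed (simp add: weight_def)
  qed (use int in auto)
  finally have "\<bar>(\<integral>v. weight N v * h v \<partial>law {..<N}) - (\<integral>v. weight N v * h' v \<partial>law {..<N})\<bar>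
      \<le> (\<integral>v. weight N v * g v \<partial>law {..<N})"
    using int by simp
  then have "\<bar>((\<integral>v. weight N v * h v \<partial>law {..<N}) - (\<integral>v. weight N v * h' v \<partial>law {..<N})) / mass N\<bar>
      \<le> (\<integral>v. weight N v * g v \<partial>law {..<N}) / mass N"
    using mass_nonneg[of N] by (simp add: abs_divide divide_right_mono)
  then show ?thesis
    by (simp add: weighted_mean_def diff_divide_distrib)
qed

lemma weighted_mean_block:
  fixes g :: "(nat \<Rightarrow> real) \<Rightarrow> real"
  assumes "N \<ge> 1" "n \<ge> 1" "n * k \<le> N" "g \<in> borel_measurable (\<Pi>\<^sub>M i\<in>{..<k}. borel)"
    "\<And>v. 0 \<le> g v" "\<And>v. g v \<le> C" "0 < C" "0 < \<epsilon>" and m: "0 < b" "b \<le> mass N"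
  shows "\<bar>weighted_mean N (\<lambda>v. g (restrict v {..<k})) - (\<integral>v. g v \<partial>law {..<k})\<bar>
    \<le> \<epsilon> + C * (2 * exp (- 2 * real n * \<epsilon>\<^sup>2 / C\<^sup>2)) / b"
proof -
  let ?I = "\<integral>v. weight N v * g (restrict v {..<k}) \<partial>law {..<N}" and ?m = "\<integral>v. g v \<partial>law {..<k}"
  let ?e = "C * (2 * exp (- 2 * real n * \<epsilon>\<^sup>2 / C\<^sup>2))"
  have M: "0 < mass N"
    using m by simp
  have "\<bar>weighted_mean N (\<lambda>v. g (restrict v {..<k})) - ?m\<bar> = \<bar>?I - ?m * mass N\<bar> / mass N"
    using M by (simp add: weighted_mean_def field_simps)
  also have "\<dots> \<le> (\<epsilon> * mass N + ?e) / mass N"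
    using weighted_block_mean[OF assms(1-8)] M by (intro divide_right_mono) auto
  also have "\<dots> = \<epsilon> + ?e / mass N"
    using M by (simp add: field_simps)
  also have "?e / mass N \<le> ?e / b"
    using m M \<open>0 < C\<close> by (intro divide_left_mono) auto
  finally show ?thesis by simp
qed

lemma integral_law:
  assumes "finite I" and [measurable]: "h \<in> borel_measurable (\<Pi>\<^sub>M i\<in>I. borel)"
  shows "(\<integral>v. h v \<partial>law I) = (\<integral>v. (\<Prod>i\<in>I. f (v i)) * h v \<partial>(\<Pi>\<^sub>M i\<in>I. lborel))"
    and "integrable (law I) h \<longleftrightarrow> integrable (\<Pi>\<^sub>M i\<in>I. lborel) (\<lambda>v. (\<Prod>i\<in>I. f (v i)) * h v)"
proof -
  have [measurable]: "h \<in> borel_measurable (\<Pi>\<^sub>M i\<in>I. lborel)"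
    using assms(2) sets_lborel_pow measurable_cong_sets by blast
  have "AE v in (\<Pi>\<^sub>M i\<in>I. lborel). 0 \<le> (\<Prod>i\<in>I. f (v i))"
    using pos by (intro AE_I2 prod_nonneg) (auto intro: less_imp_le)
  then show "(\<integral>v. h v \<partial>law I) = (\<integral>v. (\<Prod>i\<in>I. f (v i)) * h v \<partial>(\<Pi>\<^sub>M i\<in>I. lborel))"
    "integrable (law I) h \<longleftrightarrow> integrable (\<Pi>\<^sub>M i\<in>I. lborel) (\<lambda>v. (\<Prod>i\<in>I. f (v i)) * h v)"
    unfolding law_eq_density[OF assms(1)] by (simp_all add: integral_density integrable_density)
qed

end

lemma law_scaled_mono:
  fixes h :: "(nat \<Rightarrow> real) \<Rightarrow> real"
  assumes f: "radial_density f" and g: "radial_density g" and q: "0 \<le> q" "\<And>x. q * g x \<le> f x"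
    and [measurable]: "h \<in> borel_measurable (\<Pi>\<^sub>M i\<in>{..<k}. borel)"
    and h: "\<And>v. 0 \<le> h v" "\<And>v. h v \<le> C"
  shows "q ^ k * (\<integral>v. h v \<partial>radial_density.law g {..<k}) \<le> (\<integral>v. h v \<partial>radial_density.law f {..<k})"
proof -
  interpret f: radial_density f by (rule f)
  interpret g: radial_density g by (rule g)
  interpret P: prob_space "f.law {..<k}" by (rule f.prob_space_law)
  interpret Q: prob_space "g.law {..<k}" by (rule g.prob_space_law)
  have "integrable (f.law {..<k}) h" "integrable (g.law {..<k}) h"
    using h by (auto intro!: P.integrable_const_bound[where B = C] Q.integrable_const_bound[where B = C])
  then have int: "integrable (lborel_pow k) (\<lambda>v. (\<Prod>i<k. f (v i)) * h v)"
      "integrable (lborel_pow k) (\<lambda>v. (\<Prod>i<k. g (v i)) * h v)"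
    by (simp_all add: f.integral_law(2) g.integral_law(2))
  have "q ^ k * (\<integral>v. h v \<partial>g.law {..<k}) = (\<integral>v. q ^ k * ((\<Prod>i<k. g (v i)) * h v) \<partial>lborel_pow k)"
    by (simp add: g.integral_law(1))
  also have "\<dots> \<le> (\<integral>v. (\<Prod>i<k. f (v i)) * h v \<partial>lborel_pow k)"
  proof (rule integral_mono)
    fix v :: "nat \<Rightarrow> real"
    have "q ^ k * (\<Prod>i<k. g (v i)) = (\<Prod>i<k. q * g (v i))"
      by (simp add: prod.distrib)
    also have "\<dots> \<le> (\<Prod>i<k. f (v i))"
      using q g.pos by (intro prod_mono) (auto simp: less_imp_le)
    finally have "q ^ k * (\<Prod>i<k. g (v i)) * h v \<le> (\<Prod>i<k. f (v i)) * h v"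
      using h(1) by (rule mult_right_mono)
    then show "q ^ k * ((\<Prod>i<k. g (v i)) * h v) \<le> (\<Prod>i<k. f (v i)) * h v"
      by (simp add: mult.assoc)
  qed (use int in auto)
  also have "\<dots> = (\<integral>v. h v \<partial>f.law {..<k})"
    by (simp add: f.integral_law(1))
  finally show ?thesis .
qed

lemma radial_density_half: "radial_density (maxwellian (1 / 2))"
  using radial_density_maxwellian[of 1] by simp

text \<open>The cold component dominates \<open>q\<close> times the limit: 1 - \<delta> is its
  share, the root comes from its normalisation, and its tail is heavier. Domination is one-sided,
  but the masses agree, so applying it to \<open>h\<close> and to \<open>C - h\<close> bounds the
  difference from both sides.\<close>

lemma mixture_law_near_maxwellian:
  fixes h :: "(nat \<Rightarrow> real) \<Rightarrow> real"
  assumes d: "0 < \<delta>" "\<delta> < 1" and [measurable]: "h \<in> borel_measurable (\<Pi>\<^sub>M i\<in>{..<k}. borel)"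
    and h: "\<And>v. 0 \<le> h v" "\<And>v. h v \<le> C"
  defines "q \<equiv> (1 - \<delta>) * sqrt (1 - \<delta>)"
  shows "\<bar>(\<integral>v. h v \<partial>radial_density.law (maxwellian_mixture \<delta>) {..<k})
      - (\<integral>v. h v \<partial>radial_density.law (maxwellian (1 / 2)) {..<k})\<bar> \<le> C * (1 - q ^ k)"
proof -
  interpret f: radial_density "maxwellian_mixture \<delta>"
    using d by (rule radial_density_mixture)
  interpret g: radial_density "maxwellian (1 / 2)"
    by (rule radial_density_half)
  interpret P: prob_space "f.law {..<k}" by (rule f.prob_space_law)
  interpret Q: prob_space "g.law {..<k}" by (rule g.prob_space_law)
  have int: "integrable (f.law {..<k}) h" "integrable (g.law {..<k}) h"
    using h by (auto intro!: P.integrable_const_bound[where B = C] Q.integrable_const_bound[where B = C])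
  have q: "0 \<le> q"
    using d by (simp add: q_def)
  have "q \<le> 1 * 1"
    unfolding q_def using d by (intro mult_mono) auto
  then have q1: "q ^ k \<le> 1" "0 \<le> q ^ k"
    using q by (auto intro: power_le_one)
  have le: "q * maxwellian (1 / 2) x \<le> maxwellian_mixture \<delta> x" for x
  proof -
    have "maxwellian (1 / 2) x = sqrt (1 / pi) * exp (- x\<^sup>2)"
      using maxwellian_inverse[of 1 x] by simp
    then have "q * maxwellian (1 / 2) x = (1 - \<delta>) * (sqrt ((1 - \<delta>) / pi) * exp (- x\<^sup>2))"
      using d by (simp add: q_def real_sqrt_divide)
    also have "\<dots> \<le> (1 - \<delta>) * (sqrt ((1 - \<delta>) / pi) * exp (- (1 - \<delta>) * x\<^sup>2))"
      using d by (intro mult_left_mono) (auto simp: algebra_simps)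
    also have "\<dots> \<le> maxwellian_mixture \<delta> x"
      using d by (subst maxwellian_mixture_eq) auto
    finally show ?thesis .
  qed
  let ?F = "\<integral>v. h v \<partial>f.law {..<k}" and ?G = "\<integral>v. h v \<partial>g.law {..<k}"
  have "q ^ k * ?G \<le> ?F"
    using h by (intro law_scaled_mono[OF f.radial_density_axioms g.radial_density_axioms q le, where C = C]) auto
  moreover have "q ^ k * (C - ?G) \<le> C - ?F"
  proof -
    have "q ^ k * (\<integral>v. C - h v \<partial>g.law {..<k}) \<le> (\<integral>v. C - h v \<partial>f.law {..<k})"
      using h by (intro law_scaled_mono[OF f.radial_density_axioms g.radial_density_axioms q le, where C = C]) auto
    then show ?thesis
      using int P.prob_space Q.prob_space by simp
  qed
  moreover have "0 \<le> (1 - q ^ k) * ?G" "0 \<le> (1 - q ^ k) * (C - ?G)"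
    using q1 h int Q.integral_le_const[of h C] by (auto intro!: mult_nonneg_nonneg)
  ultimately show ?thesis
    by (simp add: abs_le_iff algebra_simps)
qed

text \<open>The Hoeffding error for \<open>N div Suc k\<close> blocks against the mass bound of
  \<open>mass_mixture_ge\<close>: a rate linear in \<open>N\<close> beats 3 sqrt N. Dividing by
  \<open>Suc k\<close> instead of \<open>k\<close> gives a number of blocks that also tends to
  infinity for \<open>k = 0\<close>.\<close>

lemma concentration_error_tendsto_0:
  assumes "0 < c"
  shows "(\<lambda>N. exp (- c * real (N div Suc k)) / (exp (- 3 * sqrt N) / (100 * real N ^ 4))) \<longlonglongrightarrow> 0"
proof (rule Lim_null_comparison)
  let ?c = "c / real (Suc k)"
  have c: "0 < ?c"
    using assms by simp
  show "\<forall>\<^sub>F N in sequentially. norm (exp (- c * real (N div Suc k)) / (exp (- 3 * sqrt N) / (100 * real N ^ 4)))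
    \<le> exp c * exp (- ?c * real N) / (exp (- 3 * sqrt N) / (100 * real N ^ 4))"
  proof (rule always_eventually, rule allI)
    fix N :: nat
    have "real N / real (Suc k) - 1 \<le> real (N div Suc k)"
    proof -
      have "real (N div Suc k) = of_int \<lfloor>real N / real (Suc k)\<rfloor>"
        by (simp only: floor_divide_of_nat_eq of_int_of_nat_eq)
      then show ?thesis by linarith
    qed
    then have "c * (real N / real (Suc k) - 1) \<le> c * real (N div Suc k)"
      using assms by (intro mult_left_mono) auto
    then have "exp (- c * real (N div Suc k)) \<le> exp (c - ?c * real N)"
      by (simp add: algebra_simps)
    also have "\<dots> = exp c * exp (- ?c * real N)"
      by (simp flip: exp_add)
    finally have "exp (- c * real (N div Suc k)) / (exp (- 3 * sqrt N) / (100 * real N ^ 4))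
      \<le> exp c * exp (- ?c * real N) / (exp (- 3 * sqrt N) / (100 * real N ^ 4))"
      by (intro divide_right_mono) auto
    moreover have "norm (exp (- c * real (N div Suc k)) / (exp (- 3 * sqrt N) / (100 * real N ^ 4)))
      = exp (- c * real (N div Suc k)) / (exp (- 3 * sqrt N) / (100 * real N ^ 4))"
      by simp
    ultimately show "norm (exp (- c * real (N div Suc k)) / (exp (- 3 * sqrt N) / (100 * real N ^ 4)))
      \<le> exp c * exp (- ?c * real N) / (exp (- 3 * sqrt N) / (100 * real N ^ 4))"
      by (simp only:)
  qed
  have "(\<lambda>N. K * exp (- b * real N) / (exp (- 3 * sqrt N) / (100 * real N ^ 4))) \<longlonglongrightarrow> 0" if "0 < b" for K b :: real
    using that by real_asymp
  then show "(\<lambda>N. exp c * exp (- ?c * real N) / (exp (- 3 * sqrt N) / (100 * real N ^ 4))) \<longlonglongrightarrow> 0"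
    using c by blast
qed

text \<open>The upper bound keeps the cost of the shell at exp (- O(sqrt N)); the lower bound keeps
  prefactors polynomial and - ln \<delta> of order ln N.\<close>

definition admissible :: "(nat \<Rightarrow> real) \<Rightarrow> bool" where
  "admissible \<delta> \<longleftrightarrow> (\<forall>\<^sub>F N in sequentially. 1 / (real N)\<^sup>2 \<le> \<delta> N \<and> \<delta> N \<le> 1 / sqrt (real N))"

lemma admissible_tendsto_0:
  assumes "admissible \<delta>"
  shows "\<delta> \<longlonglongrightarrow> 0"
proof (rule tendsto_sandwich)
  show "\<forall>\<^sub>F N in sequentially. 0 \<le> \<delta> N"
    using assms unfolding admissible_def by eventually_elim (metis order_trans zero_le_divide_1_iff zero_le_power2)
  show "\<forall>\<^sub>F N in sequentially. \<delta> N \<le> 1 / sqrt (real N)"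
    using assms unfolding admissible_def by eventually_elim simp
  show "(\<lambda>N. 1 / sqrt (real N)) \<longlonglongrightarrow> 0"
    by real_asymp
qed simp

lemma admissible_eventually:
  assumes "admissible \<delta>"
  shows "\<forall>\<^sub>F N in sequentially. 0 < \<delta> N \<and> \<delta> N < 1 / 9 \<and> 1 / (real N)\<^sup>2 \<le> \<delta> N
    \<and> exp (- 3 * sqrt N) / (100 * real N ^ 4) \<le> radial_density.mass (maxwellian_mixture (\<delta> N)) N"
proof -
  have "\<forall>\<^sub>F N in sequentially. \<delta> N < 1 / 9"
    using admissible_tendsto_0[OF assms] by (rule order_tendstoD) simp
  then show ?thesis
    using assms[unfolded admissible_def] eventually_ge_at_top[of "81::nat"]
  proof eventually_elim
    case (elim N)
    then have "0 < 1 / (real N)\<^sup>2"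
      by simp
    then have "0 < \<delta> N"
      using elim(2) by (meson less_le_trans)
    then show ?case
      using elim mass_mixture_ge[of N "\<delta> N"] by simp
  qed
qed

lemma weighted_mean_tendsto:
  fixes g :: "(nat \<Rightarrow> real) \<Rightarrow> real"
  assumes \<delta>: "admissible \<delta>" and g[measurable]: "g \<in> borel_measurable (\<Pi>\<^sub>M i\<in>{..<k}. borel)"
    and bd: "\<And>v. 0 \<le> g v" "\<And>v. g v \<le> C"
  shows "(\<lambda>N. radial_density.weighted_mean (maxwellian_mixture (\<delta> N)) N (\<lambda>v. g (restrict v {..<k})))
    \<longlonglongrightarrow> (\<integral>v. g v \<partial>radial_density.law (maxwellian (1 / 2)) {..<k})"
    (is "?A \<longlonglongrightarrow> ?m")
proof (rule LIMSEQ_I)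
  fix r :: real assume r: "0 < r"
  \<comment> \<open>\<open>C\<close> may be 0, whereas the Hoeffding exponent divides by the square
    of the bound. \<open>c\<close> below is this exponent per block at accuracy
    \<open>r / 2\<close>.\<close>
  define D where "D = C + 1"
  define q where "q N = (1 - \<delta> N) * sqrt (1 - \<delta> N)" for N
  define c where "c = 2 * (r / 2)\<^sup>2 / D\<^sup>2"
  let ?b = "\<lambda>N. exp (- 3 * sqrt N) / (100 * real N ^ 4)"
  let ?e = "\<lambda>N. D * 2 * (exp (- c * real (N div Suc k)) / ?b N)"
  have "0 \<le> C"
    using bd[of undefined] by linarith
  then have D: "0 < D" "\<And>v. g v \<le> D"
    using bd(2) by (auto simp: D_def add_increasing2)
  have "?e \<longlonglongrightarrow> D * 2 * 0"
    using r D by (intro tendsto_mult_left concentration_error_tendsto_0) (simp add: c_def)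
  moreover have "(\<lambda>N. C * (1 - q N ^ k)) \<longlonglongrightarrow> C * (1 - ((1 - 0) * sqrt (1 - 0)) ^ k)"
    unfolding q_def by (intro tendsto_intros admissible_tendsto_0 \<delta>)
  ultimately have "(\<lambda>N. r / 2 + ?e N + C * (1 - q N ^ k)) \<longlonglongrightarrow> r / 2 + D * 2 * 0 + C * (1 - ((1 - 0) * sqrt (1 - 0)) ^ k)"
    by (intro tendsto_add tendsto_const)
  then have "\<forall>\<^sub>F N in sequentially. r / 2 + ?e N + C * (1 - q N ^ k) < r"
    by (rule order_tendstoD(2)) (use r in simp)
  then have "\<forall>\<^sub>F N in sequentially. norm (?A N - ?m) < r"
    using admissible_eventually[OF \<delta>] eventually_ge_at_top[of "Suc k"]
  proof eventually_elim
    case (elim N)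
    then have d: "0 < \<delta> N" "\<delta> N < 1"
      and m: "?b N \<le> radial_density.mass (maxwellian_mixture (\<delta> N)) N"
      by auto
    interpret f: radial_density "maxwellian_mixture (\<delta> N)"
      using d by (rule radial_density_mixture)
    have n: "1 \<le> N div Suc k" "N div Suc k * k \<le> N" "1 \<le> N"
    proof -
      show "1 \<le> N div Suc k"
        using elim(3) div_le_mono[of "Suc k" N "Suc k"] by simp
      have "N div Suc k * k \<le> N div Suc k * Suc k"
        by simp
      also have "\<dots> \<le> N"
        by (rule div_times_less_eq_dividend)
      finally show "N div Suc k * k \<le> N" .
    qed (use elim in simp)
    have "\<bar>?A N - (\<integral>v. g v \<partial>f.law {..<k})\<bar>
        \<le> r / 2 + D * (2 * exp (- 2 * real (N div Suc k) * (r / 2)\<^sup>2 / D\<^sup>2)) / ?b N"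
      using r m n(3) by (intro f.weighted_mean_block[OF n(3,1,2) g bd(1) D(2,1)]) auto
    also have "\<dots> = r / 2 + ?e N"
      by (simp add: c_def algebra_simps)
    finally have "\<bar>?A N - (\<integral>v. g v \<partial>f.law {..<k})\<bar> \<le> r / 2 + ?e N" .
    moreover have "\<bar>(\<integral>v. g v \<partial>f.law {..<k}) - ?m\<bar> \<le> C * (1 - q N ^ k)"
      unfolding q_def by (rule mixture_law_near_maxwellian[OF d g bd])
    ultimately show ?case
      using elim(1) by simp
  qed
  then show "\<exists>N0. \<forall>N\<ge>N0. norm (?A N - ?m) < r"
    by (simp add: eventually_sequentially)
qed

section \<open>Chaoticity\<close>

text \<open>Over the full index type the product sigma-algebra is the Borel algebra of the product
  topology. So \<phi> is first composed with restriction, where continuity gives measurability, and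
  then with extension by 0 to return to \<open>k\<close> coordinates.\<close>

lemma continuous_map_measurable_PiM:
  fixes \<phi> :: "(nat \<Rightarrow> real) \<Rightarrow> real"
  assumes "continuous_map (powertop_real {..<k}) euclideanreal \<phi>"
  shows "\<phi> \<in> borel_measurable (\<Pi>\<^sub>M i\<in>{..<k}. borel)"
proof -
  have "continuous_map (powertop_real UNIV) (powertop_real {..<k}) (\<lambda>v. restrict v {..<k})"
    by (auto simp: continuous_map_componentwise intro!: continuous_map_product_projection)
  then have "continuous_map (powertop_real UNIV) euclideanreal (\<phi> \<circ> (\<lambda>v. restrict v {..<k}))"
    by (rule continuous_map_compose) (rule assms)
  then have "continuous_on UNIV (\<lambda>v. \<phi> (restrict v {..<k}))"
    by (simp add: euclidean_product_topology o_def)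
  then have "(\<lambda>v. \<phi> (restrict v {..<k})) \<in> borel_measurable borel"
    by (rule borel_measurable_continuous_onI)
  then have m: "(\<lambda>v. \<phi> (restrict v {..<k})) \<in> borel_measurable (\<Pi>\<^sub>M i\<in>UNIV. borel)"
    using sets_PiM_equal_borel measurable_cong_sets by blast
  have "(\<lambda>v. \<lambda>i. if i < k then v i else 0) \<in> (\<Pi>\<^sub>M i\<in>{..<k}. borel) \<rightarrow>\<^sub>M (\<Pi>\<^sub>M i\<in>(UNIV::nat set). (borel :: real measure))"
  proof (rule measurable_PiM_single')
    fix i :: nat
    show "(\<lambda>v. if i < k then v i else 0) \<in> borel_measurable (\<Pi>\<^sub>M i\<in>{..<k}. borel)"
      by (cases "i < k") (auto intro: measurable_component_singleton)
  qed auto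
  from measurable_compose[OF this m]
  have "(\<lambda>v. \<phi> (\<lambda>i\<in>{..<k}. if i < k then v i else 0)) \<in> borel_measurable (\<Pi>\<^sub>M i\<in>{..<k}. borel)" .
  moreover have "\<phi> (\<lambda>i\<in>{..<k}. if i < k then v i else 0) = \<phi> v" if "v \<in> space (\<Pi>\<^sub>M i\<in>{..<k}. borel)" for v
  proof -
    have "(\<lambda>i\<in>{..<k}. if i < k then v i else 0) = v"
      using that by (force simp: space_PiM PiE_iff extensional_def fun_eq_iff)
    then show ?thesis by simp
  qed
  ultimately show ?thesis
    by (simp cong: measurable_cong)
qed

text \<open>On the first \<open>k\<close> coordinates the radial projection is a dilation, but its
  factor depends on all \<open>N\<close> coordinates. Its effect on \<phi> is therefore bounded by a
  supremum over factors, which is again a function of \<open>k\<close> coordinates.\<close>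

definition dilate :: "nat \<Rightarrow> real \<Rightarrow> (nat \<Rightarrow> real) \<Rightarrow> nat \<Rightarrow> real" where
  "dilate k c v = (\<lambda>i\<in>{..<k}. c * v i)"

lemma dilate_1: "v \<in> {..<k} \<rightarrow>\<^sub>E UNIV \<Longrightarrow> dilate k 1 v = v"
  by (auto simp: dilate_def PiE_iff extensional_def fun_eq_iff)

lemma dilate_measurable [measurable]: "dilate k c \<in> (\<Pi>\<^sub>M i\<in>{..<k}. borel) \<rightarrow>\<^sub>M (\<Pi>\<^sub>M i\<in>{..<k}. borel)"
  unfolding dilate_def by measurable

lemma continuous_dilate:
  assumes "continuous_map (powertop_real {..<k}) euclideanreal \<phi>"
  shows "continuous_on UNIV (\<lambda>c. \<phi> (dilate k c v))"
proof -
  have "continuous_map euclideanreal (powertop_real {..<k}) (\<lambda>c. dilate k c v)"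
    by (auto simp: continuous_map_componentwise dilate_def intro!: continuous_intros)
  then have "continuous_map euclideanreal euclideanreal (\<phi> \<circ> (\<lambda>c. dilate k c v))"
    by (rule continuous_map_compose) (rule assms)
  then show ?thesis
    by (simp add: o_def)
qed

text \<open>The supremum runs over rational factors only, which makes it measurable.\<close>

definition dilation_oscillation :: "nat \<Rightarrow> ((nat \<Rightarrow> real) \<Rightarrow> real) \<Rightarrow> nat \<Rightarrow> (nat \<Rightarrow> real) \<Rightarrow> real" where
  "dilation_oscillation k \<phi> m v =
     (SUP c\<in>{1..<1 + 1 / real (Suc m)} \<inter> \<rat>. \<bar>\<phi> (dilate k c v) - \<phi> (dilate k 1 v)\<bar>)"

context
  fixes k :: nat and \<phi> :: "(nat \<Rightarrow> real) \<Rightarrow> real" and C :: real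
  assumes cont: "continuous_map (powertop_real {..<k}) euclideanreal \<phi>"
    and bound: "\<And>v. v \<in> {..<k} \<rightarrow>\<^sub>E UNIV \<Longrightarrow> \<bar>\<phi> v\<bar> \<le> C"
begin

lemma dilation_difference_le: "\<bar>\<phi> (dilate k c v) - \<phi> (dilate k 1 v)\<bar> \<le> 2 * C"
proof -
  have "dilate k c v \<in> {..<k} \<rightarrow>\<^sub>E UNIV" for c
    by (auto simp: dilate_def)
  then show ?thesis
    using bound[of "dilate k c v"] bound[of "dilate k 1 v"] by (simp add: abs_le_iff)
qed

lemma dilation_bdd_above:
  "bdd_above ((\<lambda>c. \<bar>\<phi> (dilate k c v) - \<phi> (dilate k 1 v)\<bar>) ` S)"
  using dilation_difference_le by (auto intro!: bdd_aboveI)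

lemma one_in_dilation_factors: "1 \<in> {1..<1 + 1 / real (Suc m)} \<inter> \<rat>"
  by auto

lemma dilation_oscillation_bounds:
  "0 \<le> dilation_oscillation k \<phi> m v" "dilation_oscillation k \<phi> m v \<le> 2 * C"
proof -
  show "0 \<le> dilation_oscillation k \<phi> m v"
    unfolding dilation_oscillation_def
    by (rule cSUP_upper2[OF dilation_bdd_above one_in_dilation_factors]) simp
  show "dilation_oscillation k \<phi> m v \<le> 2 * C"
    unfolding dilation_oscillation_def
    using one_in_dilation_factors by (intro cSUP_least dilation_difference_le) blast
qed

lemma dilation_oscillation_measurable:
  "dilation_oscillation k \<phi> m \<in> borel_measurable (\<Pi>\<^sub>M i\<in>{..<k}. borel)"
proof -
  note [measurable] = continuous_map_measurable_PiM[OF cont]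
  show ?thesis
    unfolding dilation_oscillation_def[abs_def]
    by (intro borel_measurable_cSUP dilation_bdd_above countable_Int2 countable_rat) measurable
qed

text \<open>A real factor is a limit of rational ones taken slightly above it, where the half-open
  interval leaves room; continuity along dilations carries the bound over.\<close>

lemma dilation_difference_le_oscillation:
  assumes c: "1 \<le> c" "c < 1 + 1 / real (Suc m)"
  shows "\<bar>\<phi> (dilate k c v) - \<phi> (dilate k 1 v)\<bar> \<le> dilation_oscillation k \<phi> m v"
proof -
  let ?S = "{1..<1 + 1 / real (Suc m)} \<inter> \<rat>"
  have mem: "c \<in> closure ?S"
    unfolding closure_approachable
  proof (intro allI impI)
    fix e :: real assume "0 < e"
    then obtain r where "r \<in> \<rat>" "c < r" "r < min (c + e) (1 + 1 / real (Suc m))"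
      using Rats_dense_in_real[of c "min (c + e) (1 + 1 / real (Suc m))"] c by auto
    then show "\<exists>y\<in>?S. dist y c < e"
      using c by (intro bexI[of _ r]) (auto simp: dist_real_def)
  qed
  have "continuous_on (closure ?S) (\<lambda>c. \<bar>\<phi> (dilate k c v) - \<phi> (dilate k 1 v)\<bar>)"
    using continuous_dilate[OF cont, of v] by (intro continuous_intros) (rule continuous_on_subset, auto)
  then show ?thesis
  proof (rule continuous_le_on_closure[OF _ mem])
    fix r assume "r \<in> ?S"
    then show "\<bar>\<phi> (dilate k r v) - \<phi> (dilate k 1 v)\<bar> \<le> dilation_oscillation k \<phi> m v"
      unfolding dilation_oscillation_def by (intro cSUP_upper dilation_bdd_above)
  qed
qed

text \<open>The convergence is pointwise in \<open>v\<close>, since \<phi> is only bounded and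
  continuous. Dominated convergence under the fixed limit law then makes the mean oscillation
  small.\<close>

lemma dilation_oscillation_tendsto_0: "(\<lambda>m. dilation_oscillation k \<phi> m v) \<longlonglongrightarrow> 0"
proof (rule LIMSEQ_I)
  fix r :: real assume r: "0 < r"
  have "isCont (\<lambda>c. \<phi> (dilate k c v)) 1"
    using continuous_dilate[OF cont, of v] by (simp add: continuous_on_eq_continuous_at)
  then obtain d where d: "0 < d" "\<And>c. \<bar>c - 1\<bar> < d \<Longrightarrow> \<bar>\<phi> (dilate k c v) - \<phi> (dilate k 1 v)\<bar> < r / 2"
    unfolding continuous_at_eps_delta using r by (metis dist_real_def half_gt_zero)
  obtain m0 where m0: "1 / real (Suc m0) < d"
    using d(1) nat_approx_posE by blast
  have "norm (dilation_oscillation k \<phi> m v - 0) < r" if "m \<ge> m0" for m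
  proof -
    have "1 / real (Suc m) \<le> 1 / real (Suc m0)"
      using that by (intro divide_left_mono) auto
    then have "dilation_oscillation k \<phi> m v \<le> r / 2"
      unfolding dilation_oscillation_def using one_in_dilation_factors m0
      by (intro cSUP_least less_imp_le d(2)) (blast, auto)
    then show ?thesis
      using dilation_oscillation_bounds(1)[of m v] r by simp
  qed
  then show "\<exists>N0. \<forall>m\<ge>N0. norm (dilation_oscillation k \<phi> m v - 0) < r"
    by blast
qed

end

lemma restrict_radial_projection:
  assumes N: "N \<ge> 2" "k \<le> N" "real N / (real N - 1) < (1 + 1 / real (Suc m))\<^sup>2" and v: "v \<in> kac_shell N"
  obtains c where "1 \<le> c" "c < 1 + 1 / real (Suc m)"
    "restrict (radial_projection N v) {..<k} = dilate k c (restrict v {..<k})"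
proof -
  let ?s = "\<Sum>i<N. (v i)\<^sup>2"
  have s: "real N - 1 < ?s" "?s \<le> real N" "0 < ?s"
    using v N by (auto simp: kac_shell_def)
  let ?c = "sqrt (real N) / sqrt ?s"
  have "?c\<^sup>2 = real N / ?s"
    using s by (simp add: power_divide)
  also have "\<dots> < real N / (real N - 1)"
    using s N by (intro divide_strict_left_mono) auto
  also note N(3)
  finally have "?c\<^sup>2 < (1 + 1 / real (Suc m))\<^sup>2" .
  then have "?c < 1 + 1 / real (Suc m)"
    by (rule power_less_imp_less_base) simp
  moreover have "1 \<le> ?c"
    using s by simp
  moreover have "restrict (radial_projection N v) {..<k} = dilate k ?c (restrict v {..<k})"
    using N(2) by (auto simp: radial_projection_def dilate_def fun_eq_iff)
  ultimately show ?thesis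
    using that by blast
qed

lemma restrict_measurable [measurable]:
  "k \<le> N \<Longrightarrow> (\<lambda>v. restrict v {..<k}) \<in> (\<Pi>\<^sub>M i\<in>{..<N}. borel) \<rightarrow>\<^sub>M (\<Pi>\<^sub>M i\<in>{..<(k::nat)}. borel)"
  by (intro measurable_restrict_subset) auto

text \<open>Omitting the projection inside \<phi> costs at most the weighted mean of the
  oscillation. For fixed \<open>m\<close> this mean converges to the mean under the limit law, so
  \<open>m\<close> is chosen first, with that mean below \<open>r / 2\<close>, and \<open>N\<close>
  afterwards.\<close>

lemma mixture_marginals_tendsto:
  fixes \<phi> :: "(nat \<Rightarrow> real) \<Rightarrow> real"
  assumes \<delta>: "admissible \<delta>" and cont: "continuous_map (powertop_real {..<k}) euclideanreal \<phi>"
    and bound: "\<And>v. v \<in> {..<k} \<rightarrow>\<^sub>E UNIV \<Longrightarrow> \<bar>\<phi> v\<bar> \<le> C"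
  shows "(\<lambda>N. \<integral>v. conditioned_tensor N (maxwellian_mixture (\<delta> N)) v * \<phi> (restrict v {..<k}) \<partial>kac_measure N)
    \<longlonglongrightarrow> (\<integral>v. \<phi> v \<partial>radial_density.law (maxwellian (1 / 2)) {..<k})"
    (is "?A \<longlonglongrightarrow> ?m")
proof -
  interpret M: radial_density "maxwellian (1 / 2)"
    by (rule radial_density_half)
  interpret Q: prob_space "M.law {..<k}" by (rule M.prob_space_law)
  note \<phi>[measurable] = continuous_map_measurable_PiM[OF cont]
  let ?osc = "dilation_oscillation k \<phi>"
  note osc_meas[measurable] = dilation_oscillation_measurable[OF cont bound]
  note osc = dilation_oscillation_bounds[OF cont bound]
  have C: "0 \<le> C"
    using bound[of "restrict undefined {..<k}"] by (auto intro: order_trans[OF abs_ge_zero])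
  \<comment> \<open>\<open>weighted_mean_tendsto\<close> wants bounds at every function, while
    \<phi> is bounded on extensional ones only. The shift makes it nonnegative there, and the clamp
    acts only outside.\<close>
  define g where "g v = max 0 (min (2 * C) (\<phi> v + C))" for v
  have g_meas[measurable]: "g \<in> borel_measurable (\<Pi>\<^sub>M i\<in>{..<k}. borel)"
    unfolding g_def by measurable
  have g: "g v = \<phi> v + C" if "v \<in> {..<k} \<rightarrow>\<^sub>E UNIV" for v
    using bound[OF that] by (auto simp: g_def)
  let ?w = "\<lambda>N. radial_density.weighted_mean (maxwellian_mixture (\<delta> N)) N"
  have int: "integrable (M.law {..<k}) \<phi>"
    using bound by (intro Q.integrable_const_bound[where B = C]) auto
  have g_lim: "(\<lambda>N. ?w N (\<lambda>v. g (restrict v {..<k}))) \<longlonglongrightarrow> ?m + C"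
  proof -
    have "(\<integral>v. g v \<partial>M.law {..<k}) = (\<integral>v. \<phi> v + C \<partial>M.law {..<k})"
      by (intro Bochner_Integration.integral_cong) (auto simp: g)
    also have "\<dots> = ?m + C"
      using int Q.prob_space by simp
    finally show ?thesis
      using weighted_mean_tendsto[OF \<delta> g_meas, of "2 * C"] C by (simp add: g_def)
  qed
  have osc_lim: "(\<lambda>m. \<integral>v. ?osc m v \<partial>M.law {..<k}) \<longlonglongrightarrow> (\<integral>v. 0 \<partial>M.law {..<k})"
  proof (rule integral_dominated_convergence[where w = "\<lambda>_. 2 * C"])
    show "AE v in M.law {..<k}. (\<lambda>m. ?osc m v) \<longlonglongrightarrow> 0"
      using dilation_oscillation_tendsto_0[OF cont bound] by (intro AE_I2) auto
  qed (use osc in auto)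
  show ?thesis
  proof (rule LIMSEQ_I)
    fix r :: real assume r: "0 < r"
    have "\<forall>\<^sub>F m in sequentially. (\<integral>v. ?osc m v \<partial>M.law {..<k}) < r / 2"
      using osc_lim r by (intro order_tendstoD(2)) auto
    then obtain m where m: "(\<integral>v. ?osc m v \<partial>M.law {..<k}) < r / 2"
      by (auto simp: eventually_sequentially)
    have "(\<lambda>N. ?w N (\<lambda>v. ?osc m (restrict v {..<k}))) \<longlonglongrightarrow> (\<integral>v. ?osc m v \<partial>M.law {..<k})"
      using osc by (intro weighted_mean_tendsto[OF \<delta> osc_meas]) auto
    from order_tendstoD(2)[OF this m]
    have ev1: "\<forall>\<^sub>F N in sequentially. ?w N (\<lambda>v. ?osc m (restrict v {..<k})) < r / 2" .
    have "(\<lambda>N. real N / (real N - 1)) \<longlonglongrightarrow> 1"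
      by real_asymp
    then have ev2: "\<forall>\<^sub>F N in sequentially. real N / (real N - 1) < (1 + 1 / real (Suc m))\<^sup>2"
      by (rule order_tendstoD(2)) (intro one_less_power, auto)
    have ev3: "\<forall>\<^sub>F N in sequentially. \<bar>?w N (\<lambda>v. g (restrict v {..<k})) - (?m + C)\<bar> < r / 2"
      using tendstoD[OF g_lim, of "r / 2"] r by (simp add: dist_real_def)
    have "\<forall>\<^sub>F N in sequentially. norm (?A N - ?m) < r"
      using ev1 ev2 ev3 admissible_eventually[OF \<delta>] eventually_ge_at_top[of "max 2 k"]
    proof eventually_elim
      case (elim N)
      have d: "0 < \<delta> N" "\<delta> N < 1"
        using elim by auto
      interpret f: radial_density "maxwellian_mixture (\<delta> N)"
        using d by (rule radial_density_mixture)
      have N: "N \<ge> 2" "k \<le> N" "N \<ge> 1"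
        using elim by auto
      have "0 < exp (- 3 * sqrt N) / (100 * real N ^ 4)"
        using N by simp
      then have mass: "0 < f.mass N"
        using elim(4) by (meson less_le_trans)
      have rp[measurable]: "(\<lambda>v. restrict (radial_projection N v) {..<k}) \<in> (\<Pi>\<^sub>M i\<in>{..<N}. borel) \<rightarrow>\<^sub>M (\<Pi>\<^sub>M i\<in>{..<k}. borel)"
        using measurable_compose[OF f.radial_projection_measurable' restrict_measurable[OF N(2)]] .
      note rm[measurable] = restrict_measurable[OF N(2)]
      have A: "?A N = f.weighted_mean N (\<lambda>v. \<phi> (restrict (radial_projection N v) {..<k}))"
        unfolding f.weighted_mean_def using N(1) by (intro f.conditioned_integral) measurable
      have "f.weighted_mean N (\<lambda>v. g (restrict v {..<k}))
          = (\<integral>v. f.weight N v * \<phi> (restrict v {..<k}) + f.weight N v * C \<partial>f.law {..<N}) / f.mass N"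
        unfolding f.weighted_mean_def
        by (intro arg_cong2[where f = "(/)"] Bochner_Integration.integral_cong) (auto simp: g algebra_simps)
      also have "\<dots> = (f.mass N * f.weighted_mean N (\<lambda>v. \<phi> (restrict v {..<k})) + f.mass N * C) / f.mass N"
      proof -
        have "integrable (f.law {..<N}) (\<lambda>v. f.weight N v * \<phi> (restrict v {..<k}))"
          using bound by (intro f.integrable_weight_bounded[OF N(3), where C = C]) auto
        moreover have "integrable (f.law {..<N}) (\<lambda>v. f.weight N v * C)"
          using C by (intro f.integrable_weight_bounded[OF N(3), where C = C]) auto
        ultimately show ?thesis
          using mass by (simp add: f.weighted_mean_def f.mass_def)
      qed
      also have "\<dots> = f.weighted_mean N (\<lambda>v. \<phi> (restrict v {..<k})) + C"
        using mass by (simp add: field_simps)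
      finally have B: "f.weighted_mean N (\<lambda>v. g (restrict v {..<k})) = f.weighted_mean N (\<lambda>v. \<phi> (restrict v {..<k})) + C" .
      have "\<bar>?A N - f.weighted_mean N (\<lambda>v. \<phi> (restrict v {..<k}))\<bar>
          \<le> f.weighted_mean N (\<lambda>v. ?osc m (restrict v {..<k}))"
        unfolding A
      proof (rule f.weighted_mean_diff_le[where C = "2 * C"])
        fix v assume v: "v \<in> kac_shell N"
        show "\<bar>\<phi> (restrict (radial_projection N v) {..<k}) - \<phi> (restrict v {..<k})\<bar> \<le> ?osc m (restrict v {..<k})"
        proof -
          obtain c where c: "1 \<le> c" "c < 1 + 1 / real (Suc m)"
            "restrict (radial_projection N v) {..<k} = dilate k c (restrict v {..<k})"
            using restrict_radial_projection[OF N(1,2) elim(2) v] .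
          then show ?thesis
            using dilation_difference_le_oscillation[OF cont bound c(1,2), of "restrict v {..<k}"]
            by (simp add: dilate_1)
        qed
        show "\<bar>\<phi> (restrict (radial_projection N v) {..<k})\<bar> \<le> 2 * C" "\<bar>\<phi> (restrict v {..<k})\<bar> \<le> 2 * C"
        proof -
          have "\<bar>\<phi> (restrict u {..<k})\<bar> \<le> 2 * C" for u
            using bound[of "restrict u {..<k}"] C by simp
          then show "\<bar>\<phi> (restrict (radial_projection N v) {..<k})\<bar> \<le> 2 * C" "\<bar>\<phi> (restrict v {..<k})\<bar> \<le> 2 * C"
            by blast+
        qed
        show "\<bar>?osc m (restrict v {..<k})\<bar> \<le> 2 * C"
          using osc by simp
      qed (use N in measurable)
      then show ?case
        using elim(1,3) unfolding B real_norm_def by linarith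
    qed
    then show "\<exists>N0. \<forall>N\<ge>N0. norm (?A N - ?m) < r"
      by (simp add: eventually_sequentially)
  qed
qed

section \<open>Entropy\<close>

lemma extended_integral_integrable:
  assumes "integrable M g"
  shows "extended_integral M g = ereal (\<integral>x. g x \<partial>M)"
proof -
  have fin: "(\<integral>\<^sup>+x. ennreal (g x) \<partial>M) \<noteq> \<infinity>" "(\<integral>\<^sup>+x. ennreal (- g x) \<partial>M) \<noteq> \<infinity>"
    using assms by (auto simp: real_integrable_def)
  obtain a b where "0 \<le> a" "(\<integral>\<^sup>+x. ennreal (g x) \<partial>M) = ennreal a" "0 \<le> b" "(\<integral>\<^sup>+x. ennreal (- g x) \<partial>M) = ennreal b"
    using fin by (metis ennreal_cases infinity_ennreal_def)
  then show ?thesis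
    by (simp add: extended_integral_def real_lebesgue_integral_def[OF assms])
qed

context
  fixes N :: nat and f :: "real \<Rightarrow> real"
  assumes f_meas [measurable]: "f \<in> borel_measurable borel" and f_pos: "\<And>x. 0 < f x" and f_le: "\<And>x. f x \<le> 1"
begin

lemma tensor_bounds: "0 < (\<Prod>i<N. f (v i))" "(\<Prod>i<N. f (v i)) \<le> 1"
  using f_pos f_le prod_mono[of "{..<N}" "\<lambda>i. f (v i)" "\<lambda>_. 1"]
  by (auto intro: prod_pos simp: less_imp_le)

lemma integrable_tensor: "integrable (kac_measure N) (\<lambda>v. \<Prod>i<N. f (v i))"
proof -
  interpret prob_space "kac_measure N" by (rule prob_space_kac_measure)
  show ?thesis
    using tensor_bounds by (intro integrable_const_bound[where B = 1]) (auto simp: abs_le_iff less_imp_le intro!: AE_I2 order_trans[OF _ zero_le_one])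
qed

lemma tensor_integral_pos: "0 < (\<integral>v. (\<Prod>i<N. f (v i)) \<partial>kac_measure N)"
proof -
  interpret prob_space "kac_measure N" by (rule prob_space_kac_measure)
  have nn: "0 \<le> (\<Prod>i<N. f (v i))" for v
    using tensor_bounds(1) by (rule less_imp_le)
  have "(\<integral>v. (\<Prod>i<N. f (v i)) \<partial>kac_measure N) \<noteq> 0"
  proof
    assume "(\<integral>v. (\<Prod>i<N. f (v i)) \<partial>kac_measure N) = 0"
    then have "AE v in kac_measure N. (\<Prod>i<N. f (v i)) = 0"
      using integrable_tensor nn by (subst (asm) integral_nonneg_eq_0_iff_AE) auto
    then have "AE v in kac_measure N. False"
      by eventually_elim (use tensor_bounds(1) in \<open>metis less_irrefl\<close>)
    then show False
      by simp
  qed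
  moreover have "0 \<le> (\<integral>v. (\<Prod>i<N. f (v i)) \<partial>kac_measure N)"
    by (intro Bochner_Integration.integral_nonneg nn)
  ultimately show ?thesis by simp
qed

lemma conditioned_tensor_measurable: "conditioned_tensor N f \<in> borel_measurable (kac_measure N)"
  unfolding conditioned_tensor_def[abs_def] by measurable

lemma symmetric_density_conditioned_tensor: "symmetric_density N (conditioned_tensor N f)"
  unfolding symmetric_density_def
proof (intro conjI ballI allI impI)
  let ?Z = "\<integral>v. (\<Prod>i<N. f (v i)) \<partial>kac_measure N"
  show "0 \<le> conditioned_tensor N f v" for v
    using tensor_bounds(1)[of v] tensor_integral_pos by (simp add: conditioned_tensor_def)
  have "(\<integral>\<^sup>+v. ennreal (conditioned_tensor N f v) \<partial>kac_measure N) = ennreal (\<integral>v. conditioned_tensor N f v \<partial>kac_measure N)"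
    using integrable_tensor tensor_bounds(1) tensor_integral_pos
    by (intro nn_integral_eq_integral) (auto simp: conditioned_tensor_def less_imp_le)
  also have "(\<integral>v. conditioned_tensor N f v \<partial>kac_measure N) = 1"
    using tensor_integral_pos by (simp add: conditioned_tensor_def)
  finally show "(\<integral>\<^sup>+v. ennreal (conditioned_tensor N f v) \<partial>kac_measure N) = 1"
    by simp
  fix \<pi> v assume "\<pi> permutes {..<N}"
  then show "conditioned_tensor N f (v \<circ> \<pi>) = conditioned_tensor N f v"
    using prod.permute[of \<pi> "{..<N}" "\<lambda>i. f (v i)"] by (simp add: conditioned_tensor_def o_def)
qed (rule conditioned_tensor_measurable)

text \<open>On the sphere each coordinate has square at most \<open>N\<close>, so every factor lies
  between \<open>b\<close> and 1. The entropy integrand is thus bounded almost everywhere, and the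
  extended integral reduces to a Bochner integral.\<close>

lemma kac_entropy_conditioned_tensor:
  assumes N: "N \<ge> 1" and b: "0 < b" "\<And>x. x\<^sup>2 \<le> real N \<Longrightarrow> b \<le> f x"
  defines "Z \<equiv> \<integral>v. (\<Prod>i<N. f (v i)) \<partial>kac_measure N"
  shows "kac_entropy N (conditioned_tensor N f)
    = ereal (\<integral>v. conditioned_tensor N f v * ((\<Sum>i<N. ln (f (v i))) - ln Z) \<partial>kac_measure N)"
proof -
  interpret prob_space "kac_measure N" by (rule prob_space_kac_measure)
  have Z: "0 < Z"
    unfolding Z_def by (rule tensor_integral_pos)
  have eq: "conditioned_tensor N f v * ln (conditioned_tensor N f v)
    = conditioned_tensor N f v * ((\<Sum>i<N. ln (f (v i))) - ln Z)" for v
  proof -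
    have "ln (\<Prod>i<N. f (v i)) = (\<Sum>i<N. ln (f (v i)))"
      using f_pos by (intro ln_prod finite_lessThan) (metis less_irrefl)
    then show ?thesis
      using Z tensor_bounds(1)[of v] by (simp add: conditioned_tensor_def ln_div flip: Z_def)
  qed
  note [measurable] = conditioned_tensor_measurable
  have "AE v in kac_measure N. norm (conditioned_tensor N f v * ((\<Sum>i<N. ln (f (v i))) - ln Z))
      \<le> 1 / Z * (real N * (- ln b) + \<bar>ln Z\<bar>)"
    using AE_kac_measure[OF N]
  proof eventually_elim
    case (elim v)
    have "\<bar>ln (f (v i))\<bar> \<le> - ln b" if "i < N" for i
    proof -
      have "(v i)\<^sup>2 \<le> (\<Sum>i<N. (v i)\<^sup>2)"
        using that by (intro member_le_sum) auto
      then have "b \<le> f (v i)"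
        using elim by (intro b(2)) (simp add: kac_sphere_def)
      then have "ln b \<le> ln (f (v i))"
        using b(1) f_pos by simp
      moreover have "ln (f (v i)) \<le> 0"
        using f_pos f_le by simp
      ultimately show ?thesis by simp
    qed
    then have "(\<Sum>i<N. \<bar>ln (f (v i))\<bar>) \<le> real N * (- ln b)"
      using sum_bounded_above[of "{..<N}" "\<lambda>i. \<bar>ln (f (v i))\<bar>" "- ln b"] by simp
    then have "\<bar>(\<Sum>i<N. ln (f (v i))) - ln Z\<bar> \<le> real N * (- ln b) + \<bar>ln Z\<bar>"
      using sum_abs[of "\<lambda>i. ln (f (v i))" "{..<N}"] by linarith
    moreover have "\<bar>conditioned_tensor N f v\<bar> \<le> 1 / Z"
      using Z tensor_bounds[of v] by (simp add: conditioned_tensor_def divide_right_mono flip: Z_def)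
    ultimately show ?case
      unfolding real_norm_def abs_mult using Z by (intro mult_mono) auto
  qed
  then have "integrable (kac_measure N) (\<lambda>v. conditioned_tensor N f v * ((\<Sum>i<N. ln (f (v i))) - ln Z))"
    by (rule integrable_const_bound) measurable
  then show ?thesis
    by (simp add: kac_entropy_def eq extended_integral_integrable)
qed

end

lemma maxwellian_inverse_le_1:
  assumes "0 < a" "a \<le> 1"
  shows "maxwellian (1 / (2 * a)) x \<le> 1"
proof -
  have "a \<le> pi"
    using assms pi_gt3 by simp
  then have "sqrt (a / pi) * exp (- a * x\<^sup>2) \<le> 1 * 1"
    using assms by (intro mult_mono) auto
  then show ?thesis
    using assms by (simp add: maxwellian_inverse)
qed

lemma maxwellian_mixture_le_1:
  assumes "0 < \<delta>" "\<delta> < 1"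
  shows "maxwellian_mixture \<delta> x \<le> 1"
proof -
  have "maxwellian_mixture \<delta> x \<le> \<delta> * 1 + (1 - \<delta>) * 1"
    unfolding maxwellian_mixture_def
    using assms by (intro add_mono mult_left_mono maxwellian_inverse_le_1) auto
  then show ?thesis by simp
qed

lemma symmetric_density_mixture:
  assumes "0 < \<delta>" "\<delta> \<le> 1"
  shows "symmetric_density N (conditioned_tensor N (maxwellian_mixture \<delta>))"
proof (cases "\<delta> = 1")
  case True
  interpret radial_density "maxwellian (1 / 2)"
    by (rule radial_density_half)
  have "maxwellian_mixture \<delta> = maxwellian (1 / 2)"
    using True by (simp add: maxwellian_mixture_def fun_eq_iff)
  then show ?thesis
    using maxwellian_inverse_le_1[of 1] pos by (auto intro: symmetric_density_conditioned_tensor)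
next
  case False
  then have d: "0 < \<delta>" "\<delta> < 1"
    using assms by auto
  interpret radial_density "maxwellian_mixture \<delta>"
    using d by (rule radial_density_mixture)
  show ?thesis
    using maxwellian_mixture_le_1[OF d] pos by (intro symmetric_density_conditioned_tensor) auto
qed

lemma chaotic_mixture:
  assumes \<delta>: "admissible \<delta>" and range: "\<And>N. N \<ge> 1 \<Longrightarrow> 0 < \<delta> N \<and> \<delta> N \<le> 1"
  shows "chaotic (\<lambda>N. conditioned_tensor N (maxwellian_mixture (\<delta> N))) (maxwellian (1 / 2))"
  unfolding chaotic_def
proof (intro conjI allI impI)
  fix N :: nat assume "1 \<le> N"
  then show "symmetric_density N (conditioned_tensor N (maxwellian_mixture (\<delta> N)))"
    using range by (intro symmetric_density_mixture) auto
next
  interpret radial_density "maxwellian (1 / 2)"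
    by (rule radial_density_half)
  show "real_density (maxwellian (1 / 2))"
    by (rule real_density)
  fix k :: nat and \<phi> :: "(nat \<Rightarrow> real) \<Rightarrow> real"
  assume \<phi>: "continuous_map (powertop_real {..<k}) euclideanreal \<phi> \<and> bounded (\<phi> ` ({..<k} \<rightarrow>\<^sub>E UNIV))"
  then obtain C where C: "\<And>v. v \<in> {..<k} \<rightarrow>\<^sub>E UNIV \<Longrightarrow> \<bar>\<phi> v\<bar> \<le> C"
    by (auto simp: bounded_iff)
  have eq: "(\<integral>v. \<phi> v \<partial>law {..<k}) = (\<integral>v. (\<Prod>i<k. maxwellian (1 / 2) (v i)) * \<phi> v \<partial>(\<Pi>\<^sub>M i\<in>{..<k}. lborel))"
    using continuous_map_measurable_PiM \<phi> by (intro integral_law) auto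
  show "(\<lambda>N. \<integral>v. conditioned_tensor N (maxwellian_mixture (\<delta> N)) v * \<phi> (restrict v {..<k}) \<partial>kac_measure N)
      \<longlonglongrightarrow> (\<integral>v. (\<Prod>i<k. maxwellian (1 / 2) (v i)) * \<phi> v \<partial>(\<Pi>\<^sub>M i\<in>{..<k}. lborel))"
    unfolding eq[symmetric] using \<phi> by (intro mixture_marginals_tendsto[OF \<delta> _ C]) auto
qed

section \<open>Lower bound for the entropy of the conditioned mixture\<close>

lemma ln_gaussian_term:
  assumes "0 < a"
  shows "ln (a * (sqrt (a / pi) * exp y)) = 3 / 2 * ln a - 1 / 2 * ln pi + y"
  using assms by (simp add: ln_mult ln_sqrt ln_div field_simps)

text \<open>The mixture is at least each of its components. Comparison with the cold one costs the
  energy \<open>x\<^sup>2\<close>; comparison with the hot one costs - (3/2) ln \<delta> instead,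
  and \<delta> at least 1/N^2 turns this into 3 ln N. This is the origin of the truncation level
  \<open>L\<close>.\<close>

lemma neg_ln_mixture_le:
  assumes d: "0 < \<delta>" "\<delta> < 1" "1 / (real N)\<^sup>2 \<le> \<delta>" and N: "N \<ge> 1"
  shows "- ln (maxwellian_mixture \<delta> x)
    \<le> 1 / 2 * ln pi - 3 / 2 * ln (1 - \<delta>) + \<delta> * x\<^sup>2 + min (x\<^sup>2) (3 * ln (real N))"
proof -
  let ?h = "\<delta> * (sqrt (\<delta> / pi) * exp (- \<delta> * x\<^sup>2))"
  let ?c = "(1 - \<delta>) * (sqrt ((1 - \<delta>) / pi) * exp (- (1 - \<delta>) * x\<^sup>2))"
  have pos: "0 < ?h" "0 < ?c"
    using d by auto
  have "ln ?h \<le> ln (maxwellian_mixture \<delta> x)" "ln ?c \<le> ln (maxwellian_mixture \<delta> x)"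
    unfolding maxwellian_mixture_eq[OF d(1,2)] using pos by auto
  then have le: "3 / 2 * ln \<delta> - 1 / 2 * ln pi - \<delta> * x\<^sup>2 \<le> ln (maxwellian_mixture \<delta> x)"
    "3 / 2 * ln (1 - \<delta>) - 1 / 2 * ln pi - (1 - \<delta>) * x\<^sup>2 \<le> ln (maxwellian_mixture \<delta> x)"
    using d(2) unfolding ln_gaussian_term[OF d(1)] ln_gaussian_term[of "1 - \<delta>", simplified, OF d(2)]
    by (simp_all add: algebra_simps)
  have "ln (1 / (real N)\<^sup>2) \<le> ln \<delta>"
    using d N by (intro ln_mono) auto
  then have ln_d: "- 3 / 2 * ln \<delta> \<le> 3 * ln (real N)"
    using N by (simp add: ln_div ln_realpow)
  have "ln (1 - \<delta>) \<le> 0"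
    using d by simp
  moreover have "0 \<le> \<delta> * x\<^sup>2"
    using d by simp
  ultimately show ?thesis
    using le ln_d by (auto simp: min_def algebra_simps)
qed

text \<open>Truncation caps the hot contribution at \<delta> L, and the cold component has energy (1
  - \<delta>) / (2 (1 - \<delta>)) = 1/2. The integral is over one-element index sets to match
  \<open>weighted_mean_block\<close> with \<open>k = 1\<close>.\<close>

lemma mixture_truncated_energy:
  assumes d: "0 < \<delta>" "\<delta> < 1" and L: "0 \<le> L"
  shows "(\<integral>v. min ((v 0)\<^sup>2) L \<partial>radial_density.law (maxwellian_mixture \<delta>) {..<1}) \<le> 1 / 2 + \<delta> * L"
proof -
  interpret radial_density "maxwellian_mixture \<delta>"
    using d by (rule radial_density_mixture)
  define h where "h = maxwellian (1 / (2 * \<delta>))"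
  define c where "c = maxwellian (1 / (2 * (1 - \<delta>)))"
  have h: "real_density h" and c: "real_density c"
    unfolding h_def c_def using d by (auto intro!: real_density_maxwellian)
  then have [measurable]: "h \<in> borel_measurable borel" "c \<in> borel_measurable borel"
    by (auto simp: real_density_def)
  have nn: "0 \<le> h x" "0 \<le> c x" for x
    using h c by (auto simp: real_density_def)
  have "(\<integral>\<^sup>+v. ennreal (min ((v 0)\<^sup>2) L) \<partial>law {..<1})
      = (\<integral>\<^sup>+x. ennreal (maxwellian_mixture \<delta> x) * ennreal (min (x\<^sup>2) L) \<partial>lborel)"
    by (rule nn_integral_law_component) auto
  also have "\<dots> \<le> (\<integral>\<^sup>+x. ennreal (\<delta> * L) * ennreal (h x) + ennreal (1 - \<delta>) * ennreal (x\<^sup>2 * c x) \<partial>lborel)"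
  proof (rule nn_integral_mono)
    fix x :: real
    have "maxwellian_mixture \<delta> x * min (x\<^sup>2) L
        = \<delta> * h x * min (x\<^sup>2) L + (1 - \<delta>) * c x * min (x\<^sup>2) L"
      by (simp add: maxwellian_mixture_def h_def c_def distrib_right)
    also have "\<dots> \<le> \<delta> * h x * L + (1 - \<delta>) * c x * x\<^sup>2"
      using d nn[of x] by (intro add_mono mult_left_mono) auto
    finally have "ennreal (maxwellian_mixture \<delta> x * min (x\<^sup>2) L)
        \<le> ennreal (\<delta> * L * h x + (1 - \<delta>) * (x\<^sup>2 * c x))"
      by (intro ennreal_leI) (simp add: ac_simps)
    also have "\<dots> = ennreal (\<delta> * L) * ennreal (h x) + ennreal (1 - \<delta>) * ennreal (x\<^sup>2 * c x)"
      using d L nn[of x] by (subst ennreal_plus) (simp_all add: ennreal_mult)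
    finally show "ennreal (maxwellian_mixture \<delta> x) * ennreal (min (x\<^sup>2) L)
        \<le> ennreal (\<delta> * L) * ennreal (h x) + ennreal (1 - \<delta>) * ennreal (x\<^sup>2 * c x)"
      using pos[of x] L by (simp add: ennreal_mult less_imp_le)
  qed
  also have "\<dots> = ennreal (\<delta> * L) * (\<integral>\<^sup>+x. ennreal (h x) \<partial>lborel)
      + ennreal (1 - \<delta>) * (\<integral>\<^sup>+x. ennreal (x\<^sup>2 * c x) \<partial>lborel)"
    by (simp add: nn_integral_add nn_integral_cmult)
  also have "\<dots> = ennreal (\<delta> * L) * 1 + ennreal (1 - \<delta>) * ennreal (1 / (2 * (1 - \<delta>)))"
    using h d nn_integral_maxwellian_square[of "1 / (2 * (1 - \<delta>))"] by (simp add: real_density_def c_def)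
  also have "\<dots> = ennreal (1 / 2 + \<delta> * L)"
    using d L by (simp flip: ennreal_mult ennreal_plus)
  finally show ?thesis
    using d L by (intro integral_real_bounded) auto
qed

context radial_density
begin

lemma mass_le_1:
  assumes "N \<ge> 1"
  shows "mass N \<le> 1"
proof -
  interpret prob_space "law {..<N}" by (rule prob_space_law)
  have "integrable (law {..<N}) (weight N)"
    using integrable_weight_bounded[OF assms, of "\<lambda>_. 1" 1] by simp
  then show ?thesis
    unfolding mass_def using weight_le_1[OF assms] by (intro integral_le_const) auto
qed

lemma weighted_sum_of_coordinates:
  assumes N: "N \<ge> 1" and [measurable]: "g \<in> borel_measurable borel" and g: "\<And>x. 0 \<le> g x" "\<And>x. g x \<le> C"
  shows "(\<integral>v. weight N v * (\<Sum>i<N. g (v i)) \<partial>law {..<N})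
    = real N * (mass N * weighted_mean N (\<lambda>v. g (restrict v {..<1} 0)))"
proof -
  have coord: "(\<lambda>v. g (v i)) \<in> borel_measurable (\<Pi>\<^sub>M i\<in>{..<N}. borel)" if "i < N" for i
    by (rule measurable_compose[OF _ assms(2)]) (use that in \<open>auto intro: measurable_component_singleton\<close>)
  have int: "integrable (law {..<N}) (\<lambda>v. weight N v * g (v i))" if "i < N" for i
    using coord[OF that] g by (intro integrable_weight_bounded[OF N, where C = C]) auto
  have "(\<integral>v. weight N v * (\<Sum>i<N. g (v i)) \<partial>law {..<N})
      = (\<Sum>i<N. \<integral>v. weight N v * g (v i) \<partial>law {..<N})"
    using int by (simp add: sum_distrib_left Bochner_Integration.integral_sum)
  also have "\<dots> = (\<Sum>i<N. \<integral>v. weight N v * g (restrict v {..<1} 0) \<partial>law {..<N})"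
  proof (rule sum.cong[OF refl])
    fix i assume "i \<in> {..<N}"
    then show "(\<integral>v. weight N v * g (v i) \<partial>law {..<N}) = (\<integral>v. weight N v * g (restrict v {..<1} 0) \<partial>law {..<N})"
      using weight_block_symmetry[of i N 1 N "\<lambda>w. g (w 0)"] by simp
  qed
  also have "\<dots> = real N * (\<integral>v. weight N v * g (restrict v {..<1} 0) \<partial>law {..<N})"
    by simp
  also have "(\<integral>v. weight N v * g (restrict v {..<1} 0) \<partial>law {..<N}) = mass N * weighted_mean N (\<lambda>v. g (restrict v {..<1} 0))"
  \<comment> \<open>Here \<open>weighted_mean\<close> is a division by 0, hence 0; the left side
    vanishes too, as the weight is then 0 almost everywhere.\<close>
  proof (cases "mass N = 0")
    case True
    then have "AE v in law {..<N}. weight N v = 0"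
      using integrable_weight_bounded[OF N, of "\<lambda>_. 1" 1] weight_nonneg unfolding mass_def
      by (subst (asm) integral_nonneg_eq_0_iff_AE) auto
    then have "(\<integral>v. weight N v * g (restrict v {..<1} 0) \<partial>law {..<N}) = 0"
      by (intro integral_eq_zero_AE) (auto elim: eventually_mono)
    with True show ?thesis by simp
  qed (simp add: weighted_mean_def)
  finally show ?thesis .
qed

end

text \<open>The logarithm of the density on the sphere is the sum of the \<open>ln (f (v i))\<close>
  minus \<open>ln Z\<close>. The pointwise bound for - ln f leaves one random term, the truncated
  energy, which is a sum of bounded functions of single coordinates and so concentrates with blocks
  of length 1.\<close>

lemma mixture_entropy_ge:
  assumes d: "0 < \<delta>" "\<delta> < 1" "1 / (real N)\<^sup>2 \<le> \<delta>" and N: "N \<ge> 2" and \<epsilon>: "0 < \<epsilon>"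
    and b: "0 < b" "b \<le> radial_density.mass (maxwellian_mixture \<delta>) N"
  defines "L \<equiv> 3 * ln (real N)"
  shows "ereal (ln (measure (lborel_pow N) (kac_shell N)) - real N * (1 / 2 * ln pi - 3 / 2 * ln (1 - \<delta>) + \<delta>)
      - real N * (real N / (real N - 1) * (1 / 2 + \<delta> * L + \<epsilon> + L * (2 * exp (- 2 * real N * \<epsilon>\<^sup>2 / L\<^sup>2)) / b)))
    \<le> kac_entropy N (conditioned_tensor N (maxwellian_mixture \<delta>))"
proof -
  define f where "f = maxwellian_mixture \<delta>"
  interpret radial_density f
    unfolding f_def using d(1,2) by (rule radial_density_mixture)
  interpret P: prob_space "law {..<N}" by (rule prob_space_law)
  define Z where "Z = (\<integral>v. (\<Prod>i<N. f (v i)) \<partial>kac_measure N)"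
  define V where "V = measure (lborel_pow N) (kac_shell N)"
  define a where "a = 1 / 2 * ln pi - 3 / 2 * ln (1 - \<delta>)"
  define c where "c = real N / (real N - 1)"
  define K where "K = real N * (a + \<delta>) - ln V"
  define g where "g x = min (x\<^sup>2) L" for x
  have N1: "N \<ge> 1" and L: "0 < L"
    using N by (auto simp: L_def)
  have c: "0 \<le> c"
    using N by (simp add: c_def)
  have [measurable]: "g \<in> borel_measurable borel"
    unfolding g_def by measurable
  have g: "0 \<le> g x" "g x \<le> L" for x
    using L by (auto simp: g_def)
  have m: "0 < mass N" "mass N \<le> 1"
    using b mass_le_1[OF N1] by (auto simp: f_def)
  have V: "0 < V"
    unfolding V_def by (rule measure_kac_shell_pos[OF N])
  have Z: "Z = mass N / V"
    unfolding Z_def V_def by (rule kac_normalisation[OF N])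
  \<comment> \<open>A mass of at most 1 can only raise the entropy, so a lower bound may ignore its
    logarithm.\<close>
  have lnZ: "ln V \<le> - ln Z"
    using m V by (simp add: Z ln_div)
  have f1: "f x \<le> 1" for x
    unfolding f_def using d(1,2) by (rule maxwellian_mixture_le_1)
  define H where "H v = (\<Sum>i<N. ln (f (v i))) - ln Z" for v
  have H_meas[measurable]: "H \<in> borel_measurable (\<Pi>\<^sub>M i\<in>{..<N}. borel)"
    unfolding H_def by measurable
  let ?\<beta> = "\<delta> * sqrt (\<delta> / pi) * exp (- \<delta> * real N)"
  have "kac_entropy N (conditioned_tensor N f)
      = ereal (\<integral>v. conditioned_tensor N f v * H v \<partial>kac_measure N)"
    unfolding H_def Z_def
  proof (rule kac_entropy_conditioned_tensor[where b = ?\<beta>])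
    fix x :: real assume "x\<^sup>2 \<le> real N"
    then have "\<delta> * (sqrt (\<delta> / pi) * exp (- \<delta> * real N)) \<le> \<delta> * (sqrt (\<delta> / pi) * exp (- \<delta> * x\<^sup>2))"
      using d by (intro mult_left_mono) auto
    then show "?\<beta> \<le> f x"
      unfolding f_def maxwellian_mixture_eq[OF d(1,2)] using d by (simp add: add_increasing2)
  qed (use N1 pos f1 d in auto)
  also have "(\<integral>v. conditioned_tensor N f v * H v \<partial>kac_measure N)
      = (\<integral>v. weight N v * H (radial_projection N v) \<partial>law {..<N}) / mass N"
    by (rule conditioned_integral[OF N H_meas])
  finally have ent: "kac_entropy N (conditioned_tensor N f)
      = ereal ((\<integral>v. weight N v * H (radial_projection N v) \<partial>law {..<N}) / mass N)" .
  have lower: "- K - c * (\<Sum>i<N. g (v i)) \<le> H (radial_projection N v)" if v: "v \<in> kac_shell N" for v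
  proof -
    let ?s = "\<Sum>i<N. (v i)\<^sup>2"
    obtain t where t: "1 \<le> t" "t\<^sup>2 * ?s = real N" "\<And>i. i < N \<Longrightarrow> radial_projection N v i = t * v i"
      using radial_projection_shell[OF v N1] by metis
    have t1: "1 \<le> t\<^sup>2"
      using t(1) by simp
    have "t\<^sup>2 * (real N - 1) \<le> t\<^sup>2 * ?s"
      using v by (intro mult_left_mono) (auto simp: kac_shell_def)
    then have tc: "t\<^sup>2 \<le> c"
      using N by (simp add: c_def t(2) pos_le_divide_eq)
    have each: "- ln (f (radial_projection N v i)) \<le> a + \<delta> * (t * v i)\<^sup>2 + c * g (v i)" if "i < N" for i
    proof -
      \<comment> \<open>The projection multiplies the untruncated energy by
        \<open>t\<^sup>2\<close>, and the cap \<open>L\<close> does not exceed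
        \<open>t\<^sup>2 * L\<close>. The random factor \<open>t\<^sup>2\<close> is then replaced by
        the constant \<open>c\<close>.\<close>
      have "g (t * v i) \<le> t\<^sup>2 * g (v i)"
      proof -
        have "L \<le> t\<^sup>2 * L"
          using t1 L by simp
        then show ?thesis
          by (auto simp: g_def min_def power_mult_distrib)
      qed
      also have "\<dots> \<le> c * g (v i)"
        using tc g(1) by (intro mult_right_mono) auto
      finally have "g (t * v i) \<le> c * g (v i)" .
      moreover have "- ln (f (t * v i)) \<le> a + \<delta> * (t * v i)\<^sup>2 + g (t * v i)"
        using neg_ln_mixture_le[OF d N1, of "t * v i"] by (simp add: f_def a_def g_def L_def)
      ultimately show ?thesis
        by (simp add: t(3)[OF that])
    qed
    have "(\<Sum>i<N. - ln (f (radial_projection N v i))) \<le> (\<Sum>i<N. a + \<delta> * (t * v i)\<^sup>2 + c * g (v i))"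
      using each by (intro sum_mono) auto
    also have "\<dots> = real N * a + \<delta> * (t\<^sup>2 * ?s) + c * (\<Sum>i<N. g (v i))"
      by (simp add: sum.distrib sum_distrib_left power_mult_distrib)
    \<comment> \<open>The projected point has total energy exactly \<open>N\<close>, so the hot
      exponents add up to \<delta> N without any probabilistic estimate.\<close>
    also have "\<dots> = real N * (a + \<delta>) + c * (\<Sum>i<N. g (v i))"
      unfolding t(2) by (simp add: algebra_simps)
    finally show ?thesis
      using lnZ by (simp add: H_def K_def sum_negf)
  qed
  have upper: "H v \<le> - ln Z" for v
    using pos f1 by (simp add: H_def sum_nonpos)
  have g_sum: "0 \<le> (\<Sum>i<N. g (v i))" "(\<Sum>i<N. g (v i)) \<le> real N * L" for v :: "nat \<Rightarrow> real"
    using g sum_bounded_above[of "{..<N}" "\<lambda>i. g (v i)" L] by (auto intro: sum_nonneg)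
  have int1: "integrable (law {..<N}) (\<lambda>v. weight N v * H (radial_projection N v))"
  proof (rule integrable_weight_bounded[OF N1, where C = "\<bar>K\<bar> + c * (real N * L) + \<bar>ln Z\<bar>"])
    show "(\<lambda>v. H (radial_projection N v)) \<in> borel_measurable (\<Pi>\<^sub>M i\<in>{..<N}. borel)"
      using measurable_compose[OF radial_projection_measurable' H_meas] .
    fix v assume v: "v \<in> kac_shell N"
    have "c * (\<Sum>i<N. g (v i)) \<le> c * (real N * L)"
      using c g_sum by (intro mult_left_mono) auto
    moreover have "0 \<le> c * (real N * L)"
      using c L by simp
    ultimately show "\<bar>H (radial_projection N v)\<bar> \<le> \<bar>K\<bar> + c * (real N * L) + \<bar>ln Z\<bar>"
      using lower[OF v] upper[of "radial_projection N v"] by (auto simp: abs_le_iff)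
  qed
  have intW: "integrable (law {..<N}) (weight N)"
    using integrable_weight_bounded[OF N1, of "\<lambda>_. 1" 1] by simp
  have intg: "integrable (law {..<N}) (\<lambda>v. weight N v * (\<Sum>i<N. g (v i)))"
    using g_sum by (intro integrable_weight_bounded[OF N1, where C = "real N * L"]) auto
  have "- K * mass N - c * (\<integral>v. weight N v * (\<Sum>i<N. g (v i)) \<partial>law {..<N})
      = (\<integral>v. - K * weight N v - c * (weight N v * (\<Sum>i<N. g (v i))) \<partial>law {..<N})"
    using intW intg by (simp add: mass_def)
  also have "\<dots> \<le> (\<integral>v. weight N v * H (radial_projection N v) \<partial>law {..<N})"
  proof (rule integral_mono)
    fix v
    show "- K * weight N v - c * (weight N v * (\<Sum>i<N. g (v i))) \<le> weight N v * H (radial_projection N v)"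
    proof (cases "v \<in> kac_shell N")
      case True
      then show ?thesis
        using mult_left_mono[OF lower[OF True] weight_nonneg[of N v]] by (simp add: algebra_simps)
    qed (simp add: weight_def)
  qed (use int1 intW intg in auto)
  finally have "- K * mass N - c * (real N * (mass N * weighted_mean N (\<lambda>v. g (restrict v {..<1} 0))))
      \<le> (\<integral>v. weight N v * H (radial_projection N v) \<partial>law {..<N})"
    using weighted_sum_of_coordinates[of N g L] N1 g by simp
  then have low: "- K - c * (real N * weighted_mean N (\<lambda>v. g (restrict v {..<1} 0)))
      \<le> (\<integral>v. weight N v * H (radial_projection N v) \<partial>law {..<N}) / mass N"
    unfolding pos_le_divide_eq[OF m(1)] by (simp add: algebra_simps)
  have "\<bar>weighted_mean N (\<lambda>v. g (restrict v {..<1} 0)) - (\<integral>v. g (v 0) \<partial>law {..<1})\<bar>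
      \<le> \<epsilon> + L * (2 * exp (- 2 * real N * \<epsilon>\<^sup>2 / L\<^sup>2)) / b"
    using weighted_mean_block[of N N 1 "\<lambda>w. g (w 0)" L \<epsilon> b] N1 g L \<epsilon> b by (simp add: f_def)
  moreover have "(\<integral>v. g (v 0) \<partial>law {..<1}) \<le> 1 / 2 + \<delta> * L"
    unfolding g_def f_def using d L by (intro mixture_truncated_energy) auto
  ultimately have "weighted_mean N (\<lambda>v. g (restrict v {..<1} 0))
      \<le> 1 / 2 + \<delta> * L + \<epsilon> + L * (2 * exp (- 2 * real N * \<epsilon>\<^sup>2 / L\<^sup>2)) / b"
    by linarith
  then have "c * (real N * weighted_mean N (\<lambda>v. g (restrict v {..<1} 0)))
      \<le> c * (real N * (1 / 2 + \<delta> * L + \<epsilon> + L * (2 * exp (- 2 * real N * \<epsilon>\<^sup>2 / L\<^sup>2)) / b))"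
    using c by (intro mult_left_mono) auto
  also have "\<dots> = real N * (c * (1 / 2 + \<delta> * L + \<epsilon> + L * (2 * exp (- 2 * real N * \<epsilon>\<^sup>2 / L\<^sup>2)) / b))"
    by (rule mult.left_commute)
  finally have "ln V - real N * (a + \<delta>) - real N * (c * (1 / 2 + \<delta> * L + \<epsilon> + L * (2 * exp (- 2 * real N * \<epsilon>\<^sup>2 / L\<^sup>2)) / b))
      \<le> (\<integral>v. weight N v * H (radial_projection N v) \<partial>law {..<N}) / mass N"
    using low unfolding K_def by linarith
  then show ?thesis
    unfolding f_def[symmetric] ent V_def a_def c_def by simp
qed

section \<open>Volume of the shell and failure of entropic chaoticity\<close>

text \<open>Stirling's upper bound m! \<le> e m (m/e)^m, with equality at \<open>m = 1\<close>. The
  induction step is ln (m/(m+1)) \<le> - 1/(m+1).\<close>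

lemma ln_fact_le:
  assumes "m \<ge> 1"
  shows "ln (fact m) \<le> 1 + ln (real m) + real m * ln (real m) - real m"
  using assms
proof (induction m rule: dec_induct)
  case (step m)
  have m: "0 < real m"
    using step by simp
  have "ln (real m / real (Suc m)) \<le> real m / real (Suc m) - 1"
    using m by (intro ln_le_minus_one) auto
  then have "ln (real m) - ln (real (Suc m)) \<le> - 1 / real (Suc m)"
    using m by (simp add: ln_div field_simps)
  then have "real (Suc m) * (ln (real m) - ln (real (Suc m))) \<le> - 1"
    by (simp add: field_simps)
  then have "real (Suc m) * ln (real m) + 1 \<le> real (Suc m) * ln (real (Suc m))"
    by (simp add: right_diff_distrib)
  moreover have "ln (fact (Suc m)) = ln (real (Suc m)) + ln (fact m)"
    by (simp only: fact_Suc of_nat_mult of_nat_fact ln_mult_pos[of "real (Suc m)" "fact m"] fact_gt_zero of_nat_0_less_iff zero_less_Suc)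
  ultimately show ?case
    using step.IH by (simp add: algebra_simps)
qed simp

lemma measure_kac_shell_eq:
  assumes N: "N \<ge> 2"
  shows "measure (lborel_pow N) (kac_shell N)
    = (1 - sqrt ((real N - 1) / real N) ^ N) * (unit_ball_vol (real N) * sqrt (real N) ^ N)"
proof -
  have "kac_ball N = {f. sqrt (\<Sum>i\<in>{..<N}. (f i)\<^sup>2) \<le> sqrt (real N)} \<inter> space (lborel_pow N)"
    by (auto simp: kac_ball_def space_PiM)
  then have "emeasure (lborel_pow N) (kac_ball N) = ennreal (unit_ball_vol (real N) * sqrt (real N) ^ N)"
    using emeasure_cball_aux[of "{..<N}" "sqrt (real N)"] N by simp
  then show ?thesis
    using emeasure_kac_shell[OF N] kac_shell_shrink_factor[OF N]
    by (simp add: measure_def enn2real_mult)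
qed

text \<open>The shell is the fraction 1 - ?q of the ball, and (1 - 1/N)^N \<le> 1/e bounds ?q by exp
  (- 1/2). The parenthesis is the Stirling bound for the Gamma function in the volume of the unit
  ball.\<close>

lemma ln_measure_kac_shell_ge:
  assumes N: "N \<ge> 2"
  shows "ln (1 - exp (- 1 / 2)) + real N / 2 * ln pi + real N / 2 * ln (real N)
      - (1 + ln ((real N + 1) / 2) + (real N + 1) / 2 * ln ((real N + 1) / 2) - real N / 2)
    \<le> ln (measure (lborel_pow N) (kac_shell N))"
proof -
  let ?q = "sqrt ((real N - 1) / real N) ^ N"
  \<comment> \<open>\<open>N / 2\<close> rounded up, so that odd dimensions too are compared with a
    factorial; \<open>N \<ge> 2\<close> keeps the arguments of Gamma in its increasing
    range.\<close>
  define m where "m = (N + 1) div 2"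
  have m: "1 \<le> m" "real N / 2 \<le> real m" "real m \<le> (real N + 1) / 2"
  proof -
    have *: "N \<le> 2 * m" "2 * m \<le> N + 1" "1 \<le> m"
      using N unfolding m_def by presburger+
    then show "1 \<le> m" "real N / 2 \<le> real m" "real m \<le> (real N + 1) / 2"
      using of_nat_mono[OF *(1), where 'a = real] of_nat_mono[OF *(2), where 'a = real] by auto
  qed
  have "?q = sqrt ((1 - 1 / real N) ^ N)"
    using N by (simp add: real_sqrt_power diff_divide_distrib)
  also have "\<dots> \<le> sqrt (exp (- 1 / real N) ^ N)"
    using N exp_ge_add_one_self[of "- 1 / real N"] by (intro real_sqrt_le_mono power_mono) auto
  also have "exp (- 1 / real N) ^ N = exp (- 1)"
    using N by (simp flip: exp_of_nat_mult)
  also have "sqrt (exp (- 1)) = exp (- 1 / 2 :: real)"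
    by (rule real_sqrt_unique) (simp_all flip: exp_double)
  finally have q: "1 - exp (- 1 / 2) \<le> 1 - ?q"
    by simp
  have e: "exp (- 1 / 2 :: real) < 1"
    by simp
  have G: "0 < Gamma (real N / 2 + 1)"
    by (intro Gamma_real_pos) simp
  have "Gamma (real N / 2 + 1) \<le> Gamma (1 + real m)"
  proof (cases "real N / 2 + 1 = 1 + real m")
    case False
    then have "real N / 2 + 1 < 1 + real m"
      using m(2) by linarith
    then show ?thesis
      using N by (intro less_imp_le Gamma_real_strict_mono) auto
  next
    case True
    then show ?thesis by (simp only: order_refl)
  qed
  then have "Gamma (real N / 2 + 1) \<le> fact m"
    by (simp add: Gamma_fact)
  then have "ln (Gamma (real N / 2 + 1)) \<le> ln (fact m)"
    using G by (simp add: ln_le_cancel_iff)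
  also have "\<dots> \<le> 1 + ln (real m) + real m * ln (real m) - real m"
    by (rule ln_fact_le[OF m(1)])
  also have "\<dots> \<le> 1 + ln ((real N + 1) / 2) + (real N + 1) / 2 * ln ((real N + 1) / 2) - real N / 2"
  proof -
    have "ln (real m) \<le> ln ((real N + 1) / 2)"
      using m by (intro ln_mono) auto
    moreover have "real m * ln (real m) \<le> (real N + 1) / 2 * ln ((real N + 1) / 2)"
      using m calculation by (intro mult_mono) auto
    ultimately show ?thesis
      using m(2) by linarith
  qed
  finally have lnG: "ln (Gamma (real N / 2 + 1))
      \<le> 1 + ln ((real N + 1) / 2) + (real N + 1) / 2 * ln ((real N + 1) / 2) - real N / 2" .
  have "0 < 1 - exp (- 1 / 2 :: real)"
    using e by simp
  then have "ln (1 - exp (- 1 / 2)) \<le> ln (1 - ?q)"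
    by (rule ln_mono[OF q])
  then have q0: "0 < 1 - ?q" "ln (1 - exp (- 1 / 2)) \<le> ln (1 - ?q)"
    using kac_shell_shrink_factor[OF N] by auto
  have "ln (measure (lborel_pow N) (kac_shell N))
      = ln (1 - ?q) + (ln (unit_ball_vol (real N)) + ln (sqrt (real N) ^ N))"
    unfolding measure_kac_shell_eq[OF N] using q0(1) N
    by (subst ln_mult_pos; simp add: ln_mult_pos)
  also have "ln (unit_ball_vol (real N)) = real N / 2 * ln pi - ln (Gamma (real N / 2 + 1))"
    unfolding unit_ball_vol_def using less_imp_neq[OF G] by (simp add: ln_div ln_powr)
  also have "ln (sqrt (real N) ^ N) = real N / 2 * ln (real N)"
    using N by (simp add: ln_realpow ln_sqrt)
  finally show ?thesis
    using q0(2) lnG by linarith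
qed

lemma mixture_entropy_eventually_ge:
  assumes \<delta>: "admissible \<delta>"
  obtains r where "r \<longlonglongrightarrow> 1 / 2 * ln 2 - 1 / 8"
    "\<forall>\<^sub>F N in sequentially. ereal (r N) \<le> kac_entropy N (conditioned_tensor N (maxwellian_mixture (\<delta> N))) / ereal (real N)"
proof -
  define v where "v N = (ln (1 - exp (- 1 / 2)) + real N / 2 * ln pi + real N / 2 * ln (real N)
      - (1 + ln ((real N + 1) / 2) + (real N + 1) / 2 * ln ((real N + 1) / 2) - real N / 2)) / real N" for N
  \<comment> \<open>Normalised Hoeffding error at accuracy 1/8. Exact accuracy would lead to the
    limit (ln 2)/2, which exceeds the relative entropy of the chaotic limit by 1/4; half of this
    margin is given away.\<close>
  define e where "e N = 3 * ln (real N) * (2 * exp (- 2 * real N * (1 / 8)\<^sup>2 / (3 * ln (real N))\<^sup>2))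
      / (exp (- 3 * sqrt (real N)) / (100 * real N ^ 4))" for N
  define r where "r N = v N - (1 / 2 * ln pi - 3 / 2 * ln (1 - \<delta> N) + \<delta> N)
      - real N / (real N - 1) * (1 / 2 + \<delta> N * (3 * ln (real N)) + 1 / 8 + e N)" for N
  \<comment> \<open>The limit is the logarithm of sqrt (2 pi e), the growth per dimension of the
    volume of a ball of radius sqrt N. In the auxiliary statement \<open>K\<close> and
    \<open>P\<close> stand for the constants ln (1 - exp (- 1/2)) and ln pi.\<close>
  have v: "v \<longlonglongrightarrow> 1 / 2 * ln pi + 1 / 2 * ln 2 + 1 / 2"
  proof -
    have "(\<lambda>N. (K + real N / 2 * P + real N / 2 * ln (real N)
      - (1 + ln ((real N + 1) / 2) + (real N + 1) / 2 * ln ((real N + 1) / 2) - real N / 2)) / real N)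
      \<longlonglongrightarrow> 1 / 2 * P + 1 / 2 * ln 2 + 1 / 2" for K P :: real
      by (real_asymp simp: ln_div field_simps)
    then show ?thesis
      unfolding v_def .
  qed
  \<comment> \<open>The truncation level grows, so the exponent is only of order N/(ln N)^2, which
    still beats 3 sqrt N.\<close>
  have e: "e \<longlonglongrightarrow> 0"
    unfolding e_def by real_asymp
  have d: "\<delta> \<longlonglongrightarrow> 0"
    by (rule admissible_tendsto_0[OF \<delta>])
  have dl: "(\<lambda>N. \<delta> N * (3 * ln (real N))) \<longlonglongrightarrow> 0"
  proof (rule tendsto_sandwich)
    show "\<forall>\<^sub>F N in sequentially. 0 \<le> \<delta> N * (3 * ln (real N))"
      using admissible_eventually[OF \<delta>] eventually_ge_at_top[of "1::nat"]
      by eventually_elim (auto intro!: mult_nonneg_nonneg)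
    show "\<forall>\<^sub>F N in sequentially. \<delta> N * (3 * ln (real N)) \<le> 1 / sqrt (real N) * (3 * ln (real N))"
      using \<delta>[unfolded admissible_def] eventually_ge_at_top[of "1::nat"]
      by eventually_elim (rule mult_right_mono, auto)
    show "(\<lambda>N. 1 / sqrt (real N) * (3 * ln (real N))) \<longlonglongrightarrow> 0"
      by real_asymp
  qed simp
  have c: "(\<lambda>N. real N / (real N - 1)) \<longlonglongrightarrow> 1"
    by real_asymp
  have "r \<longlonglongrightarrow> (1 / 2 * ln pi + 1 / 2 * ln 2 + 1 / 2) - (1 / 2 * ln pi - 3 / 2 * ln (1 - 0) + 0) - 1 * (1 / 2 + 0 + 1 / 8 + 0)"
    unfolding r_def by (intro tendsto_intros v d dl c e) simp
  then have "r \<longlonglongrightarrow> 1 / 2 * ln 2 - 1 / 8"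
    by simp
  moreover have "\<forall>\<^sub>F N in sequentially. ereal (r N) \<le> kac_entropy N (conditioned_tensor N (maxwellian_mixture (\<delta> N))) / ereal (real N)"
    using admissible_eventually[OF \<delta>] eventually_ge_at_top[of "2::nat"]
  proof eventually_elim
    case (elim N)
    let ?b = "exp (- 3 * sqrt (real N)) / (100 * real N ^ 4)"
    let ?H = "kac_entropy N (conditioned_tensor N (maxwellian_mixture (\<delta> N)))"
    have N: "0 < real N" "N \<ge> 2"
      using elim by auto
    have "real N * v N \<le> ln (measure (lborel_pow N) (kac_shell N))"
      using ln_measure_kac_shell_ge[OF N(2)] N by (simp add: v_def)
    then have "ereal (real N * r N) \<le> ereal (ln (measure (lborel_pow N) (kac_shell N))
      - real N * (1 / 2 * ln pi - 3 / 2 * ln (1 - \<delta> N) + \<delta> N)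
      - real N * (real N / (real N - 1) * (1 / 2 + \<delta> N * (3 * ln (real N)) + 1 / 8 + e N)))"
      unfolding r_def by (simp only: ereal_less_eq right_diff_distrib)
    also have "\<dots> \<le> ?H"
      unfolding e_def using elim N by (intro mixture_entropy_ge) auto
    finally have "ereal (real N * r N) \<le> ?H" .
    then show ?case
      using N by (subst ereal_le_divide_pos) (auto simp: mult.commute)
  qed
  ultimately show ?thesis
    using that by blast
qed

section \<open>Relative entropy and uniqueness of the chaotic limit\<close>

lemma relative_entropy_maxwellian:
  "relative_entropy (maxwellian (1 / 2)) std_normal_density = ereal (1 / 2 * ln 2 - 1 / 4)"
proof -
  have eq: "maxwellian (1 / 2) x * ln (maxwellian (1 / 2) x / std_normal_density x)
      = 1 / 2 * ln 2 * maxwellian (1 / 2) x - 1 / 2 * (maxwellian (1 / 2) x * x\<^sup>2)" for x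
  proof -
    have M: "maxwellian (1 / 2) x = exp (- x\<^sup>2) / sqrt pi"
      by (simp add: maxwellian_def)
    have "maxwellian (1 / 2) x / std_normal_density x = sqrt 2 * exp (- x\<^sup>2 / 2)"
      by (simp add: M std_normal_density_def real_sqrt_mult field_simps flip: exp_add)
    then have L: "ln (maxwellian (1 / 2) x / std_normal_density x) = 1 / 2 * ln 2 - x\<^sup>2 / 2"
      by (simp add: ln_mult ln_sqrt)
    show ?thesis
      unfolding L by (simp add: algebra_simps)
  qed
  have M: "has_bochner_integral lborel (maxwellian (1 / 2)) 1"
    using normal_moment_even[of "sqrt (1 / 2)" 0 0] by (simp add: maxwellian_eq_normal_density)
  have M2: "has_bochner_integral lborel (\<lambda>x. maxwellian (1 / 2) x * x\<^sup>2) (1 / 2)"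
    using normal_moment_even[of "sqrt (1 / 2)" 0 1]
    by (simp add: maxwellian_eq_normal_density fact_numeral)
  have "has_bochner_integral lborel
      (\<lambda>x. 1 / 2 * ln 2 * maxwellian (1 / 2) x - 1 / 2 * (maxwellian (1 / 2) x * x\<^sup>2)) (1 / 2 * ln 2 * 1 - 1 / 2 * (1 / 2))"
    by (intro has_bochner_integral_diff has_bochner_integral_mult_right M M2)
  then show ?thesis
    by (simp add: relative_entropy_def eq extended_integral_integrable has_bochner_integral_iff)
qed

lemma chaotic_limit_integral:
  assumes F: "chaotic F f" and u: "continuous_on UNIV u" "\<And>x. \<bar>u x\<bar> \<le> C"
  shows "(\<lambda>N. \<integral>v. F N v * u (v 0) \<partial>kac_measure N) \<longlonglongrightarrow> (\<integral>x. f x * u x \<partial>lborel)"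
proof -
  interpret product_sigma_finite "\<lambda>_. lborel :: real measure"
    by (rule product_sigma_finite_lborel)
  have [measurable]: "f \<in> borel_measurable borel"
    using F by (simp add: chaotic_def real_density_def)
  have [measurable]: "u \<in> borel_measurable borel"
    by (rule borel_measurable_continuous_onI[OF u(1)])
  have "continuous_map (powertop_real {..<1::nat}) euclideanreal (u \<circ> (\<lambda>v. v 0))"
  proof (rule continuous_map_compose)
    show "continuous_map (powertop_real {..<1::nat}) euclideanreal (\<lambda>v. v 0)"
      by (intro continuous_map_product_projection) simp
  qed (use u(1) in simp)
  moreover have "bounded ((\<lambda>v. u (v 0)) ` ({..<1::nat} \<rightarrow>\<^sub>E UNIV))"
    using u(2) by (auto simp: bounded_iff)
  ultimately have "(\<lambda>N. \<integral>v. F N v * u (restrict v {..<1} 0) \<partial>kac_measure N)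
      \<longlonglongrightarrow> (\<integral>v. (\<Prod>i<1. f (v i)) * u (v 0) \<partial>(\<Pi>\<^sub>M i\<in>{..<1::nat}. lborel))"
    using F unfolding chaotic_def o_def by blast
  moreover have "(\<integral>v. (\<Prod>i<1. f (v i)) * u (v 0) \<partial>(\<Pi>\<^sub>M i\<in>{..<1::nat}. lborel)) = (\<integral>x. f x * u x \<partial>lborel)"
    using product_integral_singleton[of "\<lambda>x. f x * u x" "0::nat"] by (simp add: lessThan_Suc)
  ultimately show ?thesis
    by simp
qed

lemma char_real_density:
  assumes f: "real_density f"
  shows "char (density lborel (\<lambda>x. ennreal (f x))) t
    = Complex (\<integral>x. f x * cos (t * x) \<partial>lborel) (\<integral>x. f x * sin (t * x) \<partial>lborel)"
proof -
  let ?D = "density lborel (\<lambda>x. ennreal (f x))"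
  interpret prob_space ?D
    by (rule prob_space_real_density[OF f])
  have [measurable]: "f \<in> borel_measurable borel" and nn: "\<And>x. 0 \<le> f x"
    using f by (auto simp: real_density_def)
  have int: "complex_integrable ?D (\<lambda>x. iexp (t * x))"
    using integrable_iexp[of "\<lambda>x. complex_of_real (t * x)"] by simp
  have "Re (char ?D t) = (\<integral>x. cos (t * x) \<partial>?D)" "Im (char ?D t) = (\<integral>x. sin (t * x) \<partial>?D)"
    using int unfolding char_def
    by (simp_all add: integral_Re[symmetric] integral_Im[symmetric] Re_exp Im_exp)
  then show ?thesis
    using nn by (simp add: complex_eq_iff integral_density)
qed

text \<open>First marginals suffice: testing them with x \<mapsto> cos (t x) and x \<mapsto> sin (t
  x), which are bounded and continuous, identifies the characteristic functions, and Levy's theorem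
  identifies the laws.\<close>

lemma chaotic_unique:
  assumes F: "chaotic F f" "chaotic F g"
  shows "AE x in lborel. f x = g x"
proof -
  have f: "real_density f" and g: "real_density g"
    using F by (auto simp: chaotic_def)
  have [measurable]: "f \<in> borel_measurable borel" "g \<in> borel_measurable borel"
    using f g by (auto simp: real_density_def)
  have eq: "(\<integral>x. f x * u x \<partial>lborel) = (\<integral>x. g x * u x \<partial>lborel)"
    if "continuous_on UNIV u" "\<And>x. \<bar>u x\<bar> \<le> 1" for u
    using LIMSEQ_unique[OF chaotic_limit_integral[OF F(1) that] chaotic_limit_integral[OF F(2) that]] .
  have "density lborel (\<lambda>x. ennreal (f x)) = density lborel (\<lambda>x. ennreal (g x))"
  proof (rule Levy_uniqueness)
    show "real_distribution (density lborel (\<lambda>x. ennreal (f x)))" "real_distribution (density lborel (\<lambda>x. ennreal (g x)))"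
      using f g by (auto simp: real_distribution_def real_distribution_axioms_def intro: prob_space_real_density)
    show "char (density lborel (\<lambda>x. ennreal (f x))) = char (density lborel (\<lambda>x. ennreal (g x)))"
    proof
      fix t
      show "char (density lborel (\<lambda>x. ennreal (f x))) t = char (density lborel (\<lambda>x. ennreal (g x))) t"
        unfolding char_real_density[OF f] char_real_density[OF g]
        using eq[of "\<lambda>x. cos (t * x)"] eq[of "\<lambda>x. sin (t * x)"] by (simp add: continuous_intros)
    qed
  qed
  then have "AE x in lborel. ennreal (f x) = ennreal (g x)"
    using f by (subst (asm) finite_density_unique) (auto simp: real_density_def)
  then show ?thesis
    using f g by (auto simp: real_density_def elim!: eventually_mono)
qed

lemma relative_entropy_cong:
  assumes "AE x in lborel. f x = g x"
  shows "relative_entropy f h = relative_entropy g h"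
proof -
  have "(\<integral>\<^sup>+x. ennreal (f x * ln (f x / h x)) \<partial>lborel) = (\<integral>\<^sup>+x. ennreal (g x * ln (g x / h x)) \<partial>lborel)"
    "(\<integral>\<^sup>+x. ennreal (- (f x * ln (f x / h x))) \<partial>lborel) = (\<integral>\<^sup>+x. ennreal (- (g x * ln (g x / h x))) \<partial>lborel)"
    using assms by (auto intro!: nn_integral_cong_AE elim!: eventually_mono)
  then show ?thesis
    by (simp add: relative_entropy_def extended_integral_def)
qed

lemma not_entropically_chaotic_mixture:
  assumes \<delta>: "admissible \<delta>" and range: "\<And>N. N \<ge> 1 \<Longrightarrow> 0 < \<delta> N \<and> \<delta> N \<le> 1"
  shows "\<not> entropically_chaotic (\<lambda>N. conditioned_tensor N (maxwellian_mixture (\<delta> N)))"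
proof
  let ?F = "\<lambda>N. conditioned_tensor N (maxwellian_mixture (\<delta> N))"
  assume "entropically_chaotic ?F"
  then obtain f where f: "chaotic ?F f"
    and lim: "(\<lambda>N. kac_entropy N (?F N) / ereal (real N)) \<longlonglongrightarrow> relative_entropy f std_normal_density"
    by (auto simp: entropically_chaotic_def)
  have "relative_entropy f std_normal_density = ereal (1 / 2 * ln 2 - 1 / 4)"
    using relative_entropy_cong[OF chaotic_unique[OF f chaotic_mixture[OF \<delta> range]]] relative_entropy_maxwellian
    by simp
  moreover obtain r where r: "r \<longlonglongrightarrow> 1 / 2 * ln 2 - 1 / 8"
    "\<forall>\<^sub>F N in sequentially. ereal (r N) \<le> kac_entropy N (?F N) / ereal (real N)"
    using mixture_entropy_eventually_ge[OF \<delta>] .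
  have "ereal (1 / 2 * ln 2 - 1 / 8) \<le> relative_entropy f std_normal_density"
    by (rule tendsto_le[OF _ lim tendsto_ereal[OF r(1)] r(2)]) simp
  ultimately show False
    by simp
qed

lemma admissible_powr:
  assumes "1 / 2 < \<eta>" "\<eta> < 2"
  shows "admissible (\<lambda>N. 1 / real N powr \<eta>)"
  unfolding admissible_def using eventually_ge_at_top[of "1::nat"]
proof eventually_elim
  case (elim N)
  have "sqrt (real N) \<le> real N powr \<eta>"
    using elim assms powr_mono[of "1 / 2" \<eta> "real N"] by (simp add: powr_half_sqrt)
  moreover have "real N powr \<eta> \<le> (real N)\<^sup>2"
    using elim assms powr_mono[of \<eta> 2 "real N"] by (simp add: powr_numeral)
  ultimately show ?case
    using elim by (auto intro!: divide_left_mono)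
qed

theorem theorem1p7:
  shows "\<forall>\<^sub>F \<eta> in nhds (1::real).
    let \<delta> = (\<lambda>N::nat. 1 / real N powr \<eta>);
        F = (\<lambda>N. conditioned_tensor N (maxwellian_mixture (\<delta> N)))
    in chaotic F (maxwellian (1/2)) \<and> \<not> entropically_chaotic F"
proof -
  \<comment> \<open>"Close to 1" is made explicit: this whole interval is the range in which
    \<open>admissible_powr\<close> applies.\<close>
  have "\<forall>\<^sub>F \<eta> in nhds (1::real). \<eta> \<in> {1 / 2<..<2}"
    by (intro eventually_nhds_in_open) auto
  then show ?thesis
  proof eventually_elim
    case (elim \<eta>)
    have range: "0 < 1 / real N powr \<eta> \<and> 1 / real N powr \<eta> \<le> 1" if "N \<ge> 1" for N
      using that elim ge_one_powr_ge_zero[of "real N" \<eta>] by simp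
    have "admissible (\<lambda>N. 1 / real N powr \<eta>)"
      using elim by (intro admissible_powr) auto
    then show ?case
      unfolding Let_def using chaotic_mixture not_entropically_chaotic_mixture range by blast
  qed
qed

end
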